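(* Let $(n_k)_{k\ge1}$ be a sequence of positive integers satisfying the Hadamard gap condition $n_{k+1}/n_k\ge q$ for all $k\ge1$, for some $q>1$. Let $(g_N)_{N\in\mathbb{N}}$ be a sequence such that $1\le g_N\le N$ for all $N\in\mathbb{N}$, such that both $g_N$ and $N/g_N$ are monotone increasing in $N$, and such that $g_N\to\infty$. Let $f:\mathbb{R}\to\mathbb{R}$ be a trigonometric polynomial of degree $d$, not identically zero, with mean zero. Assume that $$L(N,a,b)=O\!\left(\frac{N}{g_N}\right)\qquad\text{as } N\to\infty,\ \text{for all } a,b\in\{1,\dots,d\}.$$ Let $\varepsilon>0$. Then $$\lim_{N\to\infty}\ \sup_{0\le t\le (1-\varepsilon)\sqrt{2\log g_N}}\ \frac{\mathbb{P}\left[S_N\ge t\,\|f\|_2\sqrt{N}\right]}{1-\Phi(t)}=1 .$$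
   Context: A trigonometric polynomial of degree $d$ with mean zero is a function $f(x)=\sum_{j=1}^d \left(c_j\cos(2\pi jx)+s_j\sin(2\pi jx)\right)$ with real coefficients. $\|f\|_2=\left(\int_0^1 f(x)^2\,dx\right)^{1/2}$. The probability $\mathbb{P}$ is Lebesgue measure on $[0,1]$ (with the Borel $\sigma$-field), and $S_N(x)=\sum_{k=1}^N f(n_kx)$ for $x\in[0,1]$. $\Phi$ denotes the standard normal distribution function. For $a,b\in\mathbb{N}$, $L(N,a,b):=\sup_{c\in\mathbb{Z}}\#\{(k,\ell): 1\le k,\ell\le N,\ a n_k-b n_\ell=c\}$, where in the case $a=b$ the supremum is taken only over $c\neq0$; the implied constant in the $O$-term may depend on $a,b$.
   Formalization: The formal theorem assumes 0 < ε ≤ 1 rather than only ε > 0: for ε > 1 the range 0 ≤ t ≤ (1−ε)√(2 log g_N) is eventually empty, so the supremum is undefined and the limit cannot be 1. *)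

theory Defs
  imports "HOL-Probability.Probability" "HOL-Library.Landau_Symbols"
begin

(* The coefficients of top order are allowed to vanish, so d is an upper bound for the exact
   degree of f. *)
definition mean_zero_trig_poly :: "nat \<Rightarrow> (real \<Rightarrow> real) \<Rightarrow> bool" where
  "mean_zero_trig_poly d f \<longleftrightarrow>
     (\<exists>c s :: nat \<Rightarrow> real. \<forall>x. f x =
        (\<Sum>j=1..d. c j * cos (2 * pi * real j * x) + s j * sin (2 * pi * real j * x)))"

definition L2norm :: "(real \<Rightarrow> real) \<Rightarrow> real" where
  "L2norm f = sqrt (LINT x:{0..1}|lborel. (f x)\<^sup>2)"

(* Sequences are indexed from 1; the value n 0 is never used. *)
definition lacunary_sum :: "(nat \<Rightarrow> nat) \<Rightarrow> (real \<Rightarrow> real) \<Rightarrow> nat \<Rightarrow> real \<Rightarrow> real" where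
  "lacunary_sum n f N x = (\<Sum>k=1..N. f (real (n k) * x))"

abbreviation unit_lebesgue :: "real measure" where
  "unit_lebesgue \<equiv> restrict_space lborel {0..1}"

definition Phi :: "real \<Rightarrow> real" where
  "Phi = cdf std_normal_distribution"

(* The supremum on nat is a genuine one: the cardinalities are bounded by N ^ 2, and the index
   set for c is never empty. *)
definition dioph_count :: "(nat \<Rightarrow> nat) \<Rightarrow> nat \<Rightarrow> nat \<Rightarrow> nat \<Rightarrow> nat" where
  "dioph_count n N a b =
     (SUP c \<in> {c :: int. a = b \<longrightarrow> c \<noteq> 0}.
        card {(k, l). k \<in> {1..N} \<and> l \<in> {1..N} \<and> int a * int (n k) - int b * int (n l) = c})"

end

(* Only the upper bound is at stake: applied to f and to -f at t = 0 it already forces the ratio at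
   t = 0 to tend to 1, and the supremum is at least that ratio.

   Cut the indices into blocks of length B, a power of log g, and let M_i be the average of
   S_N / (|f| sqrt N) over the dyadic intervals of length about 1/n_k, k the end of the i-th block.
   This is a martingale with increments of order B / sqrt N, and by lacunarity M_i differs from the
   sum of the first i blocks by O(1 / sqrt N) only. Hence, up to small errors, its conditional variance
   is the normalised sum of the squared block sums, a trigonometric polynomial whose variance is O(B / g)
   by Parseval and the bound on L(N,a,b). By Chebyshev the conditional variance is close to 1 outside a
   set of measure g^(-1+o(1)), which is negligible against 1 - Phi(t) for t <= (1-eps) sqrt(2 log g).

   On the rest run the Lindeberg argument multiplicatively: U(s,x) = kappa + 1 - Phi((tau-x)/sqrt s)
   solves the heat equation and, thanks to the tiny constant kappa, its derivatives are at most
   K^j U with K a power of log g. So U(T - V_i, M_i), stopped when the conditional variance V_i exceeds T,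
   is a supermartingale up to a factor 1 + o(1), and this gives a relative rather than absolute error. *)
theory Submission
  imports Defs "HOL-Real_Asymp.Real_Asymp"
begin

section \<open>The Gaussian tail\<close>

text \<open>Write \<open>l = ln (g N)\<close>. Since 1 - Phi(t) can be as small as about
  g^(-(1-eps)^2), an additive approximation error of order g^(-1/2) would be useless for small eps.
  All parameters are powers of l: smoothing time and variance tolerance l^-3, level shift 1/l, kappa
  = 400 g^-2. As t is O(sqrt l), moving the level by O(1/l) changes 1 - Phi(t) only by a factor
  exp(O(1/sqrt l)); and 1/l is large against the smoothing width l^(-3/2). The constant kappa is
  needed because the logarithmic derivative of a Gaussian tail at y grows like y; beyond |y| = Y =
  2l the constant takes over. Two demands fix the block length l^8. Blocks must be long: each block
  costs a squared error O(1/N) from replacing block sums by martingale increments, inflated by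
  1/delta, and the total over N/B blocks has to stay below delta. Blocks must be short: K^3 times
  the largest increment has to tend to 0. The conditional variance is not directly accessible. It is
  compared with the sum of squared increments, from which it differs by a martingale, and that sum
  is compared pointwise with the squared block sums.\<close>

definition gauss_tail :: "real \<Rightarrow> real" where
  "gauss_tail y = 1 - Phi y"

interpretation std_normal: real_distribution std_normal_distribution
  by (rule real_dist_normal_dist)

lemma std_normal_density_continuous: "continuous_on A std_normal_density"
  unfolding std_normal_density_def by (intro continuous_intros) auto

lemma std_normal_density_deriv:
  "(std_normal_density has_real_derivative - y * std_normal_density y) (at y)"
  unfolding std_normal_density_def
  by (auto intro!: derivative_eq_intros simp: field_simps)

lemma std_normal_density_minus: "std_normal_density (- y) = std_normal_density y"
  by (simp add: std_normal_density_def)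

lemma Phi_diff:
  assumes "a \<le> b"
  shows "((\<lambda>y. std_normal_density y) has_integral (Phi b - Phi a)) {a..b}"
proof (cases "a = b")
  case False
  with assms have "a < b" by simp
  have int: "std_normal_density absolutely_integrable_on {a..b}"
    by (rule absolutely_integrable_continuous_real) (rule std_normal_density_continuous)
  have "Phi b - Phi a = measure std_normal_distribution {a<..b}"
    unfolding Phi_def by (rule std_normal.cdf_diff_eq) fact
  also have "\<dots> = measure std_normal_distribution {a..b}"
  proof -
    have "AE x in lborel. x \<noteq> a" by (rule AE_lborel_singleton)
    hence "AE x in std_normal_distribution. x \<noteq> a"
      by (subst AE_density) (auto elim: AE_mp)
    hence "AE x in std_normal_distribution. x \<in> {a<..b} \<longleftrightarrow> x \<in> {a..b}"
      by eventually_elim auto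
    thus ?thesis by (intro measure_eq_AE) auto
  qed
  also have "\<dots> = (LINT x:{a..b}|lborel. std_normal_density x)"
  proof -
    have "emeasure std_normal_distribution {a..b} =
        (\<integral>\<^sup>+x. ennreal (std_normal_density x * indicator {a..b} x) \<partial>lborel)"
      by (subst emeasure_density) (auto intro!: nn_integral_cong simp: indicator_def)
    also have "\<dots> = ennreal (LINT x|lborel. std_normal_density x * indicator {a..b} x)"
    proof (rule nn_integral_eq_integral)
      have "set_integrable lborel {a..b} std_normal_density"
        by (rule borel_integrable_atLeastAtMost') (rule std_normal_density_continuous)
      thus "integrable lborel (\<lambda>x. std_normal_density x * indicator {a..b} x)"
        by (simp add: set_integrable_def mult.commute)
    qed (auto simp: indicator_def)
    finally show ?thesis
      by (simp add: measure_def set_lebesgue_integral_def mult.commute)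
  qed
  also have "\<dots> = integral {a..b} std_normal_density"
    by (rule set_borel_integral_eq_integral)
       (rule borel_integrable_atLeastAtMost'[OF std_normal_density_continuous])
  finally show ?thesis
    using int by (metis integrable_integral set_lebesgue_integral_eq_integral(1))
qed auto

lemma gauss_tail_deriv:
  "(gauss_tail has_real_derivative - std_normal_density y) (at y)"
proof -
  \<comment> \<open>The base point \<open>y - 1\<close> makes \<open>y\<close> an interior point of
    the interval, so that the derivative within the interval is a full derivative.\<close>
  define F where "F = (\<lambda>u. integral {y - 1..u} std_normal_density)"
  have "(F has_real_derivative std_normal_density y) (at y within {y-1..y+1})"
    unfolding F_def by (rule integral_has_real_derivative)
      (auto intro: std_normal_density_continuous)
  moreover have "at y within {y-1..y+1} = at y"
    by (rule at_within_interior) (auto simp: interior_atLeastAtMost_real)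
  ultimately have "(F has_real_derivative std_normal_density y) (at y)" by simp
  hence "((\<lambda>u. 1 - Phi (y-1) - F u) has_real_derivative - std_normal_density y) (at y)"
    by (auto intro!: derivative_eq_intros)
  thus ?thesis
  proof (rule has_field_derivative_transform_within_open)
    show "open {y-1<..}" "y \<in> {y-1<..}" by auto
    show "1 - Phi (y-1) - F u = gauss_tail u" if "u \<in> {y-1<..}" for u
      using integral_unique[OF Phi_diff[of "y-1" u]] that by (simp add: F_def gauss_tail_def)
  qed
qed

lemmas gauss_tail_deriv' [derivative_intros] = DERIV_chain2[OF gauss_tail_deriv]
lemmas std_normal_density_deriv' [derivative_intros] = DERIV_chain2[OF std_normal_density_deriv]

lemma gauss_tail_antimono: "y \<le> z \<Longrightarrow> gauss_tail z \<le> gauss_tail y"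
  by (simp add: gauss_tail_def Phi_def std_normal.cdf_nondecreasing)

lemma gauss_tail_tendsto: "(gauss_tail \<longlongrightarrow> 0) at_top"
  unfolding gauss_tail_def Phi_def
  by (rule tendsto_eq_intros std_normal.cdf_lim_at_top_prob refl)+ simp

text \<open>The density is even, so the sum of the two opposite tails has derivative 0; its constant
  value is read off at infinity.\<close>

lemma gauss_tail_minus: "gauss_tail (- y) = 1 - gauss_tail y"
proof -
  define H where "H = (\<lambda>y. gauss_tail y + gauss_tail (- y))"
  have "(H has_real_derivative 0) (at y)" for y
    unfolding H_def
    by (rule derivative_eq_intros refl)+ (simp add: std_normal_density_minus)
  hence const: "H y = H z" for y z using DERIV_isconst_all by blast
  have "(gauss_tail \<longlongrightarrow> 1) at_bot"
    unfolding gauss_tail_def Phi_def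
    by (rule tendsto_eq_intros std_normal.cdf_lim_at_bot refl)+ simp
  hence "((\<lambda>y. gauss_tail (- y)) \<longlongrightarrow> 1) at_top"
    by (rule filterlim_compose) (rule filterlim_uminus_at_bot_at_top)
  hence "(H \<longlongrightarrow> 0 + 1) at_top"
    unfolding H_def by (intro tendsto_add gauss_tail_tendsto)
  moreover have "H = (\<lambda>_. H y)" using const by auto
  ultimately have "((\<lambda>_::real. H y) \<longlongrightarrow> 1) at_top" by simp
  hence "H y = 1" by (simp add: tendsto_const_iff)
  thus ?thesis by (simp add: H_def)
qed

lemma gauss_tail_0: "gauss_tail 0 = 1 / 2"
  using gauss_tail_minus[of 0] by simp

lemma gauss_tail_nonneg: "0 \<le> gauss_tail y"
  by (simp add: gauss_tail_def Phi_def std_normal.cdf_bounded_prob)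

lemma std_normal_density_le_half: "std_normal_density y \<le> 1 / 2"
proof -
  have "2 \<le> sqrt (2 * pi)" using pi_gt3 by (intro real_le_rsqrt) auto
  hence "1 / sqrt (2 * pi) \<le> 1 / 2" by (simp add: field_simps)
  moreover have "exp (- y\<^sup>2 / 2) \<le> 1" by simp
  ultimately have "1 / sqrt (2 * pi) * exp (- y\<^sup>2 / 2) \<le> 1 / 2 * 1"
    by (intro mult_mono) auto
  thus ?thesis by (simp add: std_normal_density_def)
qed

text \<open>After division by \<open>1 + y\<close> the difference of the two sides is monotone, and it tends to 0 at
  infinity.\<close>
lemma mills_ratio_pos:
  assumes "y \<ge> 0"
  shows "std_normal_density y \<le> (1 + y) * gauss_tail y"
proof -
  define F where "F = (\<lambda>y. gauss_tail y - std_normal_density y / (1 + y))"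
  have der: "\<exists>D. (F has_real_derivative D) (at z) \<and> D \<le> 0" if "z \<ge> 0" for z
  proof -
    have "(F has_real_derivative - std_normal_density z -
       ((- z * std_normal_density z) * (1 + z) - std_normal_density z) / ((1+z)*(1+z))) (at z)"
      unfolding F_def using that
      by (auto intro!: derivative_eq_intros gauss_tail_deriv std_normal_density_deriv)
    also have "- std_normal_density z -
       ((- z * std_normal_density z) * (1 + z) - std_normal_density z) / ((1+z)*(1+z))
        = - std_normal_density z * (z / ((1+z)*(1+z)))"
      using that by (simp add: divide_simps) (simp add: algebra_simps)
    finally show ?thesis using that by (intro exI conjI) (auto simp: mult_nonneg_nonneg)
  qed
  have mono: "F z \<le> F y" if "z \<ge> y" for z
    by (rule DERIV_nonpos_imp_nonincreasing[OF that]) (use der assms in force)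
  have "((\<lambda>z. std_normal_density z / (1 + z)) \<longlongrightarrow> 0) at_top"
  proof (rule tendsto_sandwich)
    show "\<forall>\<^sub>F z in at_top. std_normal_density z / (1 + z) \<le> 1 / (1 + z)"
      using eventually_ge_at_top[of 0]
    proof eventually_elim
      case (elim z)
      thus ?case using std_normal_density_le_half[of z] by (intro divide_right_mono) auto
    qed
    show "\<forall>\<^sub>F z in at_top. 0 \<le> std_normal_density z / (1 + z)"
      using eventually_ge_at_top[of 0] by eventually_elim auto
    show "((\<lambda>z::real. 1 / (1 + z)) \<longlongrightarrow> 0) at_top"
      by (rule tendsto_divide_0[OF tendsto_const filterlim_at_top_imp_at_infinity[OF
            filterlim_tendsto_add_at_top[OF tendsto_const filterlim_ident]]])
  qed auto
  hence "(F \<longlongrightarrow> 0 - 0) at_top"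
    unfolding F_def by (intro tendsto_diff gauss_tail_tendsto)
  hence "0 \<le> F y"
    by (intro tendsto_upperbound[where F = at_top and f = F])
       (auto simp: eventually_at_top_linorder intro!: exI[of _ y] mono)
  thus ?thesis using assms by (simp add: F_def field_simps)
qed

lemma std_normal_density_le_tail_neg:
  assumes "y \<le> 0"
  shows "std_normal_density y \<le> gauss_tail y"
  using std_normal_density_le_half[of y] gauss_tail_antimono[OF assms] gauss_tail_0 by simp

lemma gauss_tail_pos: "0 < gauss_tail y"
proof (cases "y \<ge> 0")
  case True
  have "0 < std_normal_density y" by (simp add: normal_density_pos)
  also have "\<dots> \<le> (1 + y) * gauss_tail y" by (rule mills_ratio_pos[OF True])
  finally show ?thesis using True by (simp add: zero_less_mult_iff)
next
  case False
  thus ?thesis using gauss_tail_antimono[of y 0] gauss_tail_0 by simp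
qed

lemma mills_ratio: "std_normal_density y \<le> (1 + \<bar>y\<bar>) * gauss_tail y"
proof (cases "y \<ge> 0")
  case False
  have "std_normal_density y \<le> 1 * gauss_tail y"
    using False std_normal_density_le_tail_neg by simp
  also have "\<dots> \<le> (1 + \<bar>y\<bar>) * gauss_tail y"
    by (intro mult_right_mono gauss_tail_nonneg) auto
  finally show ?thesis .
qed (use mills_ratio_pos in auto)

text \<open>By the Mills ratio the logarithmic derivative of the tail is at least
  \<open>- (1 + t)\<close> on the whole half-line up to \<open>t\<close>, so
  \<open>gauss_tail z * exp ((1 + t) * z)\<close> increases there. This turns additive errors in the
  argument into relative errors of the tail.\<close>

lemma gauss_tail_shift:
  assumes "t \<ge> 0" "y \<le> t"
  shows "gauss_tail y \<le> gauss_tail t * exp ((1 + t) * (t - y))"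
proof -
  define H where "H = (\<lambda>z. gauss_tail z * exp ((1 + t) * z))"
  have "\<exists>D. (H has_real_derivative D) (at z) \<and> 0 \<le> D" if "z \<le> t" for z
  proof -
    have "std_normal_density z \<le> (1 + t) * gauss_tail z"
    proof (cases "z \<ge> 0")
      case True
      have "std_normal_density z \<le> (1 + z) * gauss_tail z" by (rule mills_ratio_pos[OF True])
      also have "\<dots> \<le> (1 + t) * gauss_tail z"
        using that by (intro mult_right_mono gauss_tail_nonneg) auto
      finally show ?thesis .
    next
      case False
      have "1 * gauss_tail z \<le> (1 + t) * gauss_tail z"
        using assms by (intro mult_right_mono gauss_tail_nonneg) auto
      thus ?thesis using False std_normal_density_le_tail_neg[of z] by simp
    qed
    moreover have "(H has_real_derivative
        exp ((1 + t) * z) * ((1 + t) * gauss_tail z - std_normal_density z)) (at z)"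
      unfolding H_def
      by (auto intro!: derivative_eq_intros gauss_tail_deriv simp: algebra_simps)
    ultimately show ?thesis by (intro exI conjI) auto
  qed
  hence "H y \<le> H t"
    by (intro DERIV_nonneg_imp_nondecreasing[OF assms(2)]) auto
  thus ?thesis by (simp add: H_def exp_diff field_simps)
qed

section \<open>A positive solution of the heat equation with bounded logarithmic derivatives\<close>

locale heat_tail =
  fixes Y \<tau> s0 :: real
  assumes Y_nonneg: "Y \<ge> 0" and s0_pos: "s0 > 0"
begin

text \<open>Apart from the constant, this is the probability that \<open>x\<close> plus a centred
  Gaussian of variance \<open>s\<close> exceeds \<open>\<tau>\<close>, that is, the half-line
  indicator after heat flow for time \<open>s\<close>. The constant solves the heat equation
  too.\<close>

definition U :: "real \<Rightarrow> real \<Rightarrow> real" where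
  "U s x = 400 * exp (- Y) + gauss_tail ((\<tau> - x) / sqrt s)"

text \<open>The price of one derivative in \<open>x\<close> relative to \<open>U\<close>: a factor
  \<open>1 + Y\<close> from the Mills ratio and the polynomial factors, and
  \<open>1 / sqrt s0\<close> from scaling. A derivative in time costs
  \<open>K\<^sup>2\<close>.\<close>

definition K :: real where
  "K = (1 + Y) / sqrt s0"

lemma K_pos: "K > 0"
  using Y_nonneg s0_pos by (simp add: K_def)

lemma U_pos: "U s x > 0"
  by (simp add: U_def add_pos_nonneg gauss_tail_nonneg)

text \<open>For \<open>\<bar>y\<bar> \<le> Y\<close> the Mills ratio trades the density for the
  tail. Beyond \<open>Y\<close> the density beats any cubic polynomial and falls below the
  constant.\<close>

lemma density_times_power_bound:
  assumes "k \<le> 3"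
  shows "std_normal_density y * (1 + \<bar>y\<bar>) ^ k \<le> (1 + Y) ^ Suc k * (400 * exp (- Y) + gauss_tail y)"
proof (cases "\<bar>y\<bar> \<le> Y")
  case True
  have "std_normal_density y * (1 + \<bar>y\<bar>) ^ k \<le> ((1 + \<bar>y\<bar>) * gauss_tail y) * (1 + \<bar>y\<bar>) ^ k"
    by (intro mult_right_mono mills_ratio) auto
  also have "\<dots> = (1 + \<bar>y\<bar>) ^ Suc k * gauss_tail y" by simp
  also have "\<dots> \<le> (1 + Y) ^ Suc k * (400 * exp (- Y) + gauss_tail y)"
    using True by (intro mult_mono power_mono) (auto simp: gauss_tail_nonneg)
  finally show ?thesis .
next
  case False
  define a where "a = \<bar>y\<bar>"
  have a: "a \<ge> Y" "a \<ge> 0" using False by (auto simp: a_def)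
  have "(1 + a) ^ 3 \<le> 27 * exp (1 + a)"
  proof -
    have "(1 + a) / 3 \<le> exp ((1 + a) / 3)"
      using exp_ge_add_one_self[of "(1 + a) / 3"] by linarith
    hence "((1 + a) / 3) ^ 3 \<le> exp ((1 + a) / 3) ^ 3"
      using a by (intro power_mono) auto
    also have "\<dots> = exp (1 + a)" by (simp flip: exp_of_nat_mult)
    finally show ?thesis by (simp add: power_divide)
  qed
  moreover have "(1 + a) ^ k \<le> (1 + a) ^ 3" using a assms by (intro power_increasing) auto
  ultimately have 1: "(1 + a) ^ k \<le> 27 * exp (1 + a)" by linarith
  have "2 \<le> sqrt (2 * pi)" using pi_gt3 by (intro real_le_rsqrt) auto
  hence "1 / sqrt (2 * pi) \<le> 1 / 2" by (simp add: field_simps)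
  hence 2: "std_normal_density y \<le> 1 / 2 * exp (- a\<^sup>2 / 2)"
    unfolding std_normal_density_def a_def by (intro mult_mono) auto
  have "std_normal_density y * (1 + a) ^ k \<le> (1 / 2 * exp (- a\<^sup>2 / 2)) * (27 * exp (1 + a))"
    using 1 2 a by (intro mult_mono) auto
  also have "\<dots> = 27 / 2 * exp (1 + a - a\<^sup>2 / 2)" 
    by (simp add: algebra_simps flip: exp_add)
  also have "\<dots> \<le> 27 / 2 * exp (3 - Y)"
  proof -
    have "0 \<le> (a - 2)\<^sup>2" by simp
    hence "1 + a - a\<^sup>2 / 2 \<le> 3 - a" by (simp add: power2_eq_square algebra_simps)
    thus ?thesis using a by simp
  qed
  also have "exp (3 - Y) = exp 1 ^ 3 * exp (- Y)"
    by (simp add: exp_diff exp_minus field_simps flip: exp_of_nat_mult)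
  also have "27 / 2 * (exp 1 ^ 3 * exp (- Y)) \<le> 27 / 2 * (3 ^ 3 * exp (- Y))"
    by (intro mult_left_mono mult_right_mono power_mono exp_le) auto
  \<comment> \<open>Here 27 / 2 * 3 ^ 3 = 364.5, which is the origin of the constant 400 in
    \<open>U\<close>.\<close>
  also have "\<dots> \<le> 1 * (400 * exp (- Y))" by simp
  also have "\<dots> \<le> (1 + Y) ^ Suc k * (400 * exp (- Y) + gauss_tail y)"
    using Y_nonneg one_le_power[of "1 + Y" "Suc k"] gauss_tail_nonneg[of y] by (intro mult_mono) auto
  finally show ?thesis by (simp add: a_def)
qed

lemma density_times_bound:
  assumes "k \<le> 3" "\<bar>p\<bar> \<le> (1 + \<bar>(\<tau> - x) / sqrt s\<bar>) ^ k" "s \<ge> s0"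
  shows "\<bar>p * std_normal_density ((\<tau> - x) / sqrt s)\<bar> / sqrt s ^ Suc k \<le> K ^ Suc k * U s x"
proof -
  let ?y = "(\<tau> - x) / sqrt s"
  have "\<bar>p * std_normal_density ?y\<bar> = std_normal_density ?y * \<bar>p\<bar>" by (simp add: abs_mult)
  also have "\<dots> \<le> std_normal_density ?y * (1 + \<bar>?y\<bar>) ^ k"
    by (intro mult_left_mono assms) auto
  also have "\<dots> \<le> (1 + Y) ^ Suc k * U s x"
    unfolding U_def by (rule density_times_power_bound) fact
  finally have "\<bar>p * std_normal_density ?y\<bar> / sqrt s ^ Suc k \<le> (1 + Y) ^ Suc k * U s x / sqrt s0 ^ Suc k"
    using assms s0_pos U_pos[of s x] Y_nonneg
    by (intro frac_le power_mono) (auto intro!: mult_nonneg_nonneg)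
  thus ?thesis by (simp add: K_def power_divide)
qed

text \<open>With \<open>y = (\<tau> - x) / sqrt s\<close>, the factors 1, y, y^2 - 1, y^3 - 3y in
  these formulas are the Hermite polynomials. The 1/4 in \<open>Uss\<close> comes from using the
  heat equation twice: the second time derivative is a quarter of the fourth space
  derivative.\<close>

definition Ux :: "real \<Rightarrow> real \<Rightarrow> real" where
  "Ux s x = std_normal_density ((\<tau> - x) / sqrt s) / sqrt s"
definition Uxx :: "real \<Rightarrow> real \<Rightarrow> real" where
  "Uxx s x = ((\<tau> - x) / sqrt s) * std_normal_density ((\<tau> - x) / sqrt s) / sqrt s ^ 2"
definition Uxxx :: "real \<Rightarrow> real \<Rightarrow> real" where
  "Uxxx s x = (((\<tau> - x) / sqrt s)\<^sup>2 - 1) * std_normal_density ((\<tau> - x) / sqrt s) / sqrt s ^ 3"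
definition Uss :: "real \<Rightarrow> real \<Rightarrow> real" where
  "Uss s x = ((((\<tau> - x) / sqrt s) ^ 3 - 3 * ((\<tau> - x) / sqrt s)) / 4)
       * std_normal_density ((\<tau> - x) / sqrt s) / sqrt s ^ 4"

lemma U_deriv_x:
  assumes "s > 0"
  shows "(U s has_real_derivative Ux s x) (at x)"
    and "(Ux s has_real_derivative Uxx s x) (at x)"
    and "(Uxx s has_real_derivative Uxxx s x) (at x)"
proof -
  define r where "r = sqrt s"
  have r: "r > 0" using assms by (simp add: r_def)
  show "(U s has_real_derivative Ux s x) (at x)"
    unfolding U_def[abs_def] Ux_def r_def[symmetric] using r
    by (auto intro!: derivative_eq_intros simp: field_simps)
  show "(Ux s has_real_derivative Uxx s x) (at x)"
    unfolding Ux_def[abs_def] Uxx_def r_def[symmetric] using r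
    by (auto intro!: derivative_eq_intros simp: field_simps power2_eq_square)
  show "(Uxx s has_real_derivative Uxxx s x) (at x)"
    unfolding Uxx_def[abs_def] Uxxx_def r_def[symmetric]
    apply (rule derivative_eq_intros refl | use r in simp; fail)+
    using r by (simp add: divide_simps power2_eq_square power3_eq_cube) (simp add: algebra_simps)
qed

lemma arg_deriv_s:
  assumes "s > 0"
  shows "((\<lambda>s. (\<tau> - x) / sqrt s) has_real_derivative - ((\<tau> - x) / sqrt s) / (2 * s)) (at s)"
proof -
  have "((\<lambda>s. (\<tau> - x) / sqrt s) has_real_derivative
      - ((\<tau> - x) * (inverse (sqrt s) / 2)) / (sqrt s * sqrt s)) (at s)"
    using assms by (auto intro!: derivative_eq_intros)
  moreover have "sqrt s * sqrt s = s" using assms by simp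
  ultimately show ?thesis by (simp add: field_simps)
qed

text \<open>The first claim is the heat equation. It is what lets a step of variance
  \<open>v\<close> in \<open>x\<close> be exchanged for a step \<open>v\<close> in time.\<close>

lemma U_deriv_s:
  assumes "s > 0"
  shows "((\<lambda>s. U s x) has_real_derivative Uxx s x / 2) (at s)"
    and "((\<lambda>s. Uxx s x / 2) has_real_derivative Uss s x) (at s)"
proof -
  have s: "sqrt s > 0" "sqrt s ^ 2 = s" "sqrt s ^ 4 = s * s"
    using assms by (simp_all add: power4_eq_xxxx)
  show "((\<lambda>s. U s x) has_real_derivative Uxx s x / 2) (at s)"
    unfolding U_def Uxx_def s
    by (rule derivative_eq_intros arg_deriv_s[OF assms] refl)+ (use assms in \<open>simp add: field_simps\<close>)
  have "((\<lambda>s. ((\<tau> - x) / sqrt s) * std_normal_density ((\<tau> - x) / sqrt s) / s / 2)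
      has_real_derivative Uss s x) (at s)"
    unfolding Uss_def s
    apply (rule derivative_eq_intros arg_deriv_s[OF assms] refl | use assms in simp; fail)+
    using assms s(1)
    by (simp add: divide_simps) (simp add: algebra_simps power2_eq_square power3_eq_cube)?
  thus "((\<lambda>s. Uxx s x / 2) has_real_derivative Uss s x) (at s)"
    by (rule has_field_derivative_transform_within_open[of _ _ _ "{0<..}"])
       (use assms in \<open>auto simp: Uxx_def\<close>)
qed

lemma U_deriv_bounds:
  assumes "s \<ge> s0"
  shows "\<bar>Ux s x\<bar> \<le> K * U s x" and "\<bar>Uxx s x / 2\<bar> \<le> K\<^sup>2 * U s x"
    and "\<bar>Uxxx s x\<bar> \<le> K ^ 3 * U s x" and "\<bar>Uss s x\<bar> \<le> K ^ 4 * U s x"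
proof -
  let ?y = "(\<tau> - x) / sqrt s"
  define a where "a = \<bar>?y\<bar>"
  have s: "sqrt s > 0" using assms s0_pos by simp
  have a: "a \<ge> 0" by (simp add: a_def)
  have "\<bar>1 * std_normal_density ?y\<bar> / sqrt s ^ Suc 0 \<le> K ^ Suc 0 * U s x"
    by (rule density_times_bound) (use assms in auto)
  thus "\<bar>Ux s x\<bar> \<le> K * U s x" using s by (simp add: Ux_def abs_mult)
  have "\<bar>y / 2\<bar> \<le> (1 + \<bar>y\<bar>) ^ 1" for y :: real by simp
  from density_times_bound[OF _ this assms]
  have "\<bar>(?y / 2) * std_normal_density ?y\<bar> / sqrt s ^ Suc 1 \<le> K ^ Suc 1 * U s x"
    by simp
  moreover have "\<bar>Uxx s x / 2\<bar> = \<bar>(?y / 2) * std_normal_density ?y\<bar> / sqrt s ^ Suc 1"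
    using s by (simp add: Uxx_def abs_mult numeral_2_eq_2)
  ultimately show "\<bar>Uxx s x / 2\<bar> \<le> K\<^sup>2 * U s x" by (simp add: numeral_2_eq_2)
  have "\<bar>?y\<^sup>2 - 1\<bar> \<le> (1 + a) ^ 2"
  proof -
    have "\<bar>?y\<^sup>2 - 1\<bar> \<le> \<bar>?y\<^sup>2\<bar> + \<bar>1\<bar>" by (rule abs_triangle_ineq4)
    also have "\<dots> = a ^ 2 + 1" by (simp only: a_def power2_abs abs_power2 abs_one)
    also have "\<dots> \<le> (1 + a) ^ 2" using a by (simp add: power2_eq_square algebra_simps)
    finally show ?thesis .
  qed
  hence "\<bar>(?y\<^sup>2 - 1) * std_normal_density ?y\<bar> / sqrt s ^ Suc 2 \<le> K ^ Suc 2 * U s x"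
    by (intro density_times_bound) (use assms in \<open>auto simp: a_def\<close>)
  moreover have "\<bar>Uxxx s x\<bar> = \<bar>(?y\<^sup>2 - 1) * std_normal_density ?y\<bar> / sqrt s ^ Suc 2"
    using s by (simp add: Uxxx_def abs_mult numeral_3_eq_3 numeral_2_eq_2)
  ultimately show "\<bar>Uxxx s x\<bar> \<le> K ^ 3 * U s x" by (simp add: numeral_3_eq_3 numeral_2_eq_2)
  have "\<bar>(?y ^ 3 - 3 * ?y) / 4\<bar> \<le> (1 + a) ^ 3"
  proof -
    have "\<bar>?y ^ 3 - 3 * ?y\<bar> \<le> \<bar>?y ^ 3\<bar> + \<bar>3 * ?y\<bar>" by (rule abs_triangle_ineq4)
    also have "\<dots> = a ^ 3 + 3 * a" by (simp only: a_def power_abs abs_mult abs_numeral)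
    also have "\<dots> \<le> 4 * (1 + a) ^ 3"
    proof -
      have "(1 + a) ^ 3 = 1 + 3 * a + 3 * a ^ 2 + a ^ 3"
        by (simp add: power2_eq_square power3_eq_cube algebra_simps)
      moreover have "a ^ 2 \<ge> 0" "a ^ 3 \<ge> 0" using a by auto
      ultimately show ?thesis using a by simp
    qed
    finally show ?thesis by simp
  qed
  hence "\<bar>((?y ^ 3 - 3 * ?y) / 4) * std_normal_density ?y\<bar> / sqrt s ^ Suc 3 \<le> K ^ Suc 3 * U s x"
    by (intro density_times_bound) (use assms in \<open>auto simp: a_def\<close>)
  moreover have "\<bar>Uss s x\<bar> = \<bar>((?y ^ 3 - 3 * ?y) / 4) * std_normal_density ?y\<bar> / sqrt s ^ Suc 3"
    using s by (simp add: Uss_def abs_mult eval_nat_numeral)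
  ultimately show "\<bar>Uss s x\<bar> \<le> K ^ 4 * U s x" by (simp add: eval_nat_numeral)
qed

end

text \<open>Gronwall's argument in both directions: \<open>h x * exp (- C * x)\<close> decreases and
  \<open>h x * exp (C * x)\<close> increases.\<close>

lemma log_deriv_bound_exp:
  fixes h h' :: "real \<Rightarrow> real"
  assumes "a \<le> b" and "\<And>x. a \<le> x \<Longrightarrow> x \<le> b \<Longrightarrow> (h has_real_derivative h' x) (at x)"
    and "\<And>x. a \<le> x \<Longrightarrow> x \<le> b \<Longrightarrow> \<bar>h' x\<bar> \<le> C * h x"
  shows "h b \<le> h a * exp (C * (b - a))" and "h a \<le> h b * exp (C * (b - a))"
proof -
  define P where "P = (\<lambda>x. h x * exp (- C * x))"
  define R where "R = (\<lambda>x. h x * exp (C * x))"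
  have "P b \<le> P a"
  proof (rule DERIV_nonpos_imp_nonincreasing[OF assms(1)])
    fix x assume x: "a \<le> x" "x \<le> b"
    have "(P has_real_derivative exp (- C * x) * (h' x - C * h x)) (at x)"
      unfolding P_def by (auto intro!: derivative_eq_intros assms x simp: algebra_simps)
    moreover have "exp (- C * x) * (h' x - C * h x) \<le> 0"
      using assms(3)[OF x] by (intro mult_nonneg_nonpos) auto
    ultimately show "\<exists>y. DERIV P x :> y \<and> y \<le> 0" by blast
  qed
  thus "h b \<le> h a * exp (C * (b - a))"
    by (simp add: P_def exp_minus exp_diff field_simps)
  have "R a \<le> R b"
  proof (rule DERIV_nonneg_imp_nondecreasing[OF assms(1)])
    fix x assume x: "a \<le> x" "x \<le> b"
    have "(R has_real_derivative exp (C * x) * (h' x + C * h x)) (at x)"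
      unfolding R_def by (auto intro!: derivative_eq_intros assms x simp: algebra_simps)
    moreover have "exp (C * x) * (h' x + C * h x) \<ge> 0"
      using assms(3)[OF x] by (intro mult_nonneg_nonneg) auto
    ultimately show "\<exists>y. DERIV R x :> y \<and> y \<ge> 0" by blast
  qed
  thus "h a \<le> h b * exp (C * (b - a))"
    by (simp add: R_def exp_diff field_simps)
qed

section \<open>Harnack inequalities, Taylor expansions and the one-step estimate for
  \<open>U\<close>\<close>

context heat_tail
begin

text \<open>Over a length of at most \<open>1 / K\<close> the logarithm of \<open>U\<close> moves by
  at most 1; the factor 3 is a bound for e.\<close>

lemma U_harnack_x:
  assumes "s \<ge> s0" "K * \<bar>z - x\<bar> \<le> 1"
  shows "U s z \<le> 3 * U s x"
proof -
  have s: "s > 0" using assms s0_pos by simp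
  have "U s z \<le> U s x * exp (K * \<bar>z - x\<bar>)"
  proof (cases "x \<le> z")
    case True
    from log_deriv_bound_exp(1)[OF this U_deriv_x(1)[OF s] U_deriv_bounds(1)[OF assms(1)]] True
    show ?thesis by simp
  next
    case False
    hence "z \<le> x" by simp
    from log_deriv_bound_exp(2)[OF this U_deriv_x(1)[OF s] U_deriv_bounds(1)[OF assms(1)]] False
    show ?thesis by simp
  qed
  also have "\<dots> \<le> U s x * 3"
    using assms exp_le U_pos[of s x]
    by (intro mult_left_mono) (auto intro: order_trans[of _ "exp 1"])
  finally show ?thesis by simp
qed

text \<open>The time scale is \<open>1 / K\<^sup>2\<close>. The earlier value is bounded by the
  later one, the direction that \<open>U_step\<close> needs, whose right-hand side sits at time
  \<open>s + v\<close>.\<close>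

lemma U_harnack_s:
  assumes "s \<ge> s0" "s \<le> s'" "K\<^sup>2 * (s' - s) \<le> 1"
  shows "U s x \<le> 3 * U s' x"
proof -
  have "U s x \<le> U s' x * exp (K\<^sup>2 * (s' - s))"
  proof (rule log_deriv_bound_exp(2)[of s s' "\<lambda>s. U s x" "\<lambda>s. Uxx s x / 2"])
    fix r assume "s \<le> r" "r \<le> s'"
    hence "s0 \<le> r" "0 < r" using assms s0_pos by linarith+
    thus "((\<lambda>s. U s x) has_real_derivative Uxx r x / 2) (at r)" "\<bar>Uxx r x / 2\<bar> \<le> K\<^sup>2 * U r x"
      using U_deriv_s(1) U_deriv_bounds(2) by blast+
  qed (use assms in auto)
  also have "\<dots> \<le> U s' x * 3"
    using assms exp_le U_pos[of s' x]
    by (intro mult_left_mono) (auto intro: order_trans[of _ "exp 1"])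
  finally show ?thesis by simp
qed

text \<open>The third-order remainder is taken at an intermediate point and moved back to
  \<open>x\<close> by Harnack, whence 3 / 6 = 1 / 2. Bounding \<open>\<bar>D\<bar> ^ 3\<close> by
  \<open>b * D\<^sup>2\<close> keeps the error proportional to the variance.\<close>

lemma U_taylor_x:
  assumes s: "s \<ge> s0" and D: "\<bar>D\<bar> \<le> b" "K * b \<le> 1"
  shows "U s (x + D) \<le> U s x + Ux s x * D + Uxx s x / 2 * D\<^sup>2 + K ^ 3 * b / 2 * U s x * D\<^sup>2"
proof (cases "D = 0")
  case False
  define diff where "diff = (\<lambda>m::nat. if m = 0 then U s else if m = 1 then Ux s else if m = 2 then Uxx s else Uxxx s)"
  have s': "s > 0" using s s0_pos by simp
  have "\<exists>t. (if x + D < x then x + D < t \<and> t < x else x < t \<and> t < x + D) \<and>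
    U s (x + D) = (\<Sum>m<3. (diff m x / fact m) * (x + D - x)^m) + (diff 3 t / fact 3) * (x + D - x)^3"
  proof (rule Taylor[of 3 diff "U s" "x - \<bar>D\<bar>" "x + \<bar>D\<bar>" x "x + D"])
    show "\<forall>m t. m < 3 \<and> x - \<bar>D\<bar> \<le> t \<and> t \<le> x + \<bar>D\<bar> \<longrightarrow> DERIV (diff m) t :> diff (Suc m) t"
      using U_deriv_x[OF s'] by (auto simp: diff_def less_Suc_eq eval_nat_numeral)
  qed (use False in \<open>auto simp: diff_def\<close>)
  then obtain t where "if x + D < x then x + D < t \<and> t < x else x < t \<and> t < x + D"
    "U s (x + D) = (\<Sum>m<3. (diff m x / fact m) * (x + D - x)^m) + (diff 3 t / fact 3) * (x + D - x)^3"
    by blast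
  hence t: "\<bar>t - x\<bar> \<le> \<bar>D\<bar>"
    "U s (x + D) = U s x + Ux s x * D + Uxx s x / 2 * D\<^sup>2 + Uxxx s t / 6 * D ^ 3"
    by (auto simp: diff_def eval_nat_numeral split: if_splits)
  have Kt: "K * \<bar>t - x\<bar> \<le> 1"
  proof -
    have "K * \<bar>t - x\<bar> \<le> K * b" using t D K_pos by (intro mult_left_mono) auto
    thus ?thesis using D by linarith
  qed
  have "Uxxx s t / 6 * D ^ 3 \<le> \<bar>Uxxx s t\<bar> / 6 * \<bar>D\<bar> ^ 3"
    by (simp flip: abs_mult power_abs)
  also have "\<dots> \<le> (K ^ 3 * (3 * U s x)) / 6 * (b * D\<^sup>2)"
  proof (intro mult_mono divide_right_mono)
    have "\<bar>Uxxx s t\<bar> \<le> K ^ 3 * U s t" by (rule U_deriv_bounds(3)[OF s])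
    also have "\<dots> \<le> K ^ 3 * (3 * U s x)"
      using K_pos by (intro mult_left_mono U_harnack_x[OF s Kt]) auto
    finally show "\<bar>Uxxx s t\<bar> \<le> K ^ 3 * (3 * U s x)" .
    have "\<bar>D\<bar> ^ 3 = \<bar>D\<bar> * D\<^sup>2" by (simp add: power3_eq_cube power2_eq_square)
    also have "\<dots> \<le> b * D\<^sup>2" using D by (intro mult_right_mono) auto
    finally show "\<bar>D\<bar> ^ 3 \<le> b * D\<^sup>2" .
  qed (use K_pos U_pos[of s x] in auto)
  finally show ?thesis using t(2) by (simp add: field_simps)
qed auto

text \<open>Second-order Taylor in time; the constant is 1 / 2 from the remainder times 3 from
  Harnack.\<close>

lemma U_taylor_s:
  assumes s: "s \<ge> s0" and v: "v \<ge> 0" "K\<^sup>2 * v \<le> 1"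
  shows "U s x + Uxx s x / 2 * v \<le> U (s + v) x + 3 / 2 * K ^ 4 * v\<^sup>2 * U (s + v) x"
proof (cases "v = 0")
  case False
  define diff where "diff = (\<lambda>m::nat. if m = 0 then (\<lambda>s. U s x) else if m = 1 then (\<lambda>s. Uxx s x / 2) else (\<lambda>s. Uss s x))"
  have "\<exists>t. s < t \<and> t < s + v \<and>
    U (s + v) x = (\<Sum>m<2. (diff m s / fact m) * (s + v - s)^m) + (diff 2 t / fact 2) * (s + v - s)^2"
  proof (rule Taylor_up[of 2 diff "\<lambda>s. U s x" s "s + v" s])
    show "\<forall>m t. m < 2 \<and> s \<le> t \<and> t \<le> s + v \<longrightarrow> DERIV (diff m) t :> diff (Suc m) t"
      using s s0_pos by (auto simp: diff_def less_Suc_eq eval_nat_numeral intro!: U_deriv_s)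
  qed (use False v in \<open>auto simp: diff_def\<close>)
  then obtain t where t: "s < t" "t < s + v"
    "U (s + v) x = U s x + Uxx s x / 2 * v + Uss t x / 2 * v\<^sup>2"
    by (auto simp: diff_def eval_nat_numeral split: if_splits)
  have "- Uss t x \<le> \<bar>Uss t x\<bar>" by simp
  also have "\<dots> \<le> K ^ 4 * U t x" by (rule U_deriv_bounds(4)) (use t s in auto)
  also have "\<dots> \<le> K ^ 4 * (3 * U (s + v) x)"
  proof (intro mult_left_mono U_harnack_s)
    have "K\<^sup>2 * (s + v - t) \<le> K\<^sup>2 * v" using t by (intro mult_left_mono) auto
    thus "K\<^sup>2 * (s + v - t) \<le> 1" using v by linarith
  qed (use t s K_pos in auto)
  finally have "- Uss t x / 2 * v\<^sup>2 \<le> K ^ 4 * (3 * U (s + v) x) / 2 * v\<^sup>2"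
    by (intro mult_right_mono divide_right_mono) auto
  moreover have "K ^ 4 * (3 * U (s + v) x) / 2 * v\<^sup>2 = 3 / 2 * K ^ 4 * v\<^sup>2 * U (s + v) x" by simp
  ultimately show ?thesis using t(3) by linarith
qed auto

text \<open>Averaging kills the first-order term, and by the heat equation the second-order term is
  the effect of advancing time by \<open>v\<close>. The error is a factor whose exponent is linear
  in \<open>v\<close>, so over many steps the exponents add up to a multiple of the total
  conditional variance.\<close>

lemma U_step:
  fixes D :: "nat \<Rightarrow> real"
  assumes s: "s \<ge> s0" and m: "m > 0" and D: "\<And>l. l < m \<Longrightarrow> \<bar>D l\<bar> \<le> b" and b: "K * b \<le> 1" "b \<ge> 0"
    and mean: "(\<Sum>l<m. D l) = 0" and var: "(\<Sum>l<m. (D l)\<^sup>2) = real m * v"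
  shows "(\<Sum>l<m. U s (x + D l)) / real m \<le> exp (3 * K ^ 3 * b * v) * U (s + v) x"
proof -
  have v0: "v \<ge> 0"
  proof -
    have "0 \<le> (\<Sum>l<m. (D l)\<^sup>2)" by (intro sum_nonneg) auto
    thus ?thesis using var m by (simp add: zero_le_mult_iff)
  qed
  have vb: "v \<le> b\<^sup>2"
  proof -
    have "(\<Sum>l<m. (D l)\<^sup>2) \<le> (\<Sum>l<m. b\<^sup>2)"
      using D b by (intro sum_mono) (auto intro!: power2_le_iff_abs_le[THEN iffD2])
    thus ?thesis using var m by simp
  qed
  have Kb2: "K\<^sup>2 * b\<^sup>2 \<le> 1"
    using b K_pos by (simp flip: power_mult_distrib) (simp add: power_le_one)
  have Kv: "K\<^sup>2 * v \<le> 1"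
  proof -
    have "K\<^sup>2 * v \<le> K\<^sup>2 * b\<^sup>2" using vb by (intro mult_left_mono) auto
    thus ?thesis using Kb2 by linarith
  qed
  have "(\<Sum>l<m. U s (x + D l)) \<le> (\<Sum>l<m. U s x + Ux s x * D l + Uxx s x / 2 * (D l)\<^sup>2 + K ^ 3 * b / 2 * U s x * (D l)\<^sup>2)"
    by (intro sum_mono U_taylor_x s D b) auto
  also have "\<dots> = real m * U s x + Ux s x * (\<Sum>l<m. D l) + Uxx s x / 2 * (\<Sum>l<m. (D l)\<^sup>2)
       + K ^ 3 * b / 2 * U s x * (\<Sum>l<m. (D l)\<^sup>2)"
    by (simp add: sum.distrib sum_distrib_left)
  also have "\<dots> = real m * (U s x + Uxx s x / 2 * v + K ^ 3 * b / 2 * U s x * v)"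
    by (simp add: mean var algebra_simps)
  finally have "(\<Sum>l<m. U s (x + D l)) / real m \<le> U s x + Uxx s x / 2 * v + K ^ 3 * b / 2 * U s x * v"
    using m by (simp add: field_simps)
  also have "\<dots> \<le> (U (s + v) x + 3 / 2 * K ^ 4 * v\<^sup>2 * U (s + v) x) + K ^ 3 * b / 2 * (3 * U (s + v) x) * v"
    using s v0 Kv K_pos b
    by (intro add_mono U_taylor_s mult_mono U_harnack_s) (auto intro!: mult_nonneg_nonneg U_pos[THEN less_imp_le])
  \<comment> \<open>The error in time is no worse than the one in space, because
    \<open>v \<le> b\<^sup>2\<close> and \<open>K * b \<le> 1\<close>. Each contributes 3 / 2 to the
    constant 3.\<close>
  also have "3 / 2 * K ^ 4 * v\<^sup>2 * U (s + v) x \<le> 3 / 2 * (K ^ 3 * b * v) * U (s + v) x"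
  proof (intro mult_right_mono)
    have "K ^ 4 * v\<^sup>2 = K ^ 4 * v * v" by (simp add: power2_eq_square)
    also have "\<dots> \<le> K ^ 4 * v * b\<^sup>2" using vb v0 K_pos by (intro mult_left_mono) auto
    also have "\<dots> = K ^ 3 * b * v * (K * b)" by (simp add: power2_eq_square power3_eq_cube power4_eq_xxxx)
    also have "\<dots> \<le> K ^ 3 * b * v * 1" using b v0 K_pos by (intro mult_left_mono) auto
    finally have "3 / 2 * (K ^ 4 * v\<^sup>2) \<le> 3 / 2 * (K ^ 3 * b * v * 1)" by (rule mult_left_mono) simp
    thus "3 / 2 * K ^ 4 * v\<^sup>2 \<le> 3 / 2 * (K ^ 3 * b * v)" by (simp only: mult.assoc mult_1_right)
  qed (use U_pos[of "s + v" x] in auto)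
  finally have "(\<Sum>l<m. U s (x + D l)) / real m \<le> U (s + v) x * (1 + 3 * K ^ 3 * b * v)"
    by (simp add: algebra_simps)
  also have "\<dots> \<le> U (s + v) x * exp (3 * K ^ 3 * b * v)"
    using U_pos[of "s + v" x] exp_ge_add_one_self[of "3 * K ^ 3 * b * v"] by (intro mult_left_mono) auto
  finally show ?thesis by (simp add: mult.commute)
qed

end

section \<open>Martingales on finite probability trees\<close>

text \<open>A martingale on a finite probability tree: a node of level \<open>i\<close> has \<open>w i\<close> equally likely
  children, and the nodes of each level are numbered consecutively.\<close>
locale tree_martingale =
  fixes w :: "nat \<Rightarrow> nat" and M :: "nat \<Rightarrow> nat \<Rightarrow> real" and b :: real
  assumes w_pos: "w i > 0"
    and martingale: "(\<Sum>l<w i. M (Suc i) (j * w i + l)) = real (w i) * M i j"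
    and M_0: "M 0 0 = 0"
    and increment_bound: "\<bar>M (Suc i) j - M i (j div w i)\<bar> \<le> b"
begin

definition W :: "nat \<Rightarrow> nat" where
  "W i = (\<Prod>l<i. w l)"

definition E :: "nat \<Rightarrow> (nat \<Rightarrow> real) \<Rightarrow> real" where
  "E i X = (\<Sum>j<W i. X j) / real (W i)"

definition v :: "nat \<Rightarrow> nat \<Rightarrow> real" where
  "v i j = (\<Sum>l<w i. (M (Suc i) (j * w i + l) - M i j)\<^sup>2) / real (w i)"

text \<open>The conditional variance is predictable: at level \<open>Suc i\<close> it depends on the
  node only through its parent.\<close>

primrec V :: "nat \<Rightarrow> nat \<Rightarrow> real" where
  "V 0 j = 0"
| "V (Suc i) j = V i (j div w i) + v i (j div w i)"

text \<open>The sum of squared increments along the path to the node. It links \<open>V\<close>,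
  which governs the supermartingale, with squared block sums, which can be compared with
  \<open>S\<close> pointwise.\<close>

primrec S :: "nat \<Rightarrow> nat \<Rightarrow> real" where
  "S 0 j = 0"
| "S (Suc i) j = S i (j div w i) + (M (Suc i) j - M i (j div w i))\<^sup>2"

lemma W_pos: "W i > 0"
  using w_pos by (auto simp: W_def intro!: prod_pos)

lemma W_0 [simp]: "W 0 = 1"
  by (simp add: W_def)

text \<open>The tower property. Consecutive numbering turns pairs of a node and a child into the
  single range below \<open>W i * w i\<close>.\<close>

lemma E_Suc: "E (Suc i) X = E i (\<lambda>j. (\<Sum>l<w i. X (j * w i + l)) / real (w i))"
proof -
  have "(\<Sum>j<W i. \<Sum>l<w i. X (j * w i + l)) = (\<Sum>j<W i * w i. X j)"
    by (simp add: sum.atLeastLessThan_shift_0[of X "_ * _"] lessThan_atLeast0[symmetric]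
          flip: sum.nat_group)
  thus ?thesis
    using W_pos[of i] w_pos[of i]
    by (simp add: E_def W_def sum_divide_distrib[symmetric] mult.commute)
qed

lemma E_mono: "(\<And>j. X j \<le> X' j) \<Longrightarrow> E i X \<le> E i X'"
  by (auto simp: E_def intro!: divide_right_mono sum_mono)

lemma E_const [simp]: "E i (\<lambda>_. c) = c"
  using W_pos[of i] by (simp add: E_def)

lemma E_add: "E i (\<lambda>j. X j + X' j) = E i X + E i X'"
  by (simp add: E_def sum.distrib add_divide_distrib)

lemma E_cmult: "E i (\<lambda>j. c * X j) = c * E i X"
  by (simp add: E_def sum_distrib_left)

lemma b_nonneg: "b \<ge> 0"
  using increment_bound[of 0 0] by linarith

lemma child_bound:
  assumes "l < w i"
  shows "\<bar>M (Suc i) (j * w i + l) - M i j\<bar> \<le> b"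
  using increment_bound[of i "j * w i + l"] assms by simp

lemma v_bounds: "0 \<le> v i j" "v i j \<le> b\<^sup>2"
proof -
  show "0 \<le> v i j" by (auto simp: v_def intro!: divide_nonneg_nonneg sum_nonneg)
  have "(\<Sum>l<w i. (M (Suc i) (j * w i + l) - M i j)\<^sup>2) \<le> (\<Sum>l<w i. b\<^sup>2)"
    using child_bound by (intro sum_mono) (auto intro!: power2_le_iff_abs_le[THEN iffD2] simp: b_nonneg)
  thus "v i j \<le> b\<^sup>2" using w_pos[of i] by (simp add: v_def field_simps)
qed

text \<open>\<open>S - V\<close> is a martingale with increments of size at most
  \<open>b\<^sup>2\<close>, and martingale increments are orthogonal.\<close>

lemma second_moment_S_minus_V: "E i (\<lambda>j. (S i j - V i j)\<^sup>2) \<le> real i * b ^ 4"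
proof (induction i)
  case 0
  show ?case by (simp add: E_def)
next
  case (Suc i)
  have "(\<Sum>l<w i. (S (Suc i) (j * w i + l) - V (Suc i) (j * w i + l))\<^sup>2) / real (w i)
        \<le> (S i j - V i j)\<^sup>2 + b ^ 4" for j
  proof -
    define d where "d = (\<lambda>l. (M (Suc i) (j * w i + l) - M i j)\<^sup>2)"
    have d_bound: "(d l - v i j)\<^sup>2 \<le> b ^ 4" if "l < w i" for l
    proof -
      have "d l \<le> b\<^sup>2" "0 \<le> d l" unfolding d_def
        using child_bound[OF that] by (auto intro!: power2_le_iff_abs_le[THEN iffD2] simp: b_nonneg)
      hence "\<bar>d l - v i j\<bar> \<le> b\<^sup>2" using v_bounds[of i j] by linarith
      hence "(d l - v i j)\<^sup>2 \<le> (b\<^sup>2)\<^sup>2" by (intro power2_le_iff_abs_le[THEN iffD2]) auto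
      thus ?thesis by simp
    qed
    have "(\<Sum>l<w i. (S (Suc i) (j * w i + l) - V (Suc i) (j * w i + l))\<^sup>2)
        = (\<Sum>l<w i. (S i j - V i j)\<^sup>2 + 2 * (S i j - V i j) * (d l - v i j) + (d l - v i j)\<^sup>2)"
      by (intro sum.cong refl) (simp add: d_def power2_eq_square algebra_simps)
    also have "\<dots> = real (w i) * (S i j - V i j)\<^sup>2
        + 2 * (S i j - V i j) * (\<Sum>l<w i. d l - v i j) + (\<Sum>l<w i. (d l - v i j)\<^sup>2)"
      by (simp add: sum.distrib sum_distrib_left)
    \<comment> \<open>The cross term vanishes since \<open>v i j\<close> is the mean of the squared
      increments \<open>d l\<close>.\<close>
    also have "(\<Sum>l<w i. d l - v i j) = 0"
      using w_pos[of i] by (simp add: sum_subtractf v_def d_def)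
    also have "(\<Sum>l<w i. (d l - v i j)\<^sup>2) \<le> (\<Sum>l<w i. b ^ 4)"
      by (intro sum_mono d_bound) auto
    finally have "(\<Sum>l<w i. (S (Suc i) (j * w i + l) - V (Suc i) (j * w i + l))\<^sup>2)
        \<le> real (w i) * ((S i j - V i j)\<^sup>2 + b ^ 4)" by (simp add: algebra_simps)
    thus ?thesis using w_pos[of i] by (simp add: field_simps)
  qed
  hence "E (Suc i) (\<lambda>j. (S (Suc i) j - V (Suc i) j)\<^sup>2) \<le> E i (\<lambda>j. (S i j - V i j)\<^sup>2 + b ^ 4)"
    unfolding E_Suc by (rule E_mono)
  also have "\<dots> \<le> real (Suc i) * b ^ 4"
    using Suc.IH by (simp add: E_add algebra_simps)
  finally show ?case .
qed

definition freq :: "nat \<Rightarrow> (nat \<Rightarrow> bool) \<Rightarrow> real" where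
  "freq i P = real (card {j. j < W i \<and> P j}) / real (W i)"

lemma freq_eq: "freq i P = E i (\<lambda>j. of_bool (P j))"
proof -
  have "{..<W i} \<inter> {j. P j} = {j. j < W i \<and> P j}" by auto
  thus ?thesis by (simp add: freq_def E_def sum_of_bool_eq)
qed

text \<open>Chebyshev for \<open>S - V\<close>: if \<open>V\<close> is off by more than
  \<open>\<delta>\<close> and \<open>S\<close> by at most \<open>\<delta> / 2\<close>, they differ
  by at least \<open>\<delta> / 2\<close>.\<close>

lemma freq_V_le:
  assumes "\<delta> > 0"
  shows "freq i (\<lambda>j. \<bar>V i j - 1\<bar> > \<delta>)
     \<le> freq i (\<lambda>j. \<bar>S i j - 1\<bar> > \<delta> / 2) + 4 * real i * b ^ 4 / \<delta>\<^sup>2"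
proof -
  have "freq i (\<lambda>j. \<bar>V i j - 1\<bar> > \<delta>) \<le>
     E i (\<lambda>j. of_bool (\<bar>S i j - 1\<bar> > \<delta> / 2) + 4 / \<delta>\<^sup>2 * (S i j - V i j)\<^sup>2)"
    unfolding freq_eq
  proof (rule E_mono)
    fix j
    show "of_bool (\<bar>V i j - 1\<bar> > \<delta>) \<le> of_bool (\<bar>S i j - 1\<bar> > \<delta> / 2) + 4 / \<delta>\<^sup>2 * (S i j - V i j)\<^sup>2"
    proof (cases "\<bar>V i j - 1\<bar> > \<delta> \<and> \<not> \<bar>S i j - 1\<bar> > \<delta> / 2")
      case True
      hence "\<delta> / 2 \<le> \<bar>S i j - V i j\<bar>" by linarith
      hence "(\<delta> / 2)\<^sup>2 \<le> (S i j - V i j)\<^sup>2" using assms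
        by (metis abs_le_square_iff abs_of_nonneg half_gt_zero less_imp_le)
      thus ?thesis using True assms by (simp add: field_simps power2_eq_square)
    qed auto
  qed
  also have "\<dots> = freq i (\<lambda>j. \<bar>S i j - 1\<bar> > \<delta> / 2) + 4 / \<delta>\<^sup>2 * E i (\<lambda>j. (S i j - V i j)\<^sup>2)"
    unfolding freq_eq E_add E_cmult ..
  also have "4 / \<delta>\<^sup>2 * E i (\<lambda>j. (S i j - V i j)\<^sup>2) \<le> 4 / \<delta>\<^sup>2 * (real i * b ^ 4)"
    by (intro mult_left_mono second_moment_S_minus_V) auto
  finally show ?thesis by simp
qed

end

locale tree_martingale_heat = tree_martingale + heat_tail +
  assumes Kb: "K * b \<le> 1"
begin

text \<open>The process stopped before its conditional variance exceeds \<open>T\<close>.\<close>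
lemma heat_supermartingale:
  "E i (\<lambda>j. if V i j \<le> T then exp (3 * K ^ 3 * b * (T - V i j)) * U (s0 + T - V i j) (M i j) else 0)
     \<le> (if 0 \<le> T then exp (3 * K ^ 3 * b * T) * U (s0 + T) 0 else 0)"
proof (induction i)
  case 0
  show ?case by (simp add: E_def M_0)
next
  case (Suc i)
  define c where "c = 3 * K ^ 3 * b"
  have "(\<Sum>l<w i. if V (Suc i) (j * w i + l) \<le> T
           then exp (c * (T - V (Suc i) (j * w i + l))) * U (s0 + T - V (Suc i) (j * w i + l)) (M (Suc i) (j * w i + l))
           else 0) / real (w i)
      \<le> (if V i j \<le> T then exp (c * (T - V i j)) * U (s0 + T - V i j) (M i j) else 0)" (is "?L \<le> ?R") for j
  \<comment> \<open>All children share the same value of \<open>V (Suc i)\<close>, so they are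
    stopped together or not at all. If they are stopped, the left-hand side is 0.\<close>
  proof (cases "V i j + v i j \<le> T")
    case True
    define D where "D = (\<lambda>l. M (Suc i) (j * w i + l) - M i j)"
    define s where "s = s0 + T - (V i j + v i j)"
    have "?L = exp (c * (T - (V i j + v i j))) * ((\<Sum>l<w i. U s (M i j + D l)) / real (w i))"
      using True by (simp add: D_def s_def sum_distrib_left)
    also have "(\<Sum>l<w i. U s (M i j + D l)) / real (w i) \<le> exp (c * v i j) * U (s + v i j) (M i j)"
      unfolding c_def
    proof (rule U_step)
      show "(\<Sum>l<w i. D l) = 0" using martingale[of i j] by (simp add: D_def sum_subtractf)
      show "(\<Sum>l<w i. (D l)\<^sup>2) = real (w i) * v i j" using w_pos[of i] by (simp add: D_def v_def)
    qed (use True w_pos child_bound Kb b_nonneg in \<open>auto simp: s_def D_def\<close>)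
    \<comment> \<open>The weight gives up exactly the factor \<open>exp (c * v i j)\<close> that
      \<open>U_step\<close> loses.\<close>
    also have "exp (c * (T - (V i j + v i j))) * (exp (c * v i j) * U (s + v i j) (M i j))
        = exp (c * (T - V i j)) * U (s0 + T - V i j) (M i j)"
      by (simp add: s_def algebra_simps flip: exp_add)
    finally show ?thesis using True v_bounds(1)[of i j] by auto
  next
    case False
    thus ?thesis using U_pos by (auto intro!: mult_nonneg_nonneg less_imp_le)
  qed
  hence "E (Suc i) (\<lambda>j. if V (Suc i) j \<le> T then exp (c * (T - V (Suc i) j)) * U (s0 + T - V (Suc i) j) (M (Suc i) j) else 0)
     \<le> E i (\<lambda>j. if V i j \<le> T then exp (c * (T - V i j)) * U (s0 + T - V i j) (M i j) else 0)"
    unfolding E_Suc by (rule E_mono)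
  also note Suc.IH[folded c_def]
  finally show ?case by (simp only: c_def)
qed

text \<open>Markov's inequality for the stopped supermartingale with
  \<open>T = 1 + \<delta>\<close>. On the good event the remaining time lies between
  \<open>s0\<close> and \<open>s0 + 2 * \<delta>\<close>, and the margin \<open>\<eta>\<close> above
  \<open>\<tau>\<close> makes the value of \<open>U\<close> close to 1 there instead of merely 1 /
  2.\<close>

lemma freq_ge_le:
  assumes \<delta>: "\<delta> > 0" and \<eta>: "\<eta> > 0"
  shows "freq i (\<lambda>j. M i j \<ge> \<tau> + \<eta>) \<le> freq i (\<lambda>j. \<bar>V i j - 1\<bar> > \<delta>)
    + exp (3 * K ^ 3 * b * (1 + \<delta>)) * U (s0 + 1 + \<delta>) 0 / gauss_tail (- \<eta> / sqrt (s0 + 2 * \<delta>))"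
proof -
  define T where "T = 1 + \<delta>"
  define c where "c = 3 * K ^ 3 * b"
  define \<theta> where "\<theta> = gauss_tail (- \<eta> / sqrt (s0 + 2 * \<delta>))"
  have \<theta>: "\<theta> > 0" by (simp add: \<theta>_def gauss_tail_pos)
  have c: "c \<ge> 0" using b_nonneg K_pos by (simp add: c_def)
  define X where "X = (\<lambda>j. if V i j \<le> T then exp (c * (T - V i j)) * U (s0 + T - V i j) (M i j) else 0)"
  have X_nonneg: "X j \<ge> 0" for j
    using U_pos by (auto simp: X_def intro!: mult_nonneg_nonneg less_imp_le)
  have "freq i (\<lambda>j. M i j \<ge> \<tau> + \<eta>) \<le> E i (\<lambda>j. of_bool (\<bar>V i j - 1\<bar> > \<delta>) + 1 / \<theta> * X j)"
    unfolding freq_eq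
  proof (rule E_mono)
    fix j
    show "of_bool (M i j \<ge> \<tau> + \<eta>) \<le> of_bool (\<bar>V i j - 1\<bar> > \<delta>) + 1 / \<theta> * X j"
    proof (cases "M i j \<ge> \<tau> + \<eta> \<and> \<not> \<bar>V i j - 1\<bar> > \<delta>")
      case True
      define s where "s = s0 + T - V i j"
      have V: "V i j \<le> T" and s: "s0 \<le> s" "s \<le> s0 + 2 * \<delta>" "s > 0"
        using True s0_pos by (auto simp: T_def s_def)
      have "\<theta> \<le> gauss_tail ((\<tau> - M i j) / sqrt s)"
        unfolding \<theta>_def
      proof (rule gauss_tail_antimono)
        have "(\<tau> - M i j) / sqrt s \<le> - \<eta> / sqrt s"
          using True s by (intro divide_right_mono) auto
        also have "\<dots> \<le> - \<eta> / sqrt (s0 + 2 * \<delta>)"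
          using s \<eta> by (auto intro!: divide_left_mono)
        finally show "(\<tau> - M i j) / sqrt s \<le> - \<eta> / sqrt (s0 + 2 * \<delta>)" .
      qed
      also have "\<dots> \<le> U s (M i j)" by (simp add: U_def)
      also have "\<dots> = 1 * U s (M i j)" by simp
      also have "\<dots> \<le> exp (c * (T - V i j)) * U s (M i j)"
        using c V U_pos[of s "M i j"] by (intro mult_right_mono) auto
      also have "\<dots> = X j" using V by (simp add: X_def s_def)
      finally show ?thesis using True \<theta> by simp
    next
      case False
      thus ?thesis using X_nonneg[of j] \<theta> by auto
    qed
  qed
  also have "\<dots> = freq i (\<lambda>j. \<bar>V i j - 1\<bar> > \<delta>) + 1 / \<theta> * E i X"
    unfolding freq_eq E_add E_cmult ..
  also have "1 / \<theta> * E i X \<le> 1 / \<theta> * (exp (c * T) * U (s0 + T) 0)"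
  proof (rule mult_left_mono)
    have "0 \<le> T" using \<delta> by (simp add: T_def)
    thus "E i X \<le> exp (c * T) * U (s0 + T) 0"
      using heat_supermartingale[of i T] by (simp only: X_def c_def if_True)
  qed (use \<theta> in auto)
  finally show ?thesis using \<theta> by (simp add: T_def c_def \<theta>_def add.assoc)
qed

end

text \<open>\<open>s\<^sub>0\<close> is the time for which the indicator of a half-line is smoothed, and the term
  \<open>exp (- Y)\<close> keeps the logarithmic derivatives of the smoothed function bounded.\<close>
theorem (in tree_martingale) tail_bound:
  assumes "Y \<ge> 0" "s0 > 0" "\<delta> > 0" "\<eta> > 0" and "(1 + Y) / sqrt s0 * b \<le> 1"
  shows "freq i (\<lambda>j. M i j \<ge> a) \<le> freq i (\<lambda>j. \<bar>S i j - 1\<bar> > \<delta> / 2) + 4 * real i * b ^ 4 / \<delta>\<^sup>2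
    + exp (3 * ((1 + Y) / sqrt s0) ^ 3 * b * (1 + \<delta>))
      * (400 * exp (- Y) + gauss_tail ((a - \<eta>) / sqrt (s0 + 1 + \<delta>))) / gauss_tail (- \<eta> / sqrt (s0 + 2 * \<delta>))"
proof -
  interpret heat_tail Y "a - \<eta>" s0 by unfold_locales (use assms in auto)
  interpret tree_martingale_heat w M b Y "a - \<eta>" s0
    by unfold_locales (use assms in \<open>auto simp: K_def\<close>)
  show ?thesis
    using freq_ge_le[OF assms(3,4), of i] freq_V_le[OF assms(3), of i]
    by (simp add: U_def K_def)
qed

section \<open>Fourier coefficients and the counting function\<close>

definition ex :: "int \<Rightarrow> real \<Rightarrow> complex" where
  "ex k x = cis (2 * pi * of_int k * x)"

lemma ex_add: "ex (k + l) x = ex k x * ex l x"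
  by (simp add: ex_def cis_mult algebra_simps)

lemma ex_0 [simp]: "ex 0 x = 1"
  by (simp add: ex_def)

lemma ex_mult_nat: "ex a (real m * x) = ex (a * int m) x"
  by (simp add: ex_def algebra_simps)

lemma ex_has_integral:
  "(ex k has_integral (if k = 0 then 1 else 0)) {0..1}"
proof (cases "k = 0")
  case True
  have "((\<lambda>_::real. 1::complex) has_integral 1) {0..1}"
    using has_integral_const_real[of "1::complex" 0 1] by simp
  thus ?thesis using True by (simp add: fun_eq_iff cong: has_integral_cong)
next
  case False
  define c where "c = 2 * complex_of_real pi * of_int k * \<i>"
  have c: "c \<noteq> 0" using False by (simp add: c_def)
  have ex: "ex k x = exp (c * of_real x)" for x
    by (simp add: ex_def c_def cis_conv_exp mult_ac)
  have der: "((\<lambda>x. exp (c * of_real x) / c) has_vector_derivative ex k x) (at x within {0..1})" for x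
  proof -
    have "((\<lambda>z. exp (c * z) / c) has_field_derivative exp (c * of_real x)) (at (of_real x))"
      using c by (auto intro!: derivative_eq_intros)
    from has_vector_derivative_real_field[OF this] show ?thesis by (simp add: ex)
  qed
  have "(ex k has_integral (exp (c * of_real 1) / c - exp (c * of_real 0) / c)) {0..1}"
    by (rule fundamental_theorem_of_calculus) (use der in auto)
  moreover have "exp c = 1"
  proof -
    have "exp c = ex k 1" by (simp add: ex)
    also have "\<dots> = 1"
      using cos_int_2pin[of k] sin_int_2pin[of k] by (simp add: ex_def complex_eq_iff)
    finally show ?thesis .
  qed
  ultimately show ?thesis using False by simp
qed

text \<open>The frequency map \<open>\<nu>\<close> need not be injective: products of trigonometric
  sums are indexed by tuples, and many tuples may share a frequency.\<close>

lemma integral_trig_sum: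
  assumes "finite P" and "\<And>x. complex_of_real (h x) = (\<Sum>p\<in>P. z p * ex (\<nu> p) x)"
  shows "h integrable_on {0..1}"
    and "complex_of_real (integral {0..1} h) = (\<Sum>p | p \<in> P \<and> \<nu> p = 0. z p)"
proof -
  have "((\<lambda>x. \<Sum>p\<in>P. z p * ex (\<nu> p) x) has_integral
     (\<Sum>p\<in>P. z p * (if \<nu> p = 0 then 1 else 0))) {0..1}"
    by (intro has_integral_sum has_integral_mult_right ex_has_integral assms)
  also have "(\<Sum>p\<in>P. z p * (if \<nu> p = 0 then 1 else 0)) = (\<Sum>p | p \<in> P \<and> \<nu> p = 0. z p)"
    using assms(1) by (intro sum.mono_neutral_cong_right) auto
  finally have *: "((\<lambda>x. complex_of_real (h x)) has_integral (\<Sum>p | p \<in> P \<and> \<nu> p = 0. z p)) {0..1}"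
    by (simp add: assms(2))
  from has_integral_linear[OF this bounded_linear_Re]
  have h: "(h has_integral Re (\<Sum>p | p \<in> P \<and> \<nu> p = 0. z p)) {0..1}"
    by (simp add: o_def)
  thus "h integrable_on {0..1}" by blast
  have "((\<lambda>x. complex_of_real (h x)) has_integral complex_of_real (integral {0..1} h)) {0..1}"
    using has_integral_linear[OF integrable_integral bounded_linear_of_real, of h "{0..1}"] h
    by (auto simp: o_def)
  with * show "complex_of_real (integral {0..1} h) = (\<Sum>p | p \<in> P \<and> \<nu> p = 0. z p)"
    by (rule has_integral_unique[THEN sym])
qed

lemma square_as_trig_sum:
  assumes "\<And>x. complex_of_real (h x) = (\<Sum>p\<in>P. z p * ex (\<nu> p) x)"
  shows "complex_of_real ((h x)\<^sup>2) = (\<Sum>(p, p')\<in>P \<times> P. (z p * z p') * ex (\<nu> p + \<nu> p') x)"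
proof -
  have "complex_of_real ((h x)\<^sup>2) = (\<Sum>p\<in>P. z p * ex (\<nu> p) x) * (\<Sum>p\<in>P. z p * ex (\<nu> p) x)"
    by (simp add: power2_eq_square assms)
  also have "\<dots> = (\<Sum>(p, p')\<in>P \<times> P. (z p * ex (\<nu> p) x) * (z p' * ex (\<nu> p') x))"
    by (simp add: sum_product sum.cartesian_product)
  finally show ?thesis by (simp add: ex_add mult_ac)
qed

text \<open>In the expanded square only pairs of opposite frequencies survive integration, and each
  \<open>p\<close> has at most \<open>R\<close> partners.\<close>

lemma integral_square_trig_sum_le:
  assumes P: "finite P" and h: "\<And>x. complex_of_real (h x) = (\<Sum>p\<in>P. z p * ex (\<nu> p) x)"
    and Z: "\<And>p. p \<in> P \<Longrightarrow> norm (z p) \<le> Z" and R: "\<And>c. card {p \<in> P. \<nu> p = c} \<le> R"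
  shows "(\<lambda>x. (h x)\<^sup>2) integrable_on {0..1}"
    and "integral {0..1} (\<lambda>x. (h x)\<^sup>2) \<le> Z\<^sup>2 * real (card P) * real R"
proof -
  let ?z = "\<lambda>(p, p'). z p * z p'" and ?\<nu> = "\<lambda>(p, p'). \<nu> p + \<nu> p'"
  have sq: "complex_of_real ((h x)\<^sup>2) = (\<Sum>p\<in>P \<times> P. ?z p * ex (?\<nu> p) x)" for x
    unfolding square_as_trig_sum[OF h] by (simp add: case_prod_unfold)
  show "(\<lambda>x. (h x)\<^sup>2) integrable_on {0..1}"
    by (rule integral_trig_sum(1)[OF _ sq]) (use P in auto)
  have "{p. p \<in> P \<times> P \<and> ?\<nu> p = 0} = Sigma P (\<lambda>p. {p' \<in> P. \<nu> p' = - \<nu> p})" by auto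
  hence "complex_of_real (integral {0..1} (\<lambda>x. (h x)\<^sup>2)) = (\<Sum>p\<in>P. \<Sum>p' | p' \<in> P \<and> \<nu> p' = - \<nu> p. z p * z p')"
    using P by (subst integral_trig_sum(2)[OF _ sq]) (auto simp: sum.Sigma)
  hence "norm (complex_of_real (integral {0..1} (\<lambda>x. (h x)\<^sup>2)))
      \<le> (\<Sum>p\<in>P. \<Sum>p' | p' \<in> P \<and> \<nu> p' = - \<nu> p. Z * Z)"
    using Z by (simp only:) (intro sum_norm_le, auto intro!: mult_mono order_trans[OF norm_ge_zero Z]
      simp: norm_mult simp del: sum_constant)
  also have "\<dots> \<le> (\<Sum>p\<in>P. real R * (Z * Z))"
    using R by (intro sum_mono) (auto intro!: mult_right_mono)
  finally show "integral {0..1} (\<lambda>x. (h x)\<^sup>2) \<le> Z\<^sup>2 * real (card P) * real R"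
    by (simp add: power2_eq_square mult_ac)
qed

section \<open>Counting solutions of two-term equations in a lacunary sequence\<close>

locale lacunary =
  fixes n :: "nat \<Rightarrow> nat" and q :: real
  assumes n_pos: "k \<ge> 1 \<Longrightarrow> n k > 0" and q_gt_1: "q > 1"
    and gap: "k \<ge> 1 \<Longrightarrow> q * real (n k) \<le> real (n (Suc k))"
begin

lemma gap_power: "k \<ge> 1 \<Longrightarrow> q ^ j * real (n k) \<le> real (n (k + j))"
proof (induction j)
  case (Suc j)
  have "q ^ Suc j * real (n k) = q * (q ^ j * real (n k))" by simp
  also have "\<dots> \<le> q * real (n (k + j))" using Suc q_gt_1 by (intro mult_left_mono) auto
  also have "\<dots> \<le> real (n (Suc (k + j)))" using Suc by (intro gap) auto
  finally show ?case by simp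
qed auto

lemma n_less: "1 \<le> k \<Longrightarrow> k < l \<Longrightarrow> n k < n l"
proof -
  assume kl: "1 \<le> k" "k < l"
  define j where "j = l - k"
  have j: "l = k + j" "j > 0" using kl by (auto simp: j_def)
  have "1 < q ^ j" using j q_gt_1 by (intro one_less_power) auto
  hence "1 * real (n k) < q ^ j * real (n k)" using n_pos[OF kl(1)] by (intro mult_strict_right_mono) auto
  also have "\<dots> \<le> real (n l)" using gap_power[OF kl(1), of j] j by simp
  finally show ?thesis by simp
qed

lemma n_inj: "1 \<le> k \<Longrightarrow> 1 \<le> l \<Longrightarrow> n k = n l \<Longrightarrow> k = l"
  using n_less[of k l] n_less[of l k] by (cases k l rule: linorder_cases) auto

text \<open>\<open>R\<close> steps multiply the sequence by more than 2, so the indices in a dyadic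
  window lie within \<open>R\<close> consecutive ones.\<close>

lemma card_window:
  assumes "q ^ R > 2" "X > 0"
  shows "card {k \<in> {1..N}. X \<le> real (n k) \<and> real (n k) \<le> 2 * X} \<le> R"
proof (cases "{k \<in> {1..N}. X \<le> real (n k) \<and> real (n k) \<le> 2 * X} = {}")
  case False
  define A where "A = {k \<in> {1..N}. X \<le> real (n k) \<and> real (n k) \<le> 2 * X}"
  have fin: "finite A" by (simp add: A_def)
  define k0 where "k0 = Min A"
  have k0: "k0 \<in> A" unfolding k0_def using False fin A_def by (intro Min_in) auto
  have "A \<subseteq> {k0..<k0 + R}"
  proof
    fix k assume k: "k \<in> A"
    have "k0 \<le> k" using k fin by (simp add: k0_def)
    moreover have "k < k0 + R"
    proof (rule ccontr)
      assume "\<not> k < k0 + R"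
      hence "R \<le> k - k0" by simp
      hence "q ^ R \<le> q ^ (k - k0)" using q_gt_1 by (intro power_increasing) auto
      hence "2 * X < q ^ (k - k0) * X" using assms by simp
      also have "\<dots> \<le> q ^ (k - k0) * real (n k0)"
        using k0 q_gt_1 by (intro mult_left_mono) (auto simp: A_def)
      also have "\<dots> \<le> real (n k)"
        using gap_power[of k0 "k - k0"] k0 \<open>k0 \<le> k\<close> by (auto simp: A_def)
      finally show False using k by (auto simp: A_def)
    qed
    ultimately show "k \<in> {k0..<k0 + R}" by simp
  qed
  from card_mono[OF _ this] show ?thesis by (simp add: A_def)
qed (metis (no_types, lifting) card.empty zero_le)

text \<open>The larger of two positive summands of \<open>c\<close> lies between
  \<open>c / 2\<close> and \<open>c\<close>, a dyadic window with at most \<open>R\<close> choices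
  of its index; the other index is then determined.\<close>

lemma card_sum_solutions:
  fixes a b c :: int
  assumes R: "q ^ R > 2" and ab: "a > 0" "b > 0"
  shows "card {(k, l). k \<in> {1..N} \<and> l \<in> {1..N} \<and> a * int (n k) + b * int (n l) = c} \<le> 2 * R"
proof (cases "c > 0")
  case False
  have "a * int (n k) + b * int (n l) \<noteq> c" if "k \<in> {1..N}" for k l
  proof -
    have "a * int (n k) > 0" "b * int (n l) \<ge> 0" using that ab n_pos[of k] by auto
    thus ?thesis using False by linarith
  qed
  hence "{(k, l). k \<in> {1..N} \<and> l \<in> {1..N} \<and> a * int (n k) + b * int (n l) = c} = {}" by blast
  thus ?thesis by (metis card.empty zero_le)
next
  case True
  define A where "A = {(k, l). k \<in> {1..N} \<and> l \<in> {1..N} \<and> a * int (n k) + b * int (n l) = c}"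
  define w where "w = (\<lambda>a. {k \<in> {1..N}. real_of_int c / (2 * a) \<le> real (n k) \<and> real (n k) \<le> 2 * (real_of_int c / (2 * a))})"
  have w_card: "card (w a) \<le> R" if "a > 0" for a
    unfolding w_def using that True by (intro card_window R) auto
  have fin: "finite (w a)" for a by (simp add: w_def)
  have A_fin: "finite A"
    by (rule finite_subset[of _ "{1..N} \<times> {1..N}"]) (auto simp: A_def)
  define A1 where "A1 = {p \<in> A. fst p \<in> w (of_int a)}"
  define A2 where "A2 = {p \<in> A. snd p \<in> w (of_int b)}"
  have "A \<subseteq> A1 \<union> A2"
  proof
    fix p assume p: "p \<in> A"
    obtain k l where kl: "p = (k, l)" by force
    have k: "k \<in> {1..N}" and l: "l \<in> {1..N}" and eq: "a * int (n k) + b * int (n l) = c"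
      using p kl by (auto simp: A_def)
    define x where "x = real_of_int a * real (n k)"
    define y where "y = real_of_int b * real (n l)"
    have xy: "x + y = real_of_int c" "x \<ge> 0" "y \<ge> 0"
      using ab by (simp_all add: x_def y_def flip: eq)
    have "x \<ge> of_int c / 2 \<or> y \<ge> of_int c / 2" using xy by linarith
    moreover have "k \<in> w (of_int a)" if "x \<ge> of_int c / 2"
    proof -
      have "x \<le> of_int c" using xy by linarith
      thus ?thesis using that ab k by (auto simp: w_def x_def field_simps)
    qed
    moreover have "l \<in> w (of_int b)" if "y \<ge> of_int c / 2"
    proof -
      have "y \<le> of_int c" using xy by linarith
      thus ?thesis using that ab l by (auto simp: w_def y_def field_simps)
    qed
    ultimately show "p \<in> A1 \<union> A2" using p kl by (auto simp: A1_def A2_def)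
  qed
  moreover have "card A1 \<le> R"
  proof -
    have "inj_on fst A1"
    proof (rule inj_onI)
      fix p p' assume p: "p \<in> A1" "p' \<in> A1" "fst p = fst p'"
      hence "b * int (n (snd p)) = b * int (n (snd p'))" by (auto simp: A1_def A_def)
      hence "n (snd p) = n (snd p')" using ab by simp
      hence "snd p = snd p'" using p n_inj[of "snd p" "snd p'"] by (auto simp: A1_def A_def)
      thus "p = p'" using p by (auto simp: prod_eq_iff)
    qed
    hence "card A1 \<le> card (w (of_int a))" by (rule card_inj_on_le) (auto simp: A1_def fin)
    thus ?thesis using w_card[of "of_int a"] ab by simp
  qed
  moreover have "card A2 \<le> R"
  proof -
    have "inj_on snd A2"
    proof (rule inj_onI)
      fix p p' assume p: "p \<in> A2" "p' \<in> A2" "snd p = snd p'"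
      hence "a * int (n (fst p)) = a * int (n (fst p'))" by (auto simp: A2_def A_def)
      hence "n (fst p) = n (fst p')" using ab by simp
      hence "fst p = fst p'" using p n_inj[of "fst p" "fst p'"] by (auto simp: A2_def A_def)
      thus "p = p'" using p by (auto simp: prod_eq_iff)
    qed
    hence "card A2 \<le> card (w (of_int b))" by (rule card_inj_on_le) (auto simp: A2_def fin)
    thus ?thesis using w_card[of "of_int b"] ab by simp
  qed
  moreover have "card A \<le> card (A1 \<union> A2)"
    using calculation(1) A_fin by (intro card_mono) (auto simp: A1_def A2_def)
  ultimately show ?thesis using card_Un_le[of A1 A2] unfolding A_def by linarith
qed

lemma card_difference_solutions:
  fixes a b :: nat and c :: int
  assumes "a = b \<longrightarrow> c \<noteq> 0"
  shows "card {(k, l). k \<in> {1..N} \<and> l \<in> {1..N} \<and> int a * int (n k) - int b * int (n l) = c}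
    \<le> dioph_count n N a b"
  unfolding dioph_count_def
proof (rule cSUP_upper)
  show "bdd_above ((\<lambda>c. card {(k, l). k \<in> {1..N} \<and> l \<in> {1..N} \<and> int a * int (n k) - int b * int (n l) = c})
     ` {c. a = b \<longrightarrow> c \<noteq> 0})"
  proof (rule bdd_aboveI2)
    fix c
    show "card {(k, l). k \<in> {1..N} \<and> l \<in> {1..N} \<and> int a * int (n k) - int b * int (n l) = c} \<le> card ({1..N} \<times> {1..N})"
      by (intro card_mono) auto
  qed
qed (use assms in auto)

text \<open>For coefficients of equal sign lacunarity alone bounds the count; for opposite signs the
  equation is of the type counted by \<open>dioph_count\<close>. The excluded solutions are the ones
  whose total contribution is the variance.\<close>

lemma card_solutions:
  fixes a b c :: int
  assumes R: "q ^ R0 > 2" "2 * R0 \<le> R"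
    and L: "\<And>a b. a \<in> {1..d} \<Longrightarrow> b \<in> {1..d} \<Longrightarrow> dioph_count n N a b \<le> R"
    and ab: "a \<in> {- int d..int d} - {0}" "b \<in> {- int d..int d} - {0}"
  shows "card {(k, l). k \<in> {1..N} \<and> l \<in> {1..N} \<and> a * int (n k) + b * int (n l) = c \<and> \<not> (k = l \<and> b = - a)} \<le> R"
    (is "card ?A \<le> R")
proof -
  let ?S = "\<lambda>a b c. {(k, l). k \<in> {1..N} \<and> l \<in> {1..N} \<and> a * int (n k) + b * int (n l) = (c::int)}"
  let ?D = "\<lambda>a b c. {(k, l). k \<in> {1..N} \<and> l \<in> {1..N} \<and> int a * int (n k) - int b * int (n l) = (c::int)}"
  have S_fin: "finite (?S a b c)" for a b c
    by (rule finite_subset[of _ "{1..N} \<times> {1..N}"]) auto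
  have D_fin: "finite (?D a b c)" for a b c
    by (rule finite_subset[of _ "{1..N} \<times> {1..N}"]) auto
  have neg: "card ?A \<le> R" if sub: "?A \<subseteq> ?D a' b' c'"
    and a': "a' \<in> {1..d}" "b' \<in> {1..d}" and eq: "a' = b' \<Longrightarrow> b = - a" for a' b' :: nat and c' :: int
  \<comment> \<open>The one case that \<open>dioph_count\<close> leaves out: its only solutions are
    \<open>k = l\<close>, and these are excluded from the set.\<close>
  proof (cases "a' = b' \<and> c' = 0")
    case True
    have False if "(k, l) \<in> ?A" for k l
    proof -
      have "(k, l) \<in> ?D a' b' c'" using sub that by blast
      hence "n k = n l" using True a' by auto
      hence "k = l" using that n_inj[of k l] by auto
      thus False using that eq True by auto
    qed
    hence "?A = {}" by blast
    thus ?thesis by (metis card.empty zero_le)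
  next
    case False
    have "card ?A \<le> card (?D a' b' c')" using sub D_fin by (intro card_mono) auto
    also have "\<dots> \<le> dioph_count n N a' b'" using False by (intro card_difference_solutions) auto
    also have "\<dots> \<le> R" by (intro L a')
    finally show ?thesis .
  qed
  consider "a > 0" "b > 0" | "a < 0" "b < 0" | "a > 0" "b < 0" | "a < 0" "b > 0"
    using ab by force
  thus ?thesis
  proof cases
    case 1
    have "card ?A \<le> card (?S a b c)" by (intro card_mono S_fin) auto
    thus ?thesis using card_sum_solutions[OF R(1) 1, of N c] R(2) by linarith
  next
    case 2
    have "card ?A \<le> card (?S (- a) (- b) (- c))" by (intro card_mono S_fin) auto
    moreover have "card (?S (- a) (- b) (- c)) \<le> 2 * R0"
      using 2 by (intro card_sum_solutions[OF R(1)]) auto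
    ultimately show ?thesis using R(2) by linarith
  next
    case 3
    show ?thesis by (rule neg[of "nat a" "nat (- b)" c]) (use 3 ab in auto)
  next
    case 4
    show ?thesis by (rule neg[of "nat (- a)" "nat b" "- c"]) (use 4 ab in auto)
  qed
qed

end

section \<open>Trigonometric polynomials in complex form\<close>

locale trig_poly =
  fixes d :: nat and f :: "real \<Rightarrow> real" and fh :: "int \<Rightarrow> complex"
  assumes f_eq: "complex_of_real (f x) = (\<Sum>a\<in>{- int d..int d} - {0}. fh a * ex a x)"
    and fh_cnj: "fh (- a) = cnj (fh a)"
begin

abbreviation freqs :: "int set" where
  "freqs \<equiv> {- int d..int d} - {0}"

text \<open>The l^1 norm of the coefficients serves at once as a bound for each coefficient, for
  \<open>f\<close>, for its antiderivative and, up to \<open>2 * pi * d\<close>, for its Lipschitz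
  constant.\<close>

definition Z :: real where
  "Z = (\<Sum>a\<in>freqs. norm (fh a))"

lemma norm_fh_le: "a \<in> freqs \<Longrightarrow> norm (fh a) \<le> Z"
  unfolding Z_def by (rule member_le_sum) auto

definition var :: real where
  "var = (\<Sum>a\<in>freqs. (norm (fh a))\<^sup>2)"

lemma var_complex: "complex_of_real var = (\<Sum>a\<in>freqs. fh a * fh (- a))"
  unfolding var_def fh_cnj of_real_sum complex_norm_square ..

lemma integral_f_square: "integral {0..1} (\<lambda>x. (f x)\<^sup>2) = var"
proof -
  let ?z = "\<lambda>(p, p'). fh p * fh p'" and ?\<nu> = "\<lambda>(p, p'). p + p'"
  have sq: "complex_of_real ((f x)\<^sup>2) = (\<Sum>p\<in>freqs \<times> freqs. ?z p * ex (?\<nu> p) x)" for x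
    unfolding square_as_trig_sum[OF f_eq] by (simp add: case_prod_unfold)
  have "complex_of_real (integral {0..1} (\<lambda>x. (f x)\<^sup>2)) = (\<Sum>p | p \<in> freqs \<times> freqs \<and> ?\<nu> p = 0. ?z p)"
    by (rule integral_trig_sum(2)[OF _ sq]) auto
  also have "\<dots> = (\<Sum>a\<in>freqs. fh a * fh (- a))"
    by (rule sum.reindex_bij_witness[of _ "\<lambda>a. (a, - a)" fst]) (auto simp: add_eq_0_iff)
  also have "\<dots> = complex_of_real var" by (rule var_complex[symmetric])
  finally show ?thesis by (simp only: of_real_eq_iff)
qed

lemma f_continuous: "continuous_on A f"
proof -
  have "continuous_on A (\<lambda>x. Re (\<Sum>a\<in>freqs. fh a * ex a x))"
    unfolding ex_def by (intro continuous_intros)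
  thus ?thesis by (simp flip: f_eq)
qed

lemma L2norm_eq: "(L2norm f)\<^sup>2 = var" "L2norm f \<ge> 0"
proof -
  have "set_integrable lborel {0..1} (\<lambda>x. (f x)\<^sup>2)"
    by (intro borel_integrable_atLeastAtMost' continuous_intros f_continuous)
  from set_borel_integral_eq_integral(2)[OF this]
  have "L2norm f = sqrt var" by (simp add: L2norm_def integral_f_square)
  moreover have "var \<ge> 0" by (auto simp: var_def intro: sum_nonneg)
  ultimately show "(L2norm f)\<^sup>2 = var" "L2norm f \<ge> 0" by auto
qed

lemma var_pos:
  assumes "f x \<noteq> 0"
  shows "var > 0"
proof (rule ccontr)
  assume "\<not> var > 0"
  hence "var = 0" by (auto simp: var_def intro!: antisym sum_nonneg)
  hence "\<forall>a\<in>freqs. fh a = 0"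
    by (subst (asm) var_def, subst (asm) sum_nonneg_eq_0_iff) auto
  hence "complex_of_real (f x) = 0" by (simp add: f_eq)
  thus False using assms by simp
qed

end

locale lacunary_trig = lacunary + trig_poly
begin

text \<open>The terms with \<open>k = l\<close> and opposite frequencies are constant and sum to
  exactly \<open>N * var\<close>. What remains has coefficients at most \<open>Z\<^sup>2\<close>
  and, by \<open>card_solutions\<close>, frequencies of multiplicity at most
  \<open>card freqs ^ 2 * R\<close>. The other factor \<open>card freqs ^ 2\<close> counts the terms
  per pair.\<close>

lemma integral_quadratic_form:
  assumes R: "q ^ R0 > 2" "2 * R0 \<le> R"
    and L: "\<And>a b. a \<in> {1..d} \<Longrightarrow> b \<in> {1..d} \<Longrightarrow> dioph_count n N a b \<le> R"
    and Pr: "Pr \<subseteq> {1..N} \<times> {1..N}" "\<And>k. k \<in> {1..N} \<Longrightarrow> (k, k) \<in> Pr"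
  defines "h \<equiv> \<lambda>x. (\<Sum>(k, l)\<in>Pr. f (real (n k) * x) * f (real (n l) * x)) - real N * var"
  shows "(\<lambda>x. (h x)\<^sup>2) integrable_on {0..1}"
    and "integral {0..1} (\<lambda>x. (h x)\<^sup>2) \<le> Z ^ 4 * (real (card freqs)) ^ 4 * real (card Pr) * real R"
proof -
  define T where "T = Pr \<times> (freqs \<times> freqs)"
  define Dg where "Dg = (\<lambda>(k, a). ((k, k), (a, - a))) ` ({1..N} \<times> freqs)"
  define z where "z = (\<lambda>(kl::nat\<times>nat, a, b). fh a * fh b)"
  define \<nu> where "\<nu> = (\<lambda>((k, l), a, b). a * int (n k) + b * int (n l))"
  have Pr_fin: "finite Pr" using Pr(1) by (rule finite_subset) auto
  hence T_fin: "finite T" by (simp add: T_def)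
  have Dg_sub: "Dg \<subseteq> T" using Pr(2) by (auto simp: Dg_def T_def)
  have full: "complex_of_real (\<Sum>(k, l)\<in>Pr. f (real (n k) * x) * f (real (n l) * x)) = (\<Sum>p\<in>T. z p * ex (\<nu> p) x)" for x
  proof -
    have "complex_of_real (f (real (n k) * x) * f (real (n l) * x))
       = (\<Sum>(a, b)\<in>freqs \<times> freqs. fh a * fh b * ex (a * int (n k) + b * int (n l)) x)" for k l
      unfolding of_real_mult f_eq sum_product sum.cartesian_product ex_mult_nat ex_add
      by (simp add: mult_ac)
    hence "complex_of_real (\<Sum>(k, l)\<in>Pr. f (real (n k) * x) * f (real (n l) * x))
      = (\<Sum>(k, l)\<in>Pr. \<Sum>(a, b)\<in>freqs \<times> freqs. fh a * fh b * ex (a * int (n k) + b * int (n l)) x)"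
      by (simp add: case_prod_unfold)
    also have "\<dots> = (\<Sum>kl\<in>Pr. \<Sum>ab\<in>freqs \<times> freqs. z (kl, ab) * ex (\<nu> (kl, ab)) x)"
      by (simp only: z_def \<nu>_def case_prod_unfold fst_conv snd_conv)
    also have "\<dots> = (\<Sum>p\<in>T. z p * ex (\<nu> p) x)"
      unfolding T_def by (subst sum.cartesian_product) (simp only: case_prod_unfold prod.collapse)
    finally show ?thesis .
  qed
  have diag: "(\<Sum>p\<in>Dg. z p * ex (\<nu> p) x) = complex_of_real (real N * var)" for x
  proof -
    have "(\<Sum>p\<in>Dg. z p * ex (\<nu> p) x) = (\<Sum>(k, a)\<in>{1..N} \<times> freqs. fh a * fh (- a))"
      unfolding Dg_def by (subst sum.reindex) (auto simp: inj_on_def z_def \<nu>_def intro!: sum.cong)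
    also have "\<dots> = (\<Sum>k\<in>{1..N}. \<Sum>a\<in>freqs. fh a * fh (- a))"
      by (subst sum.cartesian_product) simp
    finally show ?thesis by (simp add: var_complex)
  qed
  have h: "complex_of_real (h x) = (\<Sum>p\<in>T - Dg. z p * ex (\<nu> p) x)" for x
    unfolding h_def of_real_diff full by (subst sum_diff[OF T_fin Dg_sub]) (simp add: diag)
  have z_le: "norm (z p) \<le> Z\<^sup>2" if "p \<in> T - Dg" for p
    using that norm_fh_le unfolding z_def power2_eq_square T_def
    by (auto simp: norm_mult intro!: mult_mono order_trans[OF norm_ge_zero norm_fh_le])
  have count: "card {p \<in> T - Dg. \<nu> p = c} \<le> card freqs ^ 2 * R" for c
  proof -
    define B where "B = (\<lambda>(a, b). {(k, l). k \<in> {1..N} \<and> l \<in> {1..N} \<and> a * int (n k) + b * int (n l) = c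
         \<and> \<not> (k = l \<and> b = - a)})"
    have B_fin: "finite (B ab)" for ab
      by (rule finite_subset[of _ "{1..N} \<times> {1..N}"]) (auto simp: B_def)
    have "{p \<in> T - Dg. \<nu> p = c} \<subseteq> prod.swap ` Sigma (freqs \<times> freqs) B"
    proof
      fix p assume p: "p \<in> {p \<in> T - Dg. \<nu> p = c}"
      obtain k l a b where eq: "p = ((k, l), (a, b))" by (metis prod.exhaust)
      have "((a, b), (k, l)) \<in> Sigma (freqs \<times> freqs) B"
        using p Pr(1) by (auto simp: eq T_def Dg_def \<nu>_def B_def)
      thus "p \<in> prod.swap ` Sigma (freqs \<times> freqs) B" unfolding eq by force
    qed
    hence "card {p \<in> T - Dg. \<nu> p = c} \<le> card (prod.swap ` Sigma (freqs \<times> freqs) B)"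
      by (rule card_mono[rotated]) (intro finite_imageI finite_SigmaI B_fin, simp_all)
    also have "\<dots> \<le> card (Sigma (freqs \<times> freqs) B)"
      by (intro card_image_le finite_SigmaI B_fin) simp_all
    also have "\<dots> = (\<Sum>ab\<in>freqs \<times> freqs. card (B ab))"
      by (rule card_SigmaI) (simp_all add: B_fin)
    also have "\<dots> \<le> (\<Sum>ab\<in>freqs \<times> freqs. R)"
    proof (rule sum_mono)
      fix ab assume "ab \<in> freqs \<times> freqs"
      then obtain a b where "ab = (a, b)" "a \<in> freqs" "b \<in> freqs" by blast
      thus "card (B ab) \<le> R" using card_solutions[OF R L, where d = d and a = a and b = b and c = c] by (simp add: B_def)
    qed
    also have "\<dots> = card freqs ^ 2 * R" by (simp add: card_cartesian_product power2_eq_square)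
    finally show ?thesis .
  qed
  show "(\<lambda>x. (h x)\<^sup>2) integrable_on {0..1}"
    by (rule integral_square_trig_sum_le(1)[OF _ h z_le count]) (use T_fin in auto)
  have "integral {0..1} (\<lambda>x. (h x)\<^sup>2) \<le> (Z\<^sup>2)\<^sup>2 * real (card (T - Dg)) * real (card freqs ^ 2 * R)"
    by (rule integral_square_trig_sum_le(2)[OF _ h z_le count]) (use T_fin in auto)
  also have "\<dots> \<le> (Z\<^sup>2)\<^sup>2 * real (card T) * real (card freqs ^ 2 * R)"
    using T_fin by (intro mult_left_mono mult_right_mono of_nat_mono card_mono) auto
  also have "card T = card Pr * card freqs ^ 2"
    by (simp add: T_def card_cartesian_product power2_eq_square)
  also have "(Z\<^sup>2)\<^sup>2 * real (card Pr * card freqs ^ 2) * real (card freqs ^ 2 * R)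
     = Z ^ 4 * (real (card freqs)) ^ 4 * real (card Pr) * real R"
  proof -
    have "(z\<^sup>2)\<^sup>2 * real (p * m\<^sup>2) * real (m\<^sup>2 * r) = z ^ 4 * real m ^ 4 * real p * real r" for z :: real and p m r
      by (simp add: power4_eq_xxxx power2_eq_square)
    thus ?thesis .
  qed
  finally show "integral {0..1} (\<lambda>x. (h x)\<^sup>2) \<le> Z ^ 4 * (real (card freqs)) ^ 4 * real (card Pr) * real R" .
qed

end

section \<open>Local averages of lacunary sums\<close>

lemma ex_deriv:
  "((\<lambda>x. ex k x) has_vector_derivative (2 * pi * of_int k * \<i>) * ex k x) (at x within A)"
proof -
  define c where "c = 2 * complex_of_real pi * of_int k * \<i>"
  have ex: "ex k x = exp (c * of_real x)" for x
    by (simp add: ex_def c_def cis_conv_exp mult_ac)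
  have "((\<lambda>z. exp (c * z)) has_field_derivative c * exp (c * of_real x)) (at (of_real x))"
    by (auto intro!: derivative_eq_intros)
  from has_vector_derivative_real_field[OF this] show ?thesis by (simp add: ex c_def)
qed

lemma norm_ex [simp]: "norm (ex k x) = 1"
  by (simp add: ex_def)

lemma ex_nat: "ex k (real m) = 1"
  using cos_int_2pin[of "k * int m"] sin_int_2pin[of "k * int m"]
  by (simp add: ex_def complex_eq_iff mult.assoc)

context trig_poly
begin

lemma Z_nonneg: "Z \<ge> 0"
  by (auto simp: Z_def intro: sum_nonneg)

lemma f_Re: "f x = (\<Sum>a\<in>freqs. Re (fh a * ex a x))"
  using arg_cong[OF f_eq[of x], of Re] by (simp only: Re_sum Re_complex_of_real)

lemma Re_ex_deriv:
  "((\<lambda>x. Re (z * ex a x)) has_real_derivative Re (z * ((2 * pi * of_int a * \<i>) * ex a x))) (at x)"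
proof -
  have "((\<lambda>x. z * ex a x) has_vector_derivative z * ((2 * pi * of_int a * \<i>) * ex a x)) (at x)"
    by (intro has_vector_derivative_mult_right ex_deriv)
  from bounded_linear.has_vector_derivative[OF bounded_linear_Re this]
  show ?thesis by (simp add: has_real_derivative_iff_has_vector_derivative)
qed

lemma f_bound: "\<bar>f x\<bar> \<le> Z"
proof -
  have "\<bar>f x\<bar> = norm (complex_of_real (f x))" by simp
  also have "\<dots> \<le> Z"
    unfolding f_eq Z_def by (rule order_trans[OF norm_sum]) (simp add: norm_mult)
  finally show ?thesis .
qed

lemma f_lipschitz: "\<bar>f x - f y\<bar> \<le> 2 * pi * real d * Z * \<bar>x - y\<bar>"
proof -
  define f' where "f' = (\<lambda>x. \<Sum>a\<in>freqs. Re (fh a * ((2 * pi * of_int a * \<i>) * ex a x)))"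
  have der: "(f has_real_derivative f' x) (at x)" for x
    unfolding f_Re[abs_def] f'_def by (intro DERIV_sum Re_ex_deriv)
  have bound: "norm (f' x) \<le> 2 * pi * real d * Z" for x
  proof -
    have "norm (f' x) \<le> (\<Sum>a\<in>freqs. norm (fh a * ((2 * pi * of_int a * \<i>) * ex a x)))"
      unfolding f'_def by (intro order_trans[OF norm_sum] sum_mono) (simp only: real_norm_def abs_Re_le_cmod)
    also have "\<dots> \<le> (\<Sum>a\<in>freqs. 2 * pi * real d * norm (fh a))"
    proof (rule sum_mono)
      fix a assume "a \<in> freqs"
      hence "\<bar>real_of_int a\<bar> \<le> real d" by auto
      hence "2 * pi * norm (fh a) * \<bar>real_of_int a\<bar> \<le> 2 * pi * norm (fh a) * real d"
        by (intro mult_left_mono) auto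
      thus "norm (fh a * ((2 * pi * of_int a * \<i>) * ex a x)) \<le> 2 * pi * real d * norm (fh a)"
        by (simp add: norm_mult mult_ac)
    qed
    also have "\<dots> = 2 * pi * real d * Z" by (simp add: Z_def sum_distrib_left)
    finally show ?thesis .
  qed
  have "norm (f x - f y) \<le> 2 * pi * real d * Z * norm (x - y)"
    by (rule field_differentiable_bound[of UNIV f f']) (simp_all only: der bound convex_UNIV UNIV_I)
  thus ?thesis by simp
qed

text \<open>Bounded and periodic, as an antiderivative of \<open>f\<close>, because frequency 0 is
  absent.\<close>

definition prim :: "real \<Rightarrow> real" where
  "prim x = (\<Sum>a\<in>freqs. Re (fh a / (2 * pi * of_int a * \<i>) * ex a x))"

lemma prim_deriv: "(prim has_real_derivative f x) (at x)"
proof -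
  have "(prim has_real_derivative (\<Sum>a\<in>freqs. Re (fh a / (2 * pi * of_int a * \<i>) * ((2 * pi * of_int a * \<i>) * ex a x)))) (at x)"
    unfolding prim_def[abs_def] by (intro DERIV_sum Re_ex_deriv)
  also have "(\<Sum>a\<in>freqs. Re (fh a / (2 * pi * of_int a * \<i>) * ((2 * pi * of_int a * \<i>) * ex a x))) = f x"
    unfolding f_Re
  proof (intro sum.cong refl arg_cong[of _ _ Re])
    fix a assume "a \<in> freqs"
    moreover define c where "c = 2 * complex_of_real pi * of_int a * \<i>"
    ultimately have "c \<noteq> 0" by simp
    hence "fh a / c * (c * ex a x) = fh a * ex a x" by simp
    thus "fh a / (2 * pi * of_int a * \<i>) * ((2 * pi * of_int a * \<i>) * ex a x) = fh a * ex a x"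
      by (simp only: c_def of_real_mult of_real_numeral of_real_of_int_eq)
  qed
  finally show ?thesis .
qed

lemma prim_bound: "\<bar>prim x\<bar> \<le> Z"
proof -
  have "\<bar>prim x\<bar> \<le> (\<Sum>a\<in>freqs. norm (fh a / (2 * pi * of_int a * \<i>) * ex a x))"
    unfolding prim_def by (intro order_trans[OF sum_abs] sum_mono abs_Re_le_cmod)
  also have "\<dots> \<le> (\<Sum>a\<in>freqs. norm (fh a))"
  proof (rule sum_mono)
    fix a assume a: "a \<in> freqs"
    have "1 * 1 \<le> (2 * pi) * \<bar>real_of_int a\<bar>" using a pi_gt3 by (intro mult_mono) auto
    hence "norm (fh a) / (2 * pi * \<bar>real_of_int a\<bar>) \<le> norm (fh a) / 1"
      by (intro divide_left_mono) auto
    thus "norm (fh a / (2 * pi * of_int a * \<i>) * ex a x) \<le> norm (fh a)"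
      by (simp add: norm_mult norm_divide)
  qed
  finally show ?thesis by (simp add: Z_def)
qed

lemma prim_nat: "prim (real m) = prim 0"
proof -
  have "ex k 0 = 1" for k by (simp add: ex_def)
  thus ?thesis by (simp add: prim_def ex_nat)
qed

definition avg :: "real \<Rightarrow> real \<Rightarrow> nat \<Rightarrow> real" where
  "avg a h m = integral {a..a + h} (\<lambda>y. f (real m * y)) / h"

lemma scaled_integrable: "(\<lambda>y. f (real m * y)) integrable_on {a..b}"
  by (intro integrable_continuous_interval continuous_on_compose2[OF f_continuous[of UNIV]] continuous_intros) auto

lemma avg_eq:
  assumes "m > 0" "h > 0"
  shows "avg a h m = (prim (real m * (a + h)) - prim (real m * a)) / (real m * h)"
proof -
  have "((\<lambda>y. prim (real m * y) / real m) has_vector_derivative f (real m * y)) (at y within {a..a+h})" for y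
  proof -
    have "((\<lambda>y. prim (real m * y) / real m) has_real_derivative f (real m * y)) (at y)"
      using assms by (auto intro!: derivative_eq_intros DERIV_chain2[OF prim_deriv])
    thus ?thesis
      by (auto simp: has_real_derivative_iff_has_vector_derivative intro: has_vector_derivative_at_within)
  qed
  hence "((\<lambda>y. f (real m * y)) has_integral prim (real m * (a + h)) / real m - prim (real m * a) / real m) {a..a+h}"
    using assms by (intro fundamental_theorem_of_calculus) auto
  thus ?thesis using assms by (simp add: avg_def integral_unique field_simps)
qed

text \<open>Oscillation: as the antiderivative is bounded, only the two endpoints of the interval
  count.\<close>

lemma avg_small:
  assumes "m > 0" "h > 0"
  shows "\<bar>avg a h m\<bar> \<le> 2 * Z / (real m * h)"
proof -
  have "\<bar>prim (real m * (a + h)) - prim (real m * a)\<bar> \<le> 2 * Z"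
    using prim_bound[of "real m * (a + h)"] prim_bound[of "real m * a"] by linarith
  thus ?thesis using assms by (simp add: avg_eq divide_right_mono)
qed

text \<open>The opposite regime: for small \<open>m * h\<close> the integrand hardly varies, by the
  Lipschitz bound.\<close>

lemma avg_close:
  assumes "h > 0" "x \<in> {a..a + h}"
  shows "\<bar>avg a h m - f (real m * x)\<bar> \<le> 2 * pi * real d * Z * (real m * h)"
proof -
  let ?C = "2 * pi * real d * Z * (real m * h)"
  have "((\<lambda>y. f (real m * y) - f (real m * x)) has_integral
      (integral {a..a+h} (\<lambda>y. f (real m * y)) - h * f (real m * x))) {a..a+h}"
    using assms has_integral_const_real[of "f (real m * x)" a "a + h"]
    by (intro has_integral_diff integrable_integral scaled_integrable) auto
  hence "norm (integral {a..a+h} (\<lambda>y. f (real m * y)) - h * f (real m * x)) \<le> ?C * measure lborel {a..a + h}"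
  proof (rule has_integral_bound_real[rotated 2, where S = "{}"])
    fix y assume y: "y \<in> {a..a + h} - {}"
    have "norm (f (real m * y) - f (real m * x)) \<le> 2 * pi * real d * Z * \<bar>real m * y - real m * x\<bar>"
      using f_lipschitz by simp
    also have "\<bar>real m * y - real m * x\<bar> = real m * \<bar>y - x\<bar>"
      by (simp add: abs_mult flip: right_diff_distrib)
    also have "2 * pi * real d * Z * (real m * \<bar>y - x\<bar>) \<le> ?C"
      using y assms Z_nonneg by (intro mult_left_mono) auto
    finally show "norm (f (real m * y) - f (real m * x)) \<le> ?C" .
  qed (use assms Z_nonneg in auto)
  hence "\<bar>integral {a..a+h} (\<lambda>y. f (real m * y)) - h * f (real m * x)\<bar> / h \<le> ?C * h / h"
    using assms by (intro divide_right_mono) auto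
  also have "\<bar>integral {a..a+h} (\<lambda>y. f (real m * y)) - h * f (real m * x)\<bar> / h = \<bar>avg a h m - f (real m * x)\<bar>"
  proof -
    have "avg a h m - f (real m * x) = (integral {a..a+h} (\<lambda>y. f (real m * y)) - h * f (real m * x)) / h"
      using assms by (simp add: avg_def field_simps)
    thus ?thesis using assms by simp
  qed
  finally show ?thesis using assms by simp
qed

text \<open>A unit interval contains whole periods only; this makes the martingale start at
  0.\<close>

lemma avg_integer:
  assumes "m > 0"
  shows "avg (real j) 1 m = 0"
proof -
  have "prim (real m * (real j + 1)) = prim 0" "prim (real m * real j) = prim 0"
    using prim_nat[of "m * (j + 1)"] prim_nat[of "m * j"] by (simp_all add: algebra_simps)
  thus ?thesis by (subst avg_eq[OF assms]) simp_all
qed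

end

lemma sum_integral_adjacent:
  fixes F :: "real \<Rightarrow> real"
  assumes "\<And>a b. F integrable_on {a..b}" "h \<ge> 0"
  shows "(\<Sum>l<m. integral {a + real l * h..a + real l * h + h} F) = integral {a..a + real m * h} F"
proof (induction m)
  case (Suc m)
  have "integral {a..a + real m * h} F + integral {a + real m * h..a + real m * h + h} F
      = integral {a..a + real m * h + h} F"
    by (intro Henstock_Kurzweil_Integration.integral_combine assms) (use assms(2) in auto)
  thus ?case using Suc by (simp add: algebra_simps)
qed simp

context trig_poly
begin

text \<open>Averages over adjacent pieces average to the whole, the source of the martingale
  property.\<close>

lemma avg_refine:
  assumes "h > 0" "m > 0"
  shows "(\<Sum>l<m. avg (a + real l * h) h k) = real m * avg a (real m * h) k"
proof -
  have "(\<Sum>l<m. avg (a + real l * h) h k)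
      = (\<Sum>l<m. integral {a + real l * h..a + real l * h + h} (\<lambda>y. f (real k * y))) / h"
    by (simp only: avg_def sum_divide_distrib)
  also have "(\<Sum>l<m. integral {a + real l * h..a + real l * h + h} (\<lambda>y. f (real k * y)))
      = integral {a..a + real m * h} (\<lambda>y. f (real k * y))"
    by (rule sum_integral_adjacent) (use assms in \<open>auto intro: scaled_integrable\<close>)
  also have "integral {a..a + real m * h} (\<lambda>y. f (real k * y)) / h = real m * avg a (real m * h) k"
    using assms by (simp add: avg_def)
  finally show ?thesis .
qed

end

lemma geometric_sum_le:
  fixes q :: real
  assumes "q > 1"
  shows "(\<Sum>j<m. (1 / q) ^ j) \<le> q / (q - 1)"
proof -
  have "(\<Sum>j<m. (1 / q) ^ j) \<le> (\<Sum>j. (1 / q) ^ j)"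
    using assms by (intro sum_le_suminf summable_geometric) auto
  also have "\<dots> = q / (q - 1)"
    using assms by (subst suminf_geometric) (auto simp: field_simps)
  finally show ?thesis .
qed

context lacunary_trig
begin

text \<open>\<open>q / (q - 1)\<close> sums the geometric series on either side of the cut,
  \<open>2 * pi * d * Z\<close> stems from the slow frequencies and \<open>4 * Z\<close> from the
  fast ones.\<close>

definition C0 :: real where
  "C0 = q / (q - 1) * (2 * pi * real d * Z + 4 * Z)"

lemma C0_nonneg: "C0 \<ge> 0"
  using q_gt_1 Z_nonneg by (auto simp: C0_def)

text \<open>On an interval of length about \<open>1 / n e\<close> the terms up to \<open>e\<close>
  are almost constant and the later ones almost cancel. Both errors decay geometrically away from
  \<open>e\<close>, so the total does not depend on \<open>e\<close> or \<open>N\<close>.\<close>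

lemma avg_partial_sum:
  assumes e: "1 \<le> e" "e \<le> N" and h: "h > 0" "real (n e) * h \<le> 1" "1 \<le> 2 * (real (n e) * h)"
    and x: "x \<in> {a..a + h}"
  shows "\<bar>(\<Sum>k=1..N. avg a h (n k)) - (\<Sum>k=1..e. f (real (n k) * x))\<bar> \<le> C0"
proof -
  define G where "G = q / (q - 1)"
  have low: "(\<Sum>k=1..e. real (n k) * h) \<le> G"
  proof -
    have "(\<Sum>k=1..e. real (n k) * h) \<le> (\<Sum>k=1..e. (1 / q) ^ (e - k))"
    proof (rule sum_mono)
      fix k assume k: "k \<in> {1..e}"
      have "q ^ (e - k) * (real (n k) * h) = q ^ (e - k) * real (n k) * h" by simp
      also have "\<dots> \<le> real (n e) * h"
        using gap_power[of k "e - k"] k h by (intro mult_right_mono) auto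
      also have "\<dots> \<le> 1" by (rule h)
      finally show "real (n k) * h \<le> (1 / q) ^ (e - k)"
        using q_gt_1 by (simp add: power_divide field_simps)
    qed
    also have "\<dots> = (\<Sum>j<e. (1 / q) ^ j)"
      by (rule sum.reindex_bij_witness[of _ "\<lambda>j. e - j" "\<lambda>k. e - k"]) auto
    also have "\<dots> \<le> G" unfolding G_def by (rule geometric_sum_le[OF q_gt_1])
    finally show ?thesis .
  qed
  have high: "(\<Sum>k=e+1..N. 1 / (real (n k) * h)) \<le> 2 * G"
  proof -
    have "(\<Sum>k=e+1..N. 1 / (real (n k) * h)) \<le> (\<Sum>k=e+1..N. 2 * (1 / q) ^ (k - e - 1))"
    proof (rule sum_mono)
      fix k assume k: "k \<in> {e+1..N}"
      have pos: "real (n k) * h > 0" using n_pos[of k] k h by auto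
      \<comment> \<open>The factor 2 arises because the dyadic length \<open>h\<close> matches
        \<open>1 / n e\<close> only up to a factor 2.\<close>
      have "q ^ (k - e - 1) * 1 \<le> q ^ (k - e) * (2 * (real (n e) * h))"
        using h q_gt_1 by (intro mult_mono power_increasing) auto
      also have "\<dots> = 2 * (q ^ (k - e) * real (n e) * h)" by simp
      also have "\<dots> \<le> 2 * (real (n k) * h)"
        using gap_power[of e "k - e"] k h e by (intro mult_left_mono mult_right_mono) auto
      finally show "1 / (real (n k) * h) \<le> 2 * (1 / q) ^ (k - e - 1)"
        using q_gt_1 pos by (simp add: power_divide field_simps)
    qed
    also have "\<dots> = (\<Sum>j<N - e. 2 * (1 / q) ^ j)"
      by (rule sum.reindex_bij_witness[of _ "\<lambda>j. e + 1 + j" "\<lambda>k. k - e - 1"]) auto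
    also have "\<dots> \<le> 2 * G"
      using geometric_sum_le[OF q_gt_1, of "N - e"] by (simp add: G_def flip: sum_distrib_left)
    finally show ?thesis .
  qed
  have split: "{1..N} = {1..e} \<union> {e+1..N}" using e by auto
  have "(\<Sum>k=1..N. avg a h (n k)) - (\<Sum>k=1..e. f (real (n k) * x))
     = (\<Sum>k=1..e. avg a h (n k) - f (real (n k) * x)) + (\<Sum>k=e+1..N. avg a h (n k))"
    unfolding split by (subst sum.union_disjoint) (auto simp: sum_subtractf)
  hence "\<bar>(\<Sum>k=1..N. avg a h (n k)) - (\<Sum>k=1..e. f (real (n k) * x))\<bar>
     \<le> \<bar>\<Sum>k=1..e. avg a h (n k) - f (real (n k) * x)\<bar> + \<bar>\<Sum>k=e+1..N. avg a h (n k)\<bar>"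
    by (simp add: abs_triangle_ineq)
  also have "\<dots> \<le> (\<Sum>k=1..e. 2 * pi * real d * Z * (real (n k) * h)) + (\<Sum>k=e+1..N. 2 * Z * (1 / (real (n k) * h)))"
  proof (intro add_mono order_trans[OF sum_abs] sum_mono)
    fix k assume "k \<in> {1..e}"
    show "\<bar>avg a h (n k) - f (real (n k) * x)\<bar> \<le> 2 * pi * real d * Z * (real (n k) * h)"
      by (rule avg_close[OF h(1) x])
  next
    fix k assume "k \<in> {e+1..N}"
    thus "\<bar>avg a h (n k)\<bar> \<le> 2 * Z * (1 / (real (n k) * h))"
      using avg_small[of "n k" h a] n_pos[of k] h(1) by simp
  qed
  also have "\<dots> = 2 * pi * real d * Z * (\<Sum>k=1..e. real (n k) * h) + 2 * Z * (\<Sum>k=e+1..N. 1 / (real (n k) * h))"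
    by (simp only: sum_distrib_left)
  also have "\<dots> \<le> 2 * pi * real d * Z * G + 2 * Z * (2 * G)"
    using low high Z_nonneg by (intro add_mono mult_left_mono) auto
  also have "\<dots> = C0" by (simp add: C0_def G_def algebra_simps)
  finally show ?thesis .
qed

end

section \<open>The dyadic martingale of a lacunary sum\<close>

locale lacunary_blocks = lacunary_trig +
  fixes N B :: nat and c :: real
  assumes N_pos: "N \<ge> 1" and B_pos: "B \<ge> 1" and c_pos: "c > 0"
begin

definition e :: "nat \<Rightarrow> nat" where
  "e i = min (i * B) N"

text \<open>For positive \<open>i\<close> the length \<open>1 / 2 ^ lev i\<close> lies between
  \<open>1 / (2 * n (e i))\<close> and \<open>1 / n (e i)\<close>. Level 0 is set by hand, making
  the unit interval the root.\<close>

definition lev :: "nat \<Rightarrow> nat" where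
  "lev i = (if i = 0 then 0 else LEAST m. n (e i) \<le> 2 ^ m)"

definition br :: "nat \<Rightarrow> nat" where
  "br i = 2 ^ (lev (Suc i) - lev i)"

definition lft :: "nat \<Rightarrow> nat \<Rightarrow> real" where
  "lft i j = real j / 2 ^ lev i"

text \<open>Closed intervals, so neighbours share an endpoint; this is harmless for covering and for
  integrals.\<close>

definition atom :: "nat \<Rightarrow> nat \<Rightarrow> real set" where
  "atom i j = {lft i j..lft i j + 1 / 2 ^ lev i}"

text \<open>All \<open>N\<close> terms are averaged, not only those up to \<open>e i\<close>, so the
  martingale property is exact; \<open>MM_close\<close> shows that the later terms contribute
  little.\<close>

definition MM :: "nat \<Rightarrow> nat \<Rightarrow> real" where
  "MM i j = (\<Sum>k=1..N. avg (lft i j) (1 / 2 ^ lev i) (n k)) / c"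

definition T :: "nat \<Rightarrow> real \<Rightarrow> real" where
  "T i x = (\<Sum>k=1..e i. f (real (n k) * x)) / c"

lemma e_mono: "e i \<le> e (Suc i)"
  by (simp add: e_def min_def)

lemma e_Suc_diff: "e (Suc i) - e i \<le> B"
  by (auto simp: e_def min_def)

lemma e_bounds: "i > 0 \<Longrightarrow> 1 \<le> e i" "e i \<le> N"
  using N_pos B_pos by (auto simp: e_def)

lemma lev_bounds:
  assumes "i > 0"
  shows "n (e i) \<le> 2 ^ lev i" and "2 ^ lev i \<le> 2 * n (e i)"
proof -
  have ex: "n (e i) \<le> 2 ^ n (e i)" by (rule less_imp_le[OF less_exp])
  show 1: "n (e i) \<le> 2 ^ lev i"
    unfolding lev_def using assms LeastI[of "\<lambda>m. n (e i) \<le> 2 ^ m", OF ex] by simp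
  show "2 ^ lev i \<le> 2 * n (e i)"
  proof (cases "lev i")
    case 0
    thus ?thesis using n_pos[of "e i"] e_bounds assms by simp
  next
    case (Suc m)
    have "\<not> n (e i) \<le> 2 ^ m"
    proof
      assume "n (e i) \<le> 2 ^ m"
      hence "lev i \<le> m" unfolding lev_def using assms by (simp add: Least_le)
      thus False using Suc by simp
    qed
    thus ?thesis using Suc by simp
  qed
qed

lemma lev_mono: "lev i \<le> lev (Suc i)"
proof (cases "i = 0")
  case False
  have "n (e i) \<le> n (e (Suc i))"
    using n_less[of "e i" "e (Suc i)"] e_mono[of i] e_bounds[of i] False by (cases "e i = e (Suc i)") auto
  also have "\<dots> \<le> 2 ^ lev (Suc i)" by (rule lev_bounds) simp
  finally have "(LEAST m. n (e i) \<le> 2 ^ m) \<le> lev (Suc i)" by (rule Least_le)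
  thus ?thesis using False by (simp add: lev_def[of i])
qed (simp add: lev_def)

lemma br_pos: "br i > 0"
  by (simp add: br_def)

lemma two_lev_Suc: "2 ^ lev i * real (br i) = 2 ^ lev (Suc i)"
  using lev_mono[of i] by (simp add: br_def flip: power_add)

lemma lft_child: "lft (Suc i) (j * br i + l) = lft i j + real l * (1 / 2 ^ lev (Suc i))"
  using br_pos[of i] by (simp add: lft_def add_divide_distrib flip: two_lev_Suc)

lemma atom_child: "atom (Suc i) j \<subseteq> atom i (j div br i)"
proof -
  define a where "a = j div br i"
  define l where "l = j mod br i"
  have j: "j = a * br i + l" by (simp add: a_def l_def)
  have "l + 1 \<le> br i" using br_pos[of i] by (simp add: l_def Suc_le_eq)
  hence "real (l + 1) \<le> real (br i)" by (simp only: of_nat_le_iff)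
  hence l: "real l + 1 \<le> real (br i)" by simp
  have "lft (Suc i) j + 1 / 2 ^ lev (Suc i) = lft i a + (real l + 1) * (1 / 2 ^ lev (Suc i))"
    unfolding j lft_child by (simp add: algebra_simps add_divide_distrib)
  also have "\<dots> \<le> lft i a + real (br i) * (1 / 2 ^ lev (Suc i))"
    using l by (intro add_left_mono mult_right_mono) auto
  also have "real (br i) * (1 / 2 ^ lev (Suc i)) = 1 / 2 ^ lev i"
    using br_pos[of i] by (simp flip: two_lev_Suc)
  finally have "lft (Suc i) j + 1 / 2 ^ lev (Suc i) \<le> lft i a + 1 / 2 ^ lev i" .
  moreover have "lft i a \<le> lft (Suc i) j" unfolding j lft_child by simp
  ultimately show ?thesis unfolding atom_def a_def[symmetric] by auto
qed

lemma MM_0: "MM 0 j = 0"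
  using avg_integer n_pos by (simp add: MM_def lft_def lev_def)

lemma MM_close:
  assumes "x \<in> atom i j"
  shows "\<bar>MM i j - T i x\<bar> \<le> C0 / c"
proof (cases "i = 0")
  case True
  thus ?thesis using C0_nonneg c_pos by (simp add: MM_0 T_def e_def)
next
  case False
  have "real (n (e i)) \<le> real (2 ^ lev i)" "real (2 ^ lev i) \<le> real (2 * n (e i))"
    using lev_bounds[of i] False by (simp_all only: of_nat_le_iff neq0_conv)
  hence "\<bar>(\<Sum>k=1..N. avg (lft i j) (1 / 2 ^ lev i) (n k)) - (\<Sum>k=1..e i. f (real (n k) * x))\<bar> \<le> C0"
    using e_bounds[of i] False assms by (intro avg_partial_sum) (auto simp: atom_def field_simps)
  hence "\<bar>(\<Sum>k=1..N. avg (lft i j) (1 / 2 ^ lev i) (n k)) - (\<Sum>k=1..e i. f (real (n k) * x))\<bar> / c \<le> C0 / c"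
    using c_pos by (intro divide_right_mono) auto
  thus ?thesis using c_pos by (simp add: MM_def T_def abs_divide flip: diff_divide_distrib)
qed

lemma T_diff: "T (Suc i) x - T i x = (\<Sum>k=e i+1..e (Suc i). f (real (n k) * x)) / c"
proof -
  have "{1..e (Suc i)} = {1..e i} \<union> {e i+1..e (Suc i)}" using e_mono[of i] by auto
  hence "(\<Sum>k=1..e (Suc i). f (real (n k) * x)) = (\<Sum>k=1..e i. f (real (n k) * x)) + (\<Sum>k=e i+1..e (Suc i). f (real (n k) * x))"
    by (simp only:) (rule sum.union_disjoint, auto)
  thus ?thesis by (simp add: T_def add_divide_distrib)
qed

lemma T_diff_bound: "\<bar>T (Suc i) x - T i x\<bar> \<le> real B * Z / c"
proof -
  have "\<bar>\<Sum>k=e i+1..e (Suc i). f (real (n k) * x)\<bar> \<le> (\<Sum>k=e i+1..e (Suc i). Z)"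
    by (rule order_trans[OF sum_abs sum_mono[OF f_bound]])
  also have "\<dots> = real (e (Suc i) - e i) * Z" by simp
  also have "\<dots> \<le> real B * Z" using e_Suc_diff[of i] Z_nonneg by (intro mult_right_mono) auto
  finally show ?thesis using c_pos by (simp add: T_diff abs_divide divide_right_mono)
qed

lemma lft_in_atom: "lft i j \<in> atom i j"
  by (simp add: atom_def)

lemma increment_close:
  assumes "x \<in> atom (Suc i) j"
  shows "\<bar>(MM (Suc i) j - MM i (j div br i)) - (T (Suc i) x - T i x)\<bar> \<le> 2 * C0 / c"
proof -
  have "x \<in> atom i (j div br i)" using assms atom_child by blast
  from MM_close[OF this] MM_close[OF assms] show ?thesis by simp
qed

definition bb :: real where
  "bb = (2 * C0 + real B * Z) / c"

sublocale tree: tree_martingale br MM bb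
proof
  fix i j
  show "br i > 0" by (rule br_pos)
  show "MM 0 0 = 0" by (rule MM_0)
  show "\<bar>MM (Suc i) j - MM i (j div br i)\<bar> \<le> bb"
    using increment_close[OF lft_in_atom, of i j] T_diff_bound[of i "lft (Suc i) j"]
    by (simp add: bb_def add_divide_distrib)
  have "(\<Sum>l<br i. MM (Suc i) (j * br i + l))
     = (\<Sum>k=1..N. \<Sum>l<br i. avg (lft i j + real l * (1 / 2 ^ lev (Suc i))) (1 / 2 ^ lev (Suc i)) (n k)) / c"
    unfolding MM_def lft_child by (subst sum.swap) (simp add: sum_divide_distrib)
  also have "\<dots> = (\<Sum>k=1..N. real (br i) * avg (lft i j) (real (br i) * (1 / 2 ^ lev (Suc i))) (n k)) / c"
    by (subst avg_refine) (auto simp: br_pos)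
  also have "real (br i) * (1 / 2 ^ lev (Suc i)) = 1 / 2 ^ lev i"
    using br_pos[of i] by (simp flip: two_lev_Suc)
  finally show "(\<Sum>l<br i. MM (Suc i) (j * br i + l)) = real (br i) * MM i j"
    by (simp add: MM_def sum_distrib_left)
qed

lemma W_eq: "real (tree.W i) = 2 ^ lev i"
proof (induction i)
  case 0
  show ?case by (simp add: lev_def)
next
  case (Suc i)
  have "real (tree.W (Suc i)) = real (tree.W i) * real (br i)" by (simp add: tree.W_def)
  thus ?case using Suc two_lev_Suc[of i] by simp
qed

definition Q :: "nat \<Rightarrow> real \<Rightarrow> real" where
  "Q i x = (\<Sum>i'<i. (T (Suc i') x - T i' x)\<^sup>2)"

text \<open>With \<open>u\<close> the gap between martingale increment and block sum
  \<open>y\<close>, the cross term obeys \<open>2 * \<bar>y\<bar> * \<bar>u\<bar> \<le> \<theta> *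
  y\<^sup>2 + u\<^sup>2 / \<theta>\<close>, and \<open>y\<^sup>2\<close> is absorbed into
  \<open>Q\<close>. Bounding \<open>y\<close> by \<open>B * Z / c\<close> instead would leave, over
  about N/B blocks and with \<open>c\<^sup>2\<close> of order N, a total error of order 1.\<close>

lemma S_close:
  assumes "\<theta> > 0"
  shows "x \<in> atom i j \<Longrightarrow> \<bar>tree.S i j - Q i x\<bar> \<le> \<theta> * Q i x + real i * ((1 + 1 / \<theta>) * (2 * C0 / c)\<^sup>2)"
proof (induction i arbitrary: j)
  case 0
  show ?case by (simp add: Q_def)
next
  case (Suc i)
  define D where "D = MM (Suc i) j - MM i (j div br i)"
  define y where "y = T (Suc i) x - T i x"
  define u where "u = D - y"
  have "\<bar>u\<bar> \<le> 2 * C0 / c" using increment_close[OF Suc.prems] by (simp add: u_def D_def y_def)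
  hence u2: "u\<^sup>2 \<le> (2 * C0 / c)\<^sup>2" using C0_nonneg c_pos by (intro power2_le_iff_abs_le[THEN iffD2]) auto
  have "\<bar>2 * y * u\<bar> \<le> \<theta> * y\<^sup>2 + 1 / \<theta> * u\<^sup>2"
  proof -
    have "0 \<le> (\<theta> * \<bar>y\<bar> - \<bar>u\<bar>)\<^sup>2 / \<theta>" using assms by simp
    also have "\<dots> = \<theta> * y\<^sup>2 + 1 / \<theta> * u\<^sup>2 - 2 * \<bar>y\<bar> * \<bar>u\<bar>"
      using assms by (simp add: power2_eq_square field_simps)
    finally show ?thesis by (simp add: abs_mult)
  qed
  moreover have "D\<^sup>2 - y\<^sup>2 = 2 * y * u + u\<^sup>2" by (simp add: u_def power2_eq_square algebra_simps)
  moreover have "(1 + 1 / \<theta>) * u\<^sup>2 = u\<^sup>2 + 1 / \<theta> * u\<^sup>2" by (simp add: algebra_simps)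
  ultimately have "\<bar>D\<^sup>2 - y\<^sup>2\<bar> \<le> \<theta> * y\<^sup>2 + (1 + 1 / \<theta>) * u\<^sup>2"
    using zero_le_power2[of u] by linarith
  also have "\<dots> \<le> \<theta> * y\<^sup>2 + (1 + 1 / \<theta>) * (2 * C0 / c)\<^sup>2"
    using u2 assms by (intro add_left_mono mult_left_mono) auto
  finally have "\<bar>D\<^sup>2 - y\<^sup>2\<bar> \<le> \<theta> * y\<^sup>2 + (1 + 1 / \<theta>) * (2 * C0 / c)\<^sup>2" .
  moreover have "\<bar>tree.S i (j div br i) - Q i x\<bar> \<le> \<theta> * Q i x + real i * ((1 + 1 / \<theta>) * (2 * C0 / c)\<^sup>2)"
    using Suc atom_child by blast
  moreover have "tree.S (Suc i) j = tree.S i (j div br i) + D\<^sup>2" "Q (Suc i) x = Q i x + y\<^sup>2"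
    by (simp_all add: D_def y_def Q_def)
  moreover have "real (Suc i) * ((1 + 1 / \<theta>) * (2 * C0 / c)\<^sup>2)
      = real i * ((1 + 1 / \<theta>) * (2 * C0 / c)\<^sup>2) + (1 + 1 / \<theta>) * (2 * C0 / c)\<^sup>2"
    by (simp only: of_nat_Suc distrib_right mult_1 add.commute)
  moreover have "\<theta> * Q (Suc i) x = \<theta> * Q i x + \<theta> * y\<^sup>2" by (simp add: Q_def y_def algebra_simps)
  ultimately show ?case by linarith
qed

definition Pr :: "nat \<Rightarrow> (nat \<times> nat) set" where
  "Pr r = (\<Union>i<r. {e i+1..e (Suc i)} \<times> {e i+1..e (Suc i)})"

lemma e_mono': "i \<le> i' \<Longrightarrow> e i \<le> e i'"
  by (rule lift_Suc_mono_le[of e]) (rule e_mono)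

lemma Q_eq: "c\<^sup>2 * Q r x = (\<Sum>(k, l)\<in>Pr r. f (real (n k) * x) * f (real (n l) * x))"
proof -
  have "(\<Sum>(k, l)\<in>Pr r. f (real (n k) * x) * f (real (n l) * x))
    = (\<Sum>i<r. \<Sum>(k, l)\<in>{e i+1..e (Suc i)} \<times> {e i+1..e (Suc i)}. f (real (n k) * x) * f (real (n l) * x))"
    unfolding Pr_def
  proof (rule sum.UNION_disjoint)
    show "\<forall>i\<in>{..<r}. \<forall>j\<in>{..<r}. i \<noteq> j \<longrightarrow>
       ({e i+1..e (Suc i)} \<times> {e i+1..e (Suc i)}) \<inter> ({e j+1..e (Suc j)} \<times> {e j+1..e (Suc j)}) = {}"
    proof (intro ballI impI)
      fix i j :: nat assume "i \<noteq> j"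
      hence "e (Suc i) \<le> e j \<or> e (Suc j) \<le> e i" by (auto intro: e_mono' simp: neq_iff Suc_le_eq)
      thus "({e i+1..e (Suc i)} \<times> {e i+1..e (Suc i)}) \<inter> ({e j+1..e (Suc j)} \<times> {e j+1..e (Suc j)}) = {}"
        by auto
    qed
  qed auto
  also have "\<dots> = (\<Sum>i<r. (\<Sum>k=e i+1..e (Suc i). f (real (n k) * x))\<^sup>2)"
    by (simp add: power2_eq_square sum_product sum.cartesian_product)
  also have "\<dots> = c\<^sup>2 * Q r x"
    using c_pos by (simp add: Q_def T_diff power_divide sum_distrib_left)
  finally show ?thesis ..
qed

lemma Pr_diag:
  assumes "N \<le> r * B" "k \<in> {1..N}"
  shows "(k, k) \<in> Pr r"
proof -
  \<comment> \<open>The shift by 1 is due to block \<open>i\<close> consisting of the indices from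
    \<open>i * B + 1\<close> on.\<close>
  define i where "i = (k - 1) div B"
  have B: "B > 0" using B_pos by simp
  have "k - 1 < r * B" using assms by auto
  hence "i < r" using B by (simp add: i_def less_mult_imp_div_less)
  moreover have "i * B \<le> k - 1" by (simp add: i_def)
  moreover have "k - 1 < Suc i * B" using B by (simp add: i_def dividend_less_div_times)
  ultimately show ?thesis using assms unfolding Pr_def
    by (auto simp: e_def intro!: bexI[of _ i])
qed

lemma Pr_sub: "Pr r \<subseteq> {1..N} \<times> {1..N}"
  using e_bounds(2) by (fastforce simp: Pr_def intro: order_trans)

lemma card_Pr: "card (Pr r) \<le> r * B\<^sup>2"
proof -
  have "card (Pr r) \<le> (\<Sum>i<r. card ({e i+1..e (Suc i)} \<times> {e i+1..e (Suc i)}))"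
    unfolding Pr_def by (rule card_UN_le) auto
  also have "\<dots> \<le> (\<Sum>i<r. B\<^sup>2)"
  proof (rule sum_mono)
    fix i
    have "card ({e i+1..e (Suc i)} \<times> {e i+1..e (Suc i)}) = (e (Suc i) - e i)\<^sup>2"
      by (simp add: card_cartesian_product power2_eq_square)
    also have "\<dots> \<le> B\<^sup>2" by (intro power_mono e_Suc_diff) auto
    finally show "card ({e i+1..e (Suc i)} \<times> {e i+1..e (Suc i)}) \<le> B\<^sup>2" .
  qed
  finally show ?thesis by simp
qed

text \<open>Markov's inequality, carrying integrals over the unit interval to frequencies of nodes.
  \<open>H\<close> has to be large on the whole atom.\<close>

lemma freq_le_integral:
  assumes H: "continuous_on UNIV H" "\<And>x. H x \<ge> 0" and \<kappa>: "\<kappa> > 0"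
    and P: "\<And>j x. P j \<Longrightarrow> x \<in> atom r j \<Longrightarrow> H x \<ge> \<kappa>"
  shows "tree.freq r P \<le> integral {0..1} H / \<kappa>"
proof -
  have int: "H integrable_on {a..b}" for a b
    by (intro integrable_continuous_interval continuous_on_subset[OF H(1)]) auto
  define h where "h = 1 / (2 ^ lev r :: real)"
  have at: "atom r j = {real j * h..real j * h + h}" for j by (simp add: atom_def lft_def h_def)
  have low: "\<kappa> * h \<le> integral (atom r j) H" if "P j" for j
  proof -
    have "\<kappa> * h = integral (atom r j) (\<lambda>_. \<kappa>)" by (simp add: at h_def)
    also have "\<dots> \<le> integral (atom r j) H"
      using P[OF that] int by (intro integral_le) (auto simp: at)
    finally show ?thesis .
  qed
  have "tree.freq r P * \<kappa> = (\<Sum>j | j < tree.W r \<and> P j. \<kappa> * h)"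
    by (simp add: tree.freq_def W_eq h_def)
  also have "\<dots> \<le> (\<Sum>j | j < tree.W r \<and> P j. integral (atom r j) H)"
    by (intro sum_mono low) auto
  also have "\<dots> \<le> (\<Sum>j<tree.W r. integral (atom r j) H)"
    by (intro sum_mono2) (auto simp: H(2) int at intro!: integral_nonneg)
  also have "\<dots> = integral {0..0 + real (tree.W r) * h} H"
    using sum_integral_adjacent[OF int, of h 0 "tree.W r"] by (simp add: at h_def)
  also have "real (tree.W r) * h = 1" by (simp add: W_eq h_def)
  finally show ?thesis using \<kappa> by (simp add: field_simps)
qed

lemma Q_continuous: "continuous_on UNIV (Q r)"
  unfolding Q_def T_diff
  by (intro continuous_intros continuous_on_compose2[OF f_continuous[of UNIV]]) (use c_pos in auto)

text \<open>Chebyshev for \<open>Q\<close> through \<open>integral_quadratic_form\<close>, after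
  passing from \<open>S\<close> to \<open>Q\<close> on each atom; 36 is the square of the 6 in
  \<open>\<delta> / 6\<close>.\<close>

lemma freq_S_bound:
  assumes R: "q ^ R0 > 2" "2 * R0 \<le> R"
    and L: "\<And>a b. a \<in> {1..d} \<Longrightarrow> b \<in> {1..d} \<Longrightarrow> dioph_count n N a b \<le> R"
    and r: "N \<le> r * B" and c: "c\<^sup>2 = real N * var"
    and \<delta>: "0 < \<delta>" "\<delta> \<le> 1" and small: "real r * ((1 + 12 / \<delta>) * (2 * C0 / c)\<^sup>2) \<le> \<delta> / 6"
  shows "tree.freq r (\<lambda>j. \<bar>tree.S r j - 1\<bar> > \<delta> / 2)
     \<le> 36 * (Z ^ 4 * (real (card freqs)) ^ 4 * (real r * (real B)\<^sup>2) * real R) / (\<delta>\<^sup>2 * c ^ 4)"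
proof -
  define H where "H = (\<lambda>x. (c\<^sup>2 * (Q r x - 1))\<^sup>2)"
  define \<kappa> where "\<kappa> = (c\<^sup>2 * (\<delta> / 6))\<^sup>2"
  have "tree.freq r (\<lambda>j. \<bar>tree.S r j - 1\<bar> > \<delta> / 2) \<le> integral {0..1} H / \<kappa>"
  proof (rule freq_le_integral)
    show "continuous_on UNIV H"
      unfolding H_def by (intro continuous_intros Q_continuous)
    show "\<kappa> > 0" using c_pos \<delta> by (simp add: \<kappa>_def)
    fix j x assume S: "\<bar>tree.S r j - 1\<bar> > \<delta> / 2" and x: "x \<in> atom r j"
    have "\<delta> / 6 \<le> \<bar>Q r x - 1\<bar>"
    proof (rule ccontr)
      assume "\<not> ?thesis"
      hence Q: "\<bar>Q r x - 1\<bar> < \<delta> / 6" by simp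
      \<comment> \<open>With \<open>\<theta> = \<delta> / 12\<close> and \<open>Q \<le> 2\<close>
        both parts of the error are at most \<open>\<delta> / 6\<close>; adding the deviation of
        \<open>Q\<close> stays below \<open>\<delta> / 2\<close>.\<close>
      have "\<bar>tree.S r j - Q r x\<bar> \<le> \<delta> / 12 * Q r x + real r * ((1 + 1 / (\<delta> / 12)) * (2 * C0 / c)\<^sup>2)"
        by (rule S_close) (use \<delta> x in auto)
      moreover have "\<delta> / 12 * Q r x \<le> \<delta> / 12 * 2" using Q \<delta> by (intro mult_left_mono; linarith)
      ultimately have "\<bar>tree.S r j - Q r x\<bar> \<le> \<delta> / 3" using small by simp
      thus False using Q S by linarith
    qed
    hence "c\<^sup>2 * (\<delta> / 6) \<le> c\<^sup>2 * \<bar>Q r x - 1\<bar>" by (rule mult_left_mono) simp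
    hence "\<bar>c\<^sup>2 * (\<delta> / 6)\<bar> \<le> \<bar>c\<^sup>2 * (Q r x - 1)\<bar>"
      using \<delta> by (simp only: abs_mult) simp
    thus "\<kappa> \<le> H x" unfolding \<kappa>_def H_def by (simp only: abs_le_square_iff)
  qed (simp add: H_def)
  also have "\<dots> \<le> (Z ^ 4 * (real (card freqs)) ^ 4 * (real r * (real B)\<^sup>2) * real R) / \<kappa>"
  proof (rule divide_right_mono)
    have H_eq: "H = (\<lambda>x. ((\<Sum>(k, l)\<in>Pr r. f (real (n k) * x) * f (real (n l) * x)) - real N * var)\<^sup>2)"
      unfolding H_def right_diff_distrib Q_eq by (simp add: c)
    have "integral {0..1} H \<le> Z ^ 4 * (real (card freqs)) ^ 4 * real (card (Pr r)) * real R"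
      unfolding H_eq by (rule integral_quadratic_form(2)[OF R L Pr_sub Pr_diag[OF r]])
    also have "\<dots> \<le> Z ^ 4 * (real (card freqs)) ^ 4 * (real (r * B\<^sup>2)) * real R"
      using card_Pr[of r] Z_nonneg by (intro mult_right_mono mult_left_mono of_nat_mono) auto
    finally show "integral {0..1} H \<le> Z ^ 4 * (real (card freqs)) ^ 4 * (real r * (real B)\<^sup>2) * real R" by simp
  qed (simp add: \<kappa>_def)
  also have "\<dots> = 36 * (Z ^ 4 * (real (card freqs)) ^ 4 * (real r * (real B)\<^sup>2) * real R) / (\<delta>\<^sup>2 * c ^ 4)"
  proof -
    have "A / (c\<^sup>2 * (\<delta> / 6))\<^sup>2 = 36 * A / (\<delta>\<^sup>2 * c ^ 4)" for A
      using c_pos \<delta> by (simp add: power_divide power_mult_distrib mult_ac flip: power_mult)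
    thus ?thesis by (simp only: \<kappa>_def)
  qed
  finally show ?thesis .
qed

lemma unit_interval_atoms:
  assumes "x \<in> {0..1}"
  obtains j where "j < tree.W r" "x \<in> atom r j"
proof (cases "x = 1")
  case True
  have "x \<in> atom r (tree.W r - 1)"
    using tree.W_pos[of r] by (simp add: True atom_def lft_def of_nat_diff W_eq diff_divide_distrib)
  thus ?thesis using that[of "tree.W r - 1"] tree.W_pos[of r] by simp
next
  case False
  define j where "j = nat \<lfloor>x * 2 ^ lev r\<rfloor>"
  have x: "0 \<le> x" "x < 1" using assms False by auto
  have j: "real j \<le> x * 2 ^ lev r" "x * 2 ^ lev r < real j + 1"
    unfolding j_def using x by (auto simp: of_nat_nat)
  have "x * 2 ^ lev r < 1 * 2 ^ lev r" using x by (intro mult_strict_right_mono) auto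
  hence "real j < real (tree.W r)" unfolding W_eq using j by linarith
  hence "j < tree.W r" by (simp only: of_nat_less_iff)
  moreover have "x \<in> atom r j" using j by (simp add: atom_def lft_def field_simps)
  ultimately show ?thesis using that by simp
qed

text \<open>\<open>N \<le> r * B\<close> makes the last block end at \<open>N\<close>, so
  \<open>T r\<close> is the full normalised sum; replacing it by \<open>MM r\<close> costs
  \<open>C0 / c\<close> in the level.\<close>

lemma measure_le_freq:
  assumes r: "N \<le> r * B"
  shows "measure unit_lebesgue {x \<in> space unit_lebesgue. lacunary_sum n f N x \<ge> t * c}
    \<le> tree.freq r (\<lambda>j. MM r j \<ge> t - C0 / c)"
proof -
  define J where "J = {j. j < tree.W r \<and> MM r j \<ge> t - C0 / c}"
  have e: "e r = N" using r by (simp add: e_def)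
  define A where "A = {x \<in> space unit_lebesgue. lacunary_sum n f N x \<ge> t * c}"
  have sub: "A \<subseteq> (\<Union>j\<in>J. atom r j)"
  proof
    fix x assume x: "x \<in> A"
    hence "x \<in> {0..1}" by (simp add: A_def space_restrict_space)
    then obtain j where j: "j < tree.W r" "x \<in> atom r j" by (rule unit_interval_atoms)
    have "t \<le> T r x" using x c_pos by (simp add: A_def T_def e lacunary_sum_def field_simps)
    hence "j \<in> J" using MM_close[OF j(2)] j(1) by (simp add: J_def)
    thus "x \<in> (\<Union>j\<in>J. atom r j)" using j by auto
  qed
  have "measure unit_lebesgue A = measure lborel A"
    by (rule measure_restrict_space) (auto simp: A_def space_restrict_space)
  also have "\<dots> \<le> measure lborel (\<Union>j\<in>J. atom r j)"
  proof (rule measure_mono_fmeasurable[OF sub])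
    have "f \<in> borel_measurable borel" by (rule borel_measurable_continuous_onI) (rule f_continuous)
    hence "lacunary_sum n f N \<in> borel_measurable borel"
      unfolding lacunary_sum_def[abs_def] by measurable
    moreover have "A = {x \<in> space borel. lacunary_sum n f N x \<ge> t * c} \<inter> {0..1}"
      by (auto simp: A_def space_restrict_space)
    ultimately show "A \<in> sets lborel" by simp
    show "(\<Union>j\<in>J. atom r j) \<in> fmeasurable lborel"
    proof (rule fmeasurable.finite_UN)
      show "atom r j \<in> fmeasurable lborel" for j
        using fmeasurable_cbox[of "lft r j" "lft r j + 1 / 2 ^ lev r"] by (simp add: atom_def)
    qed (simp add: J_def)
  qed
  also have "\<dots> \<le> (\<Sum>j\<in>J. measure lborel (atom r j))"
    by (rule measure_UNION_le) (auto simp: J_def atom_def)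
  also have "\<dots> = tree.freq r (\<lambda>j. MM r j \<ge> t - C0 / c)"
    by (simp add: atom_def tree.freq_def J_def W_eq)
  finally show ?thesis by (simp add: A_def)
qed

theorem lacunary_tail_bound:
  assumes R: "q ^ R0 > 2" "2 * R0 \<le> R"
    and L: "\<And>a b. a \<in> {1..d} \<Longrightarrow> b \<in> {1..d} \<Longrightarrow> dioph_count n N a b \<le> R"
    and r: "N \<le> r * B" and c: "c\<^sup>2 = real N * var"
    and \<delta>: "0 < \<delta>" "\<delta> \<le> 1" and small: "real r * ((1 + 12 / \<delta>) * (2 * C0 / c)\<^sup>2) \<le> \<delta> / 6"
    and Y: "Y \<ge> 0" "s0 > 0" "\<eta> > 0" "(1 + Y) / sqrt s0 * bb \<le> 1"
  shows "measure unit_lebesgue {x \<in> space unit_lebesgue. lacunary_sum n f N x \<ge> t * c}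
    \<le> 36 * (Z ^ 4 * (real (card freqs)) ^ 4 * (real r * (real B)\<^sup>2) * real R) / (\<delta>\<^sup>2 * c ^ 4)
      + 4 * real r * bb ^ 4 / \<delta>\<^sup>2
      + exp (3 * ((1 + Y) / sqrt s0) ^ 3 * bb * (1 + \<delta>))
        * (400 * exp (- Y) + gauss_tail ((t - C0 / c - \<eta>) / sqrt (s0 + 1 + \<delta>)))
        / gauss_tail (- \<eta> / sqrt (s0 + 2 * \<delta>))"
  using measure_le_freq[OF r, of t] freq_S_bound[OF R L r c \<delta> small]
    tree.tail_bound[OF Y(1,2) \<delta>(1) Y(3,4), of r "t - C0 / c"]
  by linarith

end

section \<open>Choice of parameters\<close>

text \<open>Here \<open>l\<close> is the logarithm of g. The recurring factor
  \<open>3 * (1 + 2 * sqrt l) * exp (- a * l)\<close> bounds 1 / (g (1 - Phi t)). The first summand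
  is the exceptional set; in the second, the first exponential is the supermartingale error, 400
  marks the constant in \<open>U\<close>, the last exponential is the perturbed level and the
  denominator is the smoothing loss.\<close>

definition tail_ratio_bound :: "real \<Rightarrow> real \<Rightarrow> real \<Rightarrow> real \<Rightarrow> real" where
  "tail_ratio_bound A C a l =
     A * l ^ 30 * (3 * (1 + 2 * sqrt l) * exp (- a * l)) +
     exp (162 * C * (l ^ 17 * exp (- l / 2)))
       * (400 * (3 * (1 + 2 * sqrt l) * exp (- a * l)) + exp ((1 + 2 * sqrt l) * (6 / l)))
       / gauss_tail (- sqrt (l / 3))"

lemma tail_ratio_bound_tendsto:
  assumes a: "a > 0"
  shows "(tail_ratio_bound A C a \<longlongrightarrow> 1) at_top"
proof -
  have 1: "((\<lambda>l::real. l ^ 30 * (3 * (1 + 2 * sqrt l) * exp (- a * l))) \<longlongrightarrow> 0) at_top"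
    using a by real_asymp
  have 2: "((\<lambda>l::real. l ^ 17 * exp (- l / 2)) \<longlongrightarrow> 0) at_top" by real_asymp
  have 3: "((\<lambda>l::real. 3 * (1 + 2 * sqrt l) * exp (- a * l)) \<longlongrightarrow> 0) at_top"
    using a by real_asymp
  have 4: "((\<lambda>l::real. exp ((1 + 2 * sqrt l) * (6 / l))) \<longlongrightarrow> 1) at_top" by real_asymp
  have "filterlim (\<lambda>l::real. sqrt (l / 3)) at_top at_top" by real_asymp
  hence "((\<lambda>l::real. gauss_tail (sqrt (l / 3))) \<longlongrightarrow> 0) at_top"
    by (rule filterlim_compose[OF gauss_tail_tendsto])
  hence "((\<lambda>l::real. 1 - gauss_tail (sqrt (l / 3))) \<longlongrightarrow> 1 - 0) at_top"
    by (intro tendsto_intros)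
  hence 5: "((\<lambda>l::real. gauss_tail (- sqrt (l / 3))) \<longlongrightarrow> 1) at_top"
    by (simp add: gauss_tail_minus)
  have "((\<lambda>l. A * (l ^ 30 * (3 * (1 + 2 * sqrt l) * exp (- a * l))) +
     exp (162 * C * (l ^ 17 * exp (- l / 2)))
       * (400 * (3 * (1 + 2 * sqrt l) * exp (- a * l)) + exp ((1 + 2 * sqrt l) * (6 / l)))
       / gauss_tail (- sqrt (l / 3))) \<longlongrightarrow> A * 0 + exp (162 * C * 0) * (400 * 0 + 1) / 1) at_top"
    by (intro tendsto_add tendsto_mult tendsto_divide tendsto_exp tendsto_const 1 2 3 4 5) auto
  thus ?thesis by (simp add: tail_ratio_bound_def[abs_def] mult.assoc)
qed

text \<open>By the Mills ratio \<open>gauss_tail t\<close> is at least the density divided by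
  \<open>1 + t\<close>; the 3 bounds \<open>sqrt (2 * pi)\<close>.\<close>

lemma gauss_tail_lower:
  assumes "0 \<le> t" "t \<le> (1 - \<epsilon>) * sqrt (2 * l)" "0 < \<epsilon>" "\<epsilon> \<le> 1" "l \<ge> 1"
  shows "exp (- l) \<le> gauss_tail t * (3 * (1 + 2 * sqrt l) * exp (- (1 - (1 - \<epsilon>)\<^sup>2) * l))"
    and "t \<le> 2 * sqrt l"
proof -
  have s: "sqrt (2 * l) \<le> 2 * sqrt l"
  proof -
    have "sqrt (2 * l) \<le> sqrt (4 * l)" using assms by (intro real_sqrt_le_mono) auto
    thus ?thesis by (simp add: real_sqrt_mult)
  qed
  have "t \<le> 1 * sqrt (2 * l)" using assms by (intro order_trans[OF assms(2)] mult_right_mono) auto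
  thus t: "t \<le> 2 * sqrt l" using s by simp
  have "t\<^sup>2 \<le> ((1 - \<epsilon>) * sqrt (2 * l))\<^sup>2" using assms by (intro power_mono) auto
  also have "\<dots> = (1 - \<epsilon>)\<^sup>2 * (2 * l)" using assms by (simp add: power_mult_distrib)
  finally have t2: "t\<^sup>2 / 2 \<le> (1 - \<epsilon>)\<^sup>2 * l" by simp
  have sq: "sqrt (2 * pi) \<le> 3" using pi_less_4 by (intro real_le_lsqrt) auto
  have "1 = std_normal_density t * (sqrt (2 * pi) * exp (t\<^sup>2 / 2))"
    by (simp add: std_normal_density_def exp_minus)
  also have "\<dots> \<le> ((1 + t) * gauss_tail t) * (3 * exp ((1 - \<epsilon>)\<^sup>2 * l))"
    using mills_ratio_pos[OF assms(1)] sq t2 assms(1) gauss_tail_nonneg[of t] by (intro mult_mono) auto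
  also have "\<dots> \<le> ((1 + 2 * sqrt l) * gauss_tail t) * (3 * exp ((1 - \<epsilon>)\<^sup>2 * l))"
    using t gauss_tail_nonneg[of t] by (intro mult_right_mono) auto
  finally have "exp (- l) * 1 \<le> exp (- l) * (((1 + 2 * sqrt l) * gauss_tail t) * (3 * exp ((1 - \<epsilon>)\<^sup>2 * l)))"
    by (intro mult_left_mono) auto
  also have "\<dots> = gauss_tail t * (3 * (1 + 2 * sqrt l) * (exp (- l) * exp ((1 - \<epsilon>)\<^sup>2 * l)))" by simp
  also have "exp (- l) * exp ((1 - \<epsilon>)\<^sup>2 * l) = exp (- (1 - (1 - \<epsilon>)\<^sup>2) * l)"
    by (simp add: algebra_simps flip: exp_add)
  finally show "exp (- l) \<le> gauss_tail t * (3 * (1 + 2 * sqrt l) * exp (- (1 - (1 - \<epsilon>)\<^sup>2) * l))" by simp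
qed

text \<open>The perturbed argument is at least \<open>t - 6 / l\<close>: the shifts cost
  \<open>2 / l\<close> and the division by the square root at most \<open>4 / l\<close>. Then
  \<open>gauss_tail_shift\<close> applies.\<close>

lemma gauss_tail_perturbed:
  assumes t: "0 \<le> t" "t \<le> 2 * sqrt l" and l: "l \<ge> 1" and \<theta>: "0 \<le> \<theta>" "\<theta> \<le> 1 / l"
  shows "gauss_tail ((t - \<theta> - 1 / l) / sqrt (1 / l ^ 3 + 1 + 1 / l ^ 3))
     \<le> gauss_tail t * exp ((1 + 2 * sqrt l) * (6 / l))"
proof -
  define \<rho> where "\<rho> = 2 / l ^ 3"
  define D where "D = sqrt (1 + \<rho>)"
  define u where "u = t - \<theta> - 1 / l"
  have \<rho>: "\<rho> > 0" using l by (simp add: \<rho>_def)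
  have D: "1 \<le> D" "D \<le> 1 + \<rho>"
    unfolding D_def using \<rho> by (auto intro!: real_le_lsqrt simp: power2_eq_square algebra_simps)
  have u: "u \<le> t" using \<theta> l by (simp add: u_def)
  \<comment> \<open>Division by \<open>D \<ge> 1\<close> moves \<open>u\<close> towards 0: a loss of
    at most \<open>t * \<rho>\<close> for nonnegative \<open>u\<close>, a gain for negative
    \<open>u\<close>.\<close>
  have "u - t * \<rho> \<le> u / D"
  proof (cases "u \<ge> 0")
    case True
    have "(u - t * \<rho>) * D \<le> u"
    proof (cases "u - t * \<rho> \<ge> 0")
      case True
      have "(u - t * \<rho>) * D \<le> (u - t * \<rho>) * (1 + \<rho>)" using True D by (intro mult_left_mono)
      also have "\<dots> = u - (t - u) * \<rho> - t * \<rho> * \<rho>" by (simp add: algebra_simps)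
      also have "\<dots> \<le> u"
      proof -
        have "0 \<le> (t - u) * \<rho>" "0 \<le> t * \<rho> * \<rho>" using u t \<rho> by auto
        thus ?thesis by linarith
      qed
      finally show ?thesis .
    next
      case False
      hence "(u - t * \<rho>) * D \<le> 0" using D by (intro mult_nonpos_nonneg) auto
      thus ?thesis using \<open>u \<ge> 0\<close> by simp
    qed
    thus ?thesis using D by (simp add: field_simps)
  next
    case False
    have "u - t * \<rho> \<le> u" using t \<rho> by simp
    also have "u * D \<le> u * 1" using False D by (intro mult_left_mono_neg) auto
    hence "u \<le> u / D" using D by (simp add: field_simps)
    finally show ?thesis .
  qed
  moreover have "t * \<rho> \<le> 4 / l"
  proof -
    have "sqrt l \<le> l" using l by (intro real_le_lsqrt) (auto simp: power2_eq_square mult_le_cancel_left1)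
    hence "t \<le> 2 * l" using t by linarith
    hence "t * \<rho> \<le> (2 * l) * \<rho>" using \<rho> by (intro mult_right_mono) auto
    also have "\<dots> = 4 / l ^ 2" using l by (simp add: \<rho>_def power2_eq_square power3_eq_cube)
    also have "\<dots> \<le> 4 / l" using l by (intro divide_left_mono) (auto simp: power2_eq_square)
    finally show ?thesis .
  qed
  moreover have "t - 2 / l \<le> u" using \<theta> by (simp add: u_def)
  moreover have "2 / l + 4 / l = 6 / l" by simp
  ultimately have "t - 6 / l \<le> u / D" by linarith
  hence "gauss_tail (u / D) \<le> gauss_tail (t - 6 / l)" by (rule gauss_tail_antimono)
  also have "\<dots> \<le> gauss_tail t * exp ((1 + t) * (t - (t - 6 / l)))"
    using l t by (intro gauss_tail_shift) auto
  also have "\<dots> \<le> gauss_tail t * exp ((1 + 2 * sqrt l) * (6 / l))"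
    using l t gauss_tail_nonneg[of t] by (intro mult_left_mono) (auto intro!: mult_right_mono divide_right_mono)
  finally show ?thesis by (simp add: u_def D_def \<rho>_def algebra_simps)
qed

context lacunary_trig
begin

text \<open>Chosen so that the increment bound \<open>bb\<close> is at most
  \<open>C1 * l ^ 8 / sqrt N\<close> once \<open>B \<le> 2 * l ^ 8\<close>.\<close>

definition C1 :: real where
  "C1 = (2 * C0 + 2 * Z) / sqrt var"

text \<open>The four growth conditions on \<open>l\<close> after \<open>l \<ge> 1\<close> ensure in
  turn that a block fits below \<open>N\<close>, that the comparison of \<open>S\<close> with
  \<open>Q\<close> is accurate, that \<open>K * bb \<le> 1\<close>, and that the level shift
  \<open>C0 / c\<close> is at most \<open>1 / l\<close>.\<close>

lemma tail_bound_explicit: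
  fixes N R0 :: nat and l G Cd t \<epsilon> :: real
  assumes var: "var > 0" and R0: "q ^ R0 > 2"
    and G: "G = exp l" "G \<le> real N" and Cd: "Cd \<ge> 0"
    and L: "\<And>a b. a \<in> {1..d} \<Longrightarrow> b \<in> {1..d} \<Longrightarrow> real (dioph_count n N a b) \<le> Cd * (real N / G)"
    and l: "l \<ge> 1" "2 * l ^ 8 \<le> exp l" "624 * C0\<^sup>2 / var \<le> l\<^sup>2"
      "3 * C1 * (l ^ 11 * exp (- l / 2)) \<le> 1" "C0 / sqrt var * (l * exp (- l / 2)) \<le> 1"
    and t: "0 \<le> t" "t \<le> (1 - \<epsilon>) * sqrt (2 * l)" and \<epsilon>: "0 < \<epsilon>" "\<epsilon> \<le> 1"
  shows "measure unit_lebesgue {x \<in> space unit_lebesgue. lacunary_sum n f N x \<ge> t * sqrt var * sqrt (real N)}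
    \<le> gauss_tail t * tail_ratio_bound
          (144 * Z ^ 4 * real (card freqs) ^ 4 * (Cd + 1 + 2 * real R0) / var\<^sup>2 + 8 * C1 ^ 4)
          C1 (1 - (1 - \<epsilon>)\<^sup>2) l"
proof -
  define c where "c = sqrt var * sqrt (real N)"
  define B where "B = nat \<lceil>l ^ 8\<rceil>"
  \<comment> \<open>One extra block guarantees \<open>N \<le> r * B\<close>, while
    \<open>B \<le> N\<close> keeps \<open>r * B \<le> 2 * N\<close>.\<close>
  define r where "r = N div B + 1"
  \<comment> \<open>A single integer above both \<open>dioph_count\<close> and the lacunary count
    \<open>2 * R0\<close>.\<close>
  define R where "R = nat \<lceil>Cd * (real N / G)\<rceil> + 2 * R0"
  \<comment> \<open>Serves both as tolerance for the conditional variance and as smoothing time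
    \<open>s0\<close>.\<close>
  define \<delta> where "\<delta> = 1 / l ^ 3"
  define x where "x = exp (- l / 2)"
  have Gpos: "G > 0" using G by simp
  hence Npos: "real N > 0" using G by linarith
  have NG: "real N / G \<ge> 1" using G Gpos by simp
  have c: "c > 0" "c\<^sup>2 = real N * var" using var Npos by (auto simp: c_def power_mult_distrib)
  have l8: "l ^ 8 \<ge> 1" using l by (intro one_le_power) auto
  have B1: "l ^ 8 \<le> real B" unfolding B_def by (rule real_nat_ceiling_ge)
  have "real B \<le> l ^ 8 + 1" unfolding B_def using l8 by linarith
  hence B2: "real B \<le> 2 * l ^ 8" using l8 by linarith
  have B3: "B \<ge> 1" using B1 l8 by (metis of_nat_1 of_nat_le_iff order_trans)
  have "real B \<le> real N" using B2 l(2) G by linarith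
  hence BN: "B \<le> N" by simp
  interpret lacunary_blocks n q d f fh N B c
    by unfold_locales (use Npos B3 c in auto)
  have r1: "N \<le> r * B"
    using dividend_less_times_div[of B N] B3 by (simp add: r_def algebra_simps)
  have "B * (N div B) \<le> N" by (rule times_div_less_eq_dividend)
  moreover have "r * B = B * (N div B) + B" by (simp add: r_def algebra_simps)
  ultimately have "r * B \<le> 2 * N" using BN by linarith
  hence rB: "real r * real B \<le> 2 * real N" by (metis of_nat_le_iff of_nat_mult of_nat_numeral)
  have rl: "real r \<le> 2 * real N / l ^ 8"
  proof -
    have "real r * l ^ 8 \<le> real r * real B" using B1 by (intro mult_left_mono) auto
    hence "real r * l ^ 8 \<le> 2 * real N" using rB by linarith
    moreover have "0 < l ^ 8" using l8 by linarith
    ultimately show ?thesis by (subst pos_le_divide_eq)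
  qed
  have rB2: "real r * (real B)\<^sup>2 \<le> 4 * real N * l ^ 8"
  proof -
    have "real r * (real B)\<^sup>2 = (real r * real B) * real B" by (simp add: power2_eq_square)
    also have "\<dots> \<le> (2 * real N) * (2 * l ^ 8)" using rB B2 by (rule mult_mono) auto
    finally show ?thesis by simp
  qed
  have R: "real R \<le> (Cd + 1 + 2 * real R0) * (real N / G)"
  proof -
    have "0 \<le> Cd * (real N / G)" using NG by (intro mult_nonneg_nonneg Cd) linarith
    hence "real R \<le> Cd * (real N / G) + (1 + 2 * real R0) * 1" unfolding R_def by (simp; linarith)
    also have "\<dots> \<le> Cd * (real N / G) + (1 + 2 * real R0) * (real N / G)"
      using NG by (intro add_left_mono mult_left_mono) auto
    finally show ?thesis by (simp only: distrib_right mult_1 add.assoc)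
  qed
  have LR: "dioph_count n N a b \<le> R" if "a \<in> {1..d}" "b \<in> {1..d}" for a b
    using L[OF that] unfolding R_def by linarith
  have C1: "C1 \<ge> 0" using C0_nonneg Z_nonneg var by (simp add: C1_def)
  have x: "x > 0" "x\<^sup>2 = 1 / G" by (auto simp: x_def G exp_minus power2_eq_square field_simps simp flip: exp_add)
  have Nx: "1 / sqrt (real N) \<le> x"
  proof -
    have "x = 1 / sqrt G" using x Gpos by (metis less_imp_le real_sqrt_divide real_sqrt_one real_sqrt_unique)
    moreover have "1 / sqrt (real N) \<le> 1 / sqrt G" using G Gpos Npos by (intro divide_left_mono) auto
    ultimately show ?thesis by simp
  qed
  have bb: "bb \<le> C1 * l ^ 8 * (1 / sqrt (real N))"
  proof -
    have "2 * C0 * 1 + real B * Z \<le> 2 * C0 * l ^ 8 + (2 * l ^ 8) * Z"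
      using l8 B2 C0_nonneg Z_nonneg by (intro add_mono mult_left_mono mult_right_mono) auto
    hence "bb \<le> (2 * C0 * l ^ 8 + (2 * l ^ 8) * Z) / c" unfolding bb_def using c by (intro divide_right_mono) auto
    also have "\<dots> = C1 * l ^ 8 * (1 / sqrt (real N))"
      by (simp add: C1_def c_def algebra_simps add_divide_distrib)
    finally show ?thesis .
  qed
  have bbx: "bb \<le> C1 * l ^ 8 * x"
    using l8 C1 by (intro order_trans[OF bb] mult_left_mono Nx) auto
  have bb0: "bb \<ge> 0" by (rule tree.b_nonneg)
  have \<delta>: "0 < \<delta>" "\<delta> \<le> 1" using l(1) by (auto simp: \<delta>_def)
  have l0: "l > 0" using l by simp
  define \<beta> where "\<beta> = (1 + 2 * l) / sqrt \<delta>"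
  have \<beta>: "0 \<le> \<beta>" "\<beta> \<le> 3 * l ^ 3"
  proof -
    have "sqrt (l ^ 3) \<le> l ^ 2"
      using l(1) by (intro real_le_lsqrt) (auto simp: power_increasing simp flip: power_mult)
    hence "(1 + 2 * l) * sqrt (l ^ 3) \<le> (3 * l) * l ^ 2" using l(1) by (intro mult_mono) auto
    moreover have "\<beta> = (1 + 2 * l) * sqrt (l ^ 3)" by (simp add: \<beta>_def \<delta>_def real_sqrt_divide)
    ultimately show "\<beta> \<le> 3 * l ^ 3" by (simp add: power3_eq_cube power2_eq_square)
  qed (use l0 \<delta> in \<open>simp add: \<beta>_def\<close>)
  have small: "real r * ((1 + 12 / \<delta>) * (2 * C0 / c)\<^sup>2) \<le> \<delta> / 6"
  proof -
    have "real r * ((1 + 12 / \<delta>) * (2 * C0 / c)\<^sup>2)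
      \<le> (2 * real N / l ^ 8) * ((13 * l ^ 3) * (2 * C0 / c)\<^sup>2)"
      using l(1) by (intro mult_mono rl mult_right_mono) (auto simp: \<delta>_def)
    \<comment> \<open>624 = 6 * 2 * 13 * 4, the 6 coming from the target
      \<open>\<delta> / 6\<close>.\<close>
    also have "\<dots> = (624 * C0\<^sup>2 / var) / (6 * l ^ 5)"
      using Npos var l0 by (simp add: power_divide power_mult_distrib c) (simp add: field_simps flip: power_add)
    also have "\<dots> \<le> l\<^sup>2 / (6 * l ^ 5)" using l0 l(3) by (intro divide_right_mono) auto
    also have "\<dots> = \<delta> / 6" using l0 by (simp add: \<delta>_def field_simps flip: power_add)
    finally show ?thesis .
  qed
  have \<beta>bb: "\<beta> * bb \<le> 1"
  proof -
    have "\<beta> * bb \<le> (3 * l ^ 3) * (C1 * l ^ 8 * x)"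
      using \<beta> bbx bb0 l0 by (intro mult_mono) auto
    also have "\<dots> = 3 * C1 * (l ^ 11 * x)" by (simp flip: power_add)
    finally show ?thesis using l(4) by (simp add: x_def)
  qed
  have \<beta>3: "3 * \<beta> ^ 3 * bb * (1 + \<delta>) \<le> 162 * C1 * (l ^ 17 * x)"
  proof -
    have "3 * \<beta> ^ 3 * bb * (1 + \<delta>) \<le> 3 * (3 * l ^ 3) ^ 3 * (C1 * l ^ 8 * x) * 2"
      using \<beta> bbx bb0 l0 \<delta> C1 x
      by (intro mult_mono power_mono) (auto intro!: mult_nonneg_nonneg)
    also have "\<dots> = 162 * C1 * (l ^ 17 * x)" by (simp add: power_mult_distrib flip: power_mult power_add)
    finally show ?thesis .
  qed
  define \<psi> where "\<psi> = 3 * (1 + 2 * sqrt l) * exp (- (1 - (1 - \<epsilon>)\<^sup>2) * l)"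
  define Qd where "Qd = gauss_tail (- sqrt (l / 3))"
  have Qd: "Qd > 0" by (simp add: Qd_def gauss_tail_pos)
  note low = gauss_tail_lower[OF t \<epsilon> l(1)]
  have x\<psi>: "1 / G \<le> gauss_tail t * \<psi>"
    using low(1) by (simp add: \<psi>_def G exp_minus field_simps)
  have p1: "36 * (Z ^ 4 * real (card freqs) ^ 4 * (real r * (real B)\<^sup>2) * real R) / (\<delta>\<^sup>2 * c ^ 4)
     \<le> (144 * Z ^ 4 * real (card freqs) ^ 4 * (Cd + 1 + 2 * real R0) / var\<^sup>2) * l ^ 14 * (1 / G)"
  proof -
    define zz where "zz = Z ^ 4 * real (card freqs) ^ 4"
    have zz: "zz \<ge> 0" by (simp add: zz_def)
    have c4: "c ^ 4 = (real N * var)\<^sup>2" by (simp flip: c(2) power_mult)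
    have "36 * (zz * (real r * (real B)\<^sup>2) * real R) / (\<delta>\<^sup>2 * c ^ 4)
      \<le> 36 * (zz * (4 * real N * l ^ 8) * ((Cd + 1 + 2 * real R0) * (real N / G))) / (\<delta>\<^sup>2 * c ^ 4)"
      using zz l0 c by (intro divide_right_mono mult_left_mono mult_mono[OF mult_left_mono[OF rB2 zz] R]) auto
    also have "\<dots> = (144 * zz * (Cd + 1 + 2 * real R0) / var\<^sup>2) * l ^ 14 * (1 / G)"
    proof -
      have "36 * (zz * (4 * real N * u) * (k * (real N / G))) / ((1 / w)\<^sup>2 * (real N * var)\<^sup>2)
          = (144 * zz * k / var\<^sup>2) * (u * w\<^sup>2) * (1 / G)" for u k w
        using Npos var by (simp add: field_simps power2_eq_square)
      from this[of "l ^ 8" _ "l ^ 3"] show ?thesis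
        by (simp add: c4 \<delta>_def flip: power_mult power_add)
    qed
    finally show ?thesis by (simp add: zz_def mult.assoc)
  qed
  have p2: "4 * real r * bb ^ 4 / \<delta>\<^sup>2 \<le> 8 * C1 ^ 4 * l ^ 30 * (1 / G)"
  proof -
    have "4 * real r * bb ^ 4 / \<delta>\<^sup>2 \<le> 4 * (2 * real N / l ^ 8) * (C1 * l ^ 8 * (1 / sqrt (real N))) ^ 4 / \<delta>\<^sup>2"
      using rl bb bb0 by (intro divide_right_mono mult_mono power_mono) auto
    \<comment> \<open>The power 30 is 32 from the fourth power of the increments, minus 8 from the
      number of blocks, plus 6 from \<open>1 / \<delta>\<^sup>2\<close>.\<close>
    also have "\<dots> = 8 * C1 ^ 4 * l ^ 30 * (1 / real N)"
    proof -
      have "sqrt (real N) ^ 4 = real N * real N" by (simp add: power4_eq_xxxx)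
      hence "4 * (2 * real N / u) * (C1 * u * (1 / sqrt (real N))) ^ 4 / (1 / w)\<^sup>2 = 8 * C1 ^ 4 * (u ^ 3 * w\<^sup>2) * (1 / real N)"
        if "u > 0" "w > 0" for u w
        using Npos that by (simp add: power_mult_distrib power_divide) (simp add: field_simps eval_nat_numeral)
      from this[of "l ^ 8" "l ^ 3"] show ?thesis
        using l0 by (simp add: \<delta>_def flip: power_mult power_add)
    qed
    also have "\<dots> \<le> 8 * C1 ^ 4 * l ^ 30 * (1 / G)"
      using G(2) Gpos Npos C1 l0 by (intro mult_left_mono divide_left_mono mult_pos_pos) auto
    finally show ?thesis .
  qed
  define A where "A = 144 * Z ^ 4 * real (card freqs) ^ 4 * (Cd + 1 + 2 * real R0) / var\<^sup>2 + 8 * C1 ^ 4"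
  have p12: "36 * (Z ^ 4 * real (card freqs) ^ 4 * (real r * (real B)\<^sup>2) * real R) / (\<delta>\<^sup>2 * c ^ 4)
      + 4 * real r * bb ^ 4 / \<delta>\<^sup>2 \<le> gauss_tail t * (A * l ^ 30 * \<psi>)"
  proof -
    define A1 where "A1 = 144 * Z ^ 4 * real (card freqs) ^ 4 * (Cd + 1 + 2 * real R0) / var\<^sup>2"
    have A1: "A1 \<ge> 0" using Cd by (simp add: A1_def)
    have "A1 * l ^ 14 * (1 / G) \<le> A1 * l ^ 30 * (1 / G)"
      using A1 l(1) Gpos by (intro mult_right_mono mult_left_mono power_increasing) auto
    with p1 p2 have "36 * (Z ^ 4 * real (card freqs) ^ 4 * (real r * (real B)\<^sup>2) * real R) / (\<delta>\<^sup>2 * c ^ 4)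
      + 4 * real r * bb ^ 4 / \<delta>\<^sup>2 \<le> A1 * l ^ 30 * (1 / G) + 8 * C1 ^ 4 * l ^ 30 * (1 / G)"
      unfolding A1_def by linarith
    also have "\<dots> = (A * l ^ 30) * (1 / G)" by (simp add: A_def A1_def algebra_simps add_divide_distrib)
    also have "\<dots> \<le> (A * l ^ 30) * (gauss_tail t * \<psi>)"
    proof (rule mult_left_mono[OF x\<psi>])
      have "A = A1 + 8 * C1 ^ 4" by (simp only: A_def A1_def)
      thus "0 \<le> A * l ^ 30" using A1 C1 l0 by simp
    qed
    finally show ?thesis by (simp add: mult_ac)
  qed
  have cC0: "C0 / c \<le> 1 / l"
  proof -
    have "C0 / c = C0 / sqrt var * (1 / sqrt (real N))" by (simp add: c_def)
    also have "\<dots> \<le> C0 / sqrt var * x" using C0_nonneg var by (intro mult_left_mono Nx) auto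
    finally have "(C0 / c) * l \<le> (C0 / sqrt var * x) * l" using l0 by (intro mult_right_mono) auto
    also have "\<dots> \<le> 1" using l(5) by (simp add: x_def mult_ac)
    finally show ?thesis using l0 by (simp add: field_simps)
  qed
  \<comment> \<open>With \<open>Y = 2 * l\<close> and \<open>s0 = \<delta>\<close> the constant
    \<open>K\<close> is \<open>\<beta>\<close>. The margin \<open>\<eta> = 1 / l\<close> amounts to
    \<open>sqrt (l / 3)\<close> standard deviations for the remaining time
    \<open>3 * \<delta>\<close>, so the last denominator tends to 1.\<close>
  have main: "measure unit_lebesgue {x \<in> space unit_lebesgue. lacunary_sum n f N x \<ge> t * c}
    \<le> 36 * (Z ^ 4 * real (card freqs) ^ 4 * (real r * (real B)\<^sup>2) * real R) / (\<delta>\<^sup>2 * c ^ 4)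
      + 4 * real r * bb ^ 4 / \<delta>\<^sup>2
      + exp (3 * \<beta> ^ 3 * bb * (1 + \<delta>))
        * (400 * exp (- (2 * l)) + gauss_tail ((t - C0 / c - 1 / l) / sqrt (\<delta> + 1 + \<delta>)))
        / gauss_tail (- (1 / l) / sqrt (\<delta> + 2 * \<delta>))"
    unfolding \<beta>_def
    by (rule lacunary_tail_bound[OF R0 _ LR r1 c(2) \<delta> small])
       (use l0 \<delta> \<beta>bb in \<open>auto simp: R_def \<beta>_def\<close>)
  have Qd_eq: "gauss_tail (- (1 / l) / sqrt (\<delta> + 2 * \<delta>)) = Qd"
  proof -
    have "(1 / l) / sqrt (\<delta> + 2 * \<delta>) = sqrt ((1 / l)\<^sup>2 / (3 * \<delta>))"
      using l0 by (simp add: real_sqrt_divide)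
    also have "(1 / l)\<^sup>2 / (3 * \<delta>) = l / 3" using l0 by (simp add: \<delta>_def power2_eq_square power3_eq_cube)
    finally show ?thesis by (simp add: Qd_def)
  qed
  have tail: "400 * exp (- (2 * l)) + gauss_tail ((t - C0 / c - 1 / l) / sqrt (\<delta> + 1 + \<delta>))
     \<le> gauss_tail t * (400 * \<psi> + exp ((1 + 2 * sqrt l) * (6 / l)))"
  proof -
    have "exp (- (2 * l)) \<le> exp (- l)" using l0 by simp
    also have "\<dots> \<le> gauss_tail t * \<psi>" using low(1) by (simp add: \<psi>_def)
    finally have "400 * exp (- (2 * l)) \<le> gauss_tail t * (400 * \<psi>)" by simp
    moreover have "gauss_tail ((t - C0 / c - 1 / l) / sqrt (\<delta> + 1 + \<delta>)) \<le> gauss_tail t * exp ((1 + 2 * sqrt l) * (6 / l))"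
      unfolding \<delta>_def using C0_nonneg c by (intro gauss_tail_perturbed t low l cC0) auto
    ultimately show ?thesis by (simp add: distrib_left)
  qed
  have "exp (3 * \<beta> ^ 3 * bb * (1 + \<delta>))
        * (400 * exp (- (2 * l)) + gauss_tail ((t - C0 / c - 1 / l) / sqrt (\<delta> + 1 + \<delta>))) / Qd
     \<le> exp (162 * C1 * (l ^ 17 * x)) * (gauss_tail t * (400 * \<psi> + exp ((1 + 2 * sqrt l) * (6 / l)))) / Qd"
    using \<beta>3 tail Qd gauss_tail_nonneg by (intro divide_right_mono mult_mono) auto
  with main p12 have "measure unit_lebesgue {x \<in> space unit_lebesgue. lacunary_sum n f N x \<ge> t * c}
    \<le> gauss_tail t * (A * l ^ 30 * \<psi>)
     + exp (162 * C1 * (l ^ 17 * x)) * (gauss_tail t * (400 * \<psi> + exp ((1 + 2 * sqrt l) * (6 / l)))) / Qd"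
    unfolding Qd_eq by linarith
  also have "\<dots> = gauss_tail t * tail_ratio_bound A C1 (1 - (1 - \<epsilon>)\<^sup>2) l"
    unfolding tail_ratio_bound_def \<psi>_def[symmetric] x_def[symmetric] Qd_def[symmetric]
    by (simp add: distrib_left mult_ac)
  finally show ?thesis by (simp only: A_def c_def mult.assoc)
qed

end

section \<open>Passage to the complex form and the limit of large \<open>N\<close>\<close>

lemma mean_zero_trig_poly_complex:
  assumes "mean_zero_trig_poly d f"
  obtains fh where "trig_poly d f fh"
proof -
  obtain c s :: "nat \<Rightarrow> real" where f: "\<And>x. f x =
      (\<Sum>j=1..d. c j * cos (2 * pi * real j * x) + s j * sin (2 * pi * real j * x))"
    using assms unfolding mean_zero_trig_poly_def by blast
  \<comment> \<open>Euler's formula: the coefficient is \<open>(c j - \<i> * s j) / 2\<close> at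
    frequency \<open>j\<close> and its conjugate at \<open>- j\<close>; \<open>sgn\<close> covers
    both.\<close>
  define fh :: "int \<Rightarrow> complex" where
    "fh = (\<lambda>a. Complex (c (nat \<bar>a\<bar>) / 2) (- real_of_int (sgn a) * s (nat \<bar>a\<bar>) / 2))"
  have "trig_poly d f fh"
  proof
    fix x
    have split: "{- int d..int d} - {0} = int ` {1..d} \<union> (\<lambda>j. - int j) ` {1..d}"
    proof (intro set_eqI iffI)
      fix a assume a: "a \<in> {- int d..int d} - {0}"
      show "a \<in> int ` {1..d} \<union> (\<lambda>j. - int j) ` {1..d}"
      proof (cases "a > 0")
        case True
        hence "a = int (nat a)" "nat a \<in> {1..d}" using a by auto
        thus ?thesis by blast
      next
        case False
        hence "a = - int (nat (- a))" "nat (- a) \<in> {1..d}" using a by auto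
        thus ?thesis by blast
      qed
    qed auto
    have "(\<Sum>a\<in>{- int d..int d} - {0}. fh a * ex a x)
       = (\<Sum>a\<in>int ` {1..d}. fh a * ex a x) + (\<Sum>a\<in>(\<lambda>j. - int j) ` {1..d}. fh a * ex a x)"
      unfolding split by (rule sum.union_disjoint) auto
    also have "\<dots> = (\<Sum>j=1..d. fh (int j) * ex (int j) x + fh (- int j) * ex (- int j) x)"
      by (simp add: sum.reindex inj_on_def sum.distrib)
    also have "\<dots> = (\<Sum>j=1..d. complex_of_real (c j * cos (2 * pi * real j * x) + s j * sin (2 * pi * real j * x)))"
      by (intro sum.cong refl) (auto simp: fh_def ex_def complex_eq_iff field_simps)
    also have "\<dots> = complex_of_real (f x)" by (simp add: f)
    finally show "complex_of_real (f x) = (\<Sum>a\<in>{- int d..int d} - {0}. fh a * ex a x)" ..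
    show "fh (- a) = cnj (fh a)" for a by (simp add: fh_def complex_eq_iff)
  qed
  thus ?thesis using that by blast
qed

lemma mean_zero_trig_poly_uminus:
  assumes "mean_zero_trig_poly d f"
  shows "mean_zero_trig_poly d (\<lambda>x. - f x)"
proof -
  obtain c s :: "nat \<Rightarrow> real" where f: "\<And>x. f x =
      (\<Sum>j=1..d. c j * cos (2 * pi * real j * x) + s j * sin (2 * pi * real j * x))"
    using assms unfolding mean_zero_trig_poly_def by blast
  show ?thesis
    unfolding mean_zero_trig_poly_def
    by (intro exI[of _ "\<lambda>j. - c j"] exI[of _ "\<lambda>j. - s j"]) (simp add: f sum_negf algebra_simps flip: sum_negf)
qed

text \<open>Uniformity in \<open>t\<close> is automatic: \<open>tail_bound_explicit\<close> involves
  \<open>t\<close> only through the factor \<open>gauss_tail t\<close>, and the other factor is a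
  function of \<open>ln (g N)\<close> alone that tends to 1.\<close>

lemma upper_deviations:
  fixes n :: "nat \<Rightarrow> nat" and q :: real and g :: "nat \<Rightarrow> real"
    and f :: "real \<Rightarrow> real" and d :: nat and \<epsilon> \<omega> :: real
  assumes n_pos: "\<And>k. k \<ge> 1 \<Longrightarrow> n k > 0"
    and q_gt_1: "q > 1"
    and hadamard_gap: "\<And>k. k \<ge> 1 \<Longrightarrow> real (n (k + 1)) / real (n k) \<ge> q"
    and g_bounds: "\<And>N. N \<ge> 1 \<Longrightarrow> 1 \<le> g N \<and> g N \<le> real N"
    and g_unbounded: "filterlim g at_top sequentially"
    and f_trig_poly: "mean_zero_trig_poly d f"
    and f_nonzero: "\<exists>x. f x \<noteq> 0"
    and L_bound: "\<And>a b. a \<in> {1..d} \<Longrightarrow> b \<in> {1..d} \<Longrightarrow>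
          (\<lambda>N. real (dioph_count n N a b)) \<in> O(\<lambda>N. real N / g N)"
    and eps: "0 < \<epsilon>" "\<epsilon> \<le> 1" and \<omega>: "\<omega> > 0"
  shows "\<forall>\<^sub>F N in sequentially. \<forall>t\<in>{0..(1 - \<epsilon>) * sqrt (2 * ln (g N))}.
     measure unit_lebesgue {x \<in> space unit_lebesgue. lacunary_sum n f N x \<ge> t * L2norm f * sqrt (real N)}
       \<le> (1 + \<omega>) * gauss_tail t"
proof -
  obtain fh where fh: "trig_poly d f fh" using mean_zero_trig_poly_complex[OF f_trig_poly] .
  have "lacunary n q"
    by unfold_locales (use n_pos q_gt_1 hadamard_gap in \<open>auto simp: field_simps\<close>)
  then interpret lacunary_trig n q d f fh
    using fh by (simp add: lacunary_trig_def)
  have var: "var > 0" using f_nonzero var_pos by blast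
  have L2: "L2norm f = sqrt var" using L2norm_eq by (metis real_sqrt_unique)
  obtain R0 where R0: "q ^ R0 > 2" using real_arch_pow[OF q_gt_1] by blast
  have "\<forall>p\<in>{1..d} \<times> {1..d}. \<exists>C\<ge>0. \<forall>\<^sub>F N in sequentially. real (dioph_count n N (fst p) (snd p)) \<le> C * (real N / g N)"
  proof
    fix p assume p: "p \<in> {1..d} \<times> {1..d}"
    hence "(\<lambda>N. real (dioph_count n N (fst p) (snd p))) \<in> O(\<lambda>N. real N / g N)"
      by (intro L_bound) auto
    then obtain C where C: "C > 0" "\<forall>\<^sub>F N in sequentially. norm (real (dioph_count n N (fst p) (snd p))) \<le> C * norm (real N / g N)"
      by (rule landau_o.bigE)
    from C(2) eventually_ge_at_top[of 1]
    have "\<forall>\<^sub>F N in sequentially. real (dioph_count n N (fst p) (snd p)) \<le> C * (real N / g N)"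
    proof eventually_elim
      case (elim N)
      thus ?case using g_bounds[of N] by simp
    qed
    thus "\<exists>C\<ge>0. \<forall>\<^sub>F N in sequentially. real (dioph_count n N (fst p) (snd p)) \<le> C * (real N / g N)"
      using C(1) by (intro exI[of _ C]) auto
  qed
  then obtain Cf where Cf: "\<And>p. p \<in> {1..d} \<times> {1..d} \<Longrightarrow> Cf p \<ge> 0"
     "\<And>p. p \<in> {1..d} \<times> {1..d} \<Longrightarrow> \<forall>\<^sub>F N in sequentially. real (dioph_count n N (fst p) (snd p)) \<le> Cf p * (real N / g N)"
    by metis
  \<comment> \<open>There are finitely many pairs of coefficients, so the sum of their constants
    works for all of them.\<close>
  define Cd where "Cd = (\<Sum>p\<in>{1..d} \<times> {1..d}. Cf p)"
  have Cd: "Cd \<ge> 0" unfolding Cd_def by (intro sum_nonneg Cf)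
  have "\<forall>\<^sub>F N in sequentially. \<forall>p\<in>{1..d} \<times> {1..d}. real (dioph_count n N (fst p) (snd p)) \<le> Cf p * (real N / g N)"
    using Cf(2) by (intro eventually_ball_finite) auto
  hence ev_L: "\<forall>\<^sub>F N in sequentially. \<forall>p\<in>{1..d} \<times> {1..d}. real (dioph_count n N (fst p) (snd p)) \<le> Cd * (real N / g N)"
    using eventually_ge_at_top[of 1]
  proof eventually_elim
    case (elim N)
    show ?case
    proof
      fix p assume p: "p \<in> {1..d} \<times> {1..d}"
      have "Cf p \<le> Cd" unfolding Cd_def using p Cf(1) by (intro member_le_sum) auto
      hence "Cf p * (real N / g N) \<le> Cd * (real N / g N)"
        using g_bounds[OF elim(2)] by (intro mult_right_mono) auto
      thus "real (dioph_count n N (fst p) (snd p)) \<le> Cd * (real N / g N)"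
        using elim(1) p by force
    qed
  qed
  define A where "A = 144 * Z ^ 4 * real (card freqs) ^ 4 * (Cd + 1 + 2 * real R0) / var\<^sup>2 + 8 * C1 ^ 4"
  have a: "1 - (1 - \<epsilon>)\<^sup>2 > 0" using eps by (simp add: power2_eq_square algebra_simps)
  have ln_g: "filterlim (\<lambda>N. ln (g N)) at_top sequentially"
    by (rule filterlim_compose[OF ln_at_top g_unbounded])
  have "\<forall>\<^sub>F l in at_top. tail_ratio_bound A C1 (1 - (1 - \<epsilon>)\<^sup>2) l < 1 + \<omega>"
    by (rule order_tendstoD(2)[OF tail_ratio_bound_tendsto[OF a]]) (use \<omega> in auto)
  moreover have "\<forall>\<^sub>F l::real in at_top. l \<ge> 1" by (rule eventually_ge_at_top)
  moreover have "\<forall>\<^sub>F l::real in at_top. 2 * l ^ 8 \<le> exp l" by real_asymp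
  moreover have "\<forall>\<^sub>F l::real in at_top. 624 * C0\<^sup>2 / var \<le> l\<^sup>2"
  proof -
    have "filterlim (\<lambda>l::real. l\<^sup>2) at_top at_top" by real_asymp
    thus ?thesis by (simp add: filterlim_at_top)
  qed
  moreover have "\<forall>\<^sub>F l::real in at_top. 3 * C1 * (l ^ 11 * exp (- l / 2)) < 1"
  proof -
    have "((\<lambda>l::real. l ^ 11 * exp (- l / 2)) \<longlongrightarrow> 0) at_top" by real_asymp
    hence "((\<lambda>l::real. 3 * C1 * (l ^ 11 * exp (- l / 2))) \<longlongrightarrow> 3 * C1 * 0) at_top" by (intro tendsto_intros)
    thus ?thesis by (intro order_tendstoD(2)) auto
  qed
  moreover have "\<forall>\<^sub>F l::real in at_top. C0 / sqrt var * (l * exp (- l / 2)) < 1"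
  proof -
    have "((\<lambda>l::real. l * exp (- l / 2)) \<longlongrightarrow> 0) at_top" by real_asymp
    hence "((\<lambda>l::real. C0 / sqrt var * (l * exp (- l / 2))) \<longlongrightarrow> C0 / sqrt var * 0) at_top" by (intro tendsto_intros) (use var in auto)
    thus ?thesis by (intro order_tendstoD(2)) auto
  qed
  ultimately have "\<forall>\<^sub>F l in at_top. tail_ratio_bound A C1 (1 - (1 - \<epsilon>)\<^sup>2) l < 1 + \<omega> \<and> l \<ge> 1 \<and> 2 * l ^ 8 \<le> exp l
     \<and> 624 * C0\<^sup>2 / var \<le> l\<^sup>2 \<and> 3 * C1 * (l ^ 11 * exp (- l / 2)) < 1 \<and> C0 / sqrt var * (l * exp (- l / 2)) < 1"
    by eventually_elim auto
  from eventually_compose_filterlim[OF this ln_g] ev_L eventually_ge_at_top[of 1]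
  show ?thesis
  proof eventually_elim
    case (elim N)
    define l where "l = ln (g N)"
    have gN: "1 \<le> g N" "g N \<le> real N" using g_bounds[OF elim(3)] by auto
    hence G: "g N = exp l" by (simp add: l_def)
    note el = elim(1)[folded l_def]
    show ?case
    proof
      fix t assume t: "t \<in> {0..(1 - \<epsilon>) * sqrt (2 * ln (g N))}"
      have "measure unit_lebesgue {x \<in> space unit_lebesgue. lacunary_sum n f N x \<ge> t * sqrt var * sqrt (real N)}
        \<le> gauss_tail t * tail_ratio_bound A C1 (1 - (1 - \<epsilon>)\<^sup>2) l"
        unfolding A_def
      proof (rule tail_bound_explicit[OF var R0 G gN(2) Cd])
        fix a b assume "a \<in> {1..d}" "b \<in> {1..d}"
        thus "real (dioph_count n N a b) \<le> Cd * (real N / g N)" using elim(2) by force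
      qed (use el t eps in \<open>auto simp: l_def\<close>)
      also have "\<dots> \<le> gauss_tail t * (1 + \<omega>)"
        using el gauss_tail_nonneg[of t] by (intro mult_left_mono) auto
      finally show "measure unit_lebesgue {x \<in> space unit_lebesgue. lacunary_sum n f N x \<ge> t * L2norm f * sqrt (real N)}
       \<le> (1 + \<omega>) * gauss_tail t" by (simp add: L2 mult.commute)
    qed
  qed
qed

lemma mean_zero_trig_poly_continuous:
  assumes "mean_zero_trig_poly d f"
  shows "continuous_on A f"
proof -
  obtain fh where "trig_poly d f fh" using mean_zero_trig_poly_complex[OF assms] .
  thus ?thesis by (rule trig_poly.f_continuous)
qed

text \<open>At every point the sum for \<open>f\<close> or the sum for \<open>- f\<close> is
  nonnegative, so the two events cover the unit interval. An upper bound for one event thus becomes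
  a lower bound for the other.\<close>

lemma measure_nonneg_part:
  assumes "continuous_on UNIV f"
  shows "1 \<le> measure unit_lebesgue {x \<in> space unit_lebesgue. lacunary_sum n f N x \<ge> 0}
     + measure unit_lebesgue {x \<in> space unit_lebesgue. lacunary_sum n (\<lambda>x. - f x) N x \<ge> 0}"
    (is "1 \<le> measure _ ?A + measure _ ?B")
proof -
  have "f \<in> borel_measurable borel" by (rule borel_measurable_continuous_onI) fact
  hence "lacunary_sum n f N \<in> borel_measurable borel"
    unfolding lacunary_sum_def[abs_def] by measurable
  hence m [measurable]: "lacunary_sum n f N \<in> borel_measurable unit_lebesgue"
    by (intro measurable_restrict_space1) simp
  have neg: "lacunary_sum n (\<lambda>x. - f x) N x = - lacunary_sum n f N x" for x
    by (simp add: lacunary_sum_def sum_negf)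
  have sets: "?A \<in> sets unit_lebesgue" "?B \<in> sets unit_lebesgue"
    unfolding neg by measurable
  have "?A \<union> ?B = space unit_lebesgue" by (auto simp: neg)
  hence "measure unit_lebesgue (space unit_lebesgue) \<le> measure unit_lebesgue ?A + measure unit_lebesgue ?B"
    using measure_Un_le[OF sets] by simp
  moreover have "measure unit_lebesgue (space unit_lebesgue) = 1"
    by (subst measure_restrict_space) (auto simp: space_restrict_space)
  ultimately show ?thesis by simp
qed

theorem theoremA:
  fixes n :: "nat \<Rightarrow> nat" and q :: real and g :: "nat \<Rightarrow> real"
    and f :: "real \<Rightarrow> real" and d :: nat and \<epsilon> :: real
  assumes n_pos: "\<And>k. k \<ge> 1 \<Longrightarrow> n k > 0"
    and q_gt_1: "q > 1"
    and hadamard_gap: "\<And>k. k \<ge> 1 \<Longrightarrow> real (n (k + 1)) / real (n k) \<ge> q"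
    and g_bounds: "\<And>N. N \<ge> 1 \<Longrightarrow> 1 \<le> g N \<and> g N \<le> real N"
    and g_mono: "mono_on {1..} g"
    and quotient_mono: "mono_on {1..} (\<lambda>N. real N / g N)"
    and g_unbounded: "filterlim g at_top sequentially"
    and f_trig_poly: "mean_zero_trig_poly d f"
    and f_nonzero: "\<exists>x. f x \<noteq> 0"
    and L_bound: "\<And>a b. a \<in> {1..d} \<Longrightarrow> b \<in> {1..d} \<Longrightarrow>
          (\<lambda>N. real (dioph_count n N a b)) \<in> O(\<lambda>N. real N / g N)"
    and eps_pos: "\<epsilon> > 0"
    and eps_le_1: "\<epsilon> \<le> 1"
  shows "(\<lambda>N. SUP t \<in> {0..(1 - \<epsilon>) * sqrt (2 * ln (g N))}.
            measure unit_lebesgue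
              {x \<in> space unit_lebesgue. lacunary_sum n f N x \<ge> t * L2norm f * sqrt (real N)}
            / (1 - Phi t)) \<longlonglongrightarrow> 1"
proof -
  define P where "P = (\<lambda>N t. measure unit_lebesgue
              {x \<in> space unit_lebesgue. lacunary_sum n f N x \<ge> t * L2norm f * sqrt (real N)})"
  define I where "I = (\<lambda>N. {0..(1 - \<epsilon>) * sqrt (2 * ln (g N))})"
  \<comment> \<open>At \<open>t = 0\<close> the norm disappears from the event, so the norms of
    \<open>f\<close> and \<open>- f\<close> need not be compared.\<close>
  have f': "mean_zero_trig_poly d (\<lambda>x. - f x)" "\<exists>x. - f x \<noteq> 0"
    using mean_zero_trig_poly_uminus[OF f_trig_poly] f_nonzero by auto
  have upper: "\<forall>\<^sub>F N in sequentially. \<forall>t\<in>{0..(1 - \<epsilon>) * sqrt (2 * ln (g N))}.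
     measure unit_lebesgue {x \<in> space unit_lebesgue. lacunary_sum n f' N x \<ge> t * L2norm f' * sqrt (real N)}
       \<le> (1 + \<omega>) * gauss_tail t"
    if "mean_zero_trig_poly d f'" "\<exists>x. f' x \<noteq> 0" "\<omega> > 0" for f' \<omega>
    using that
    by (intro upper_deviations[of n q g] n_pos q_gt_1 hadamard_gap g_bounds g_unbounded L_bound
          eps_pos eps_le_1)
  have "\<forall>\<^sub>F N in sequentially. \<bar>(SUP t \<in> I N. P N t / (1 - Phi t)) - 1\<bar> < \<omega>" if \<omega>: "\<omega> > 0" for \<omega>
  proof -
    have \<omega>2: "\<omega> / 2 > 0" using \<omega> by simp
    from upper[OF f_trig_poly f_nonzero \<omega>2] upper[OF f' \<omega>2] eventually_ge_at_top[of 1]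
    show ?thesis
    proof eventually_elim
      case (elim N)
      have I0: "0 \<in> I N"
        using g_bounds[OF elim(3)] eps_le_1 by (auto simp: I_def intro!: mult_nonneg_nonneg)
      have le: "P N t / (1 - Phi t) \<le> 1 + \<omega> / 2" if "t \<in> I N" for t
      proof -
        have "P N t \<le> (1 + \<omega> / 2) * gauss_tail t" using elim(1) that by (simp add: P_def I_def)
        thus ?thesis using gauss_tail_pos[of t] by (simp add: gauss_tail_def divide_le_eq)
      qed
      hence "(SUP t \<in> I N. P N t / (1 - Phi t)) \<le> 1 + \<omega> / 2"
        using I0 by (intro cSUP_least) auto
      moreover have "1 - \<omega> / 2 \<le> (SUP t \<in> I N. P N t / (1 - Phi t))"
      proof -
        have "measure unit_lebesgue {x \<in> space unit_lebesgue. lacunary_sum n (\<lambda>x. - f x) N x \<ge> 0}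
            \<le> (1 + \<omega> / 2) / 2"
          using bspec[OF elim(2) I0[unfolded I_def]] by (simp add: gauss_tail_0)
        moreover have "P N 0 = measure unit_lebesgue {x \<in> space unit_lebesgue. lacunary_sum n f N x \<ge> 0}"
          by (simp add: P_def)
        ultimately have "1 - (1 + \<omega> / 2) / 2 \<le> P N 0"
          using measure_nonneg_part[OF mean_zero_trig_poly_continuous[OF f_trig_poly], of n N]
          by linarith
        hence "1 - \<omega> / 2 \<le> 2 * P N 0" by argo
        moreover have Phi_0: "1 - Phi 0 = 1 / 2"
          using gauss_tail_0 by (simp add: gauss_tail_def)
        ultimately have "1 - \<omega> / 2 \<le> P N 0 / (1 - Phi 0)" unfolding Phi_0 by argo
        also have "\<dots> \<le> (SUP t \<in> I N. P N t / (1 - Phi t))"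
          using le I0 by (intro cSUP_upper bdd_aboveI2[where M = "1 + \<omega> / 2"]) auto
        finally show ?thesis .
      qed
      ultimately show ?case using \<omega> by linarith
    qed
  qed
  thus ?thesis
    unfolding tendsto_iff dist_real_def by (simp add: P_def I_def)
qed

end
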